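(* Let $A,G\in\mathbb{C}^{n\times n}$, $B\in\mathbb{C}^{n\times m}$, $\Gamma\in\mathbb{C}^{m\times m}$ with $G,\Gamma$ Hermitian and $\det\Gamma\neq 0$ ($\Gamma$ possibly sign indefinite). Then the Riccati inequality $$HA+A^{*}H+G-HB\Gamma^{-1}B^{*}H<0$$ (negative definiteness) has a Hermitian solution $H\in\mathbb{C}^{n\times n}$ if and only if $s(\omega)\ge 0$ for all $\omega\in\mathbb{R}$, where $s(\omega)=m_+(\omega)-m_-(\omega)-m_0(\omega)$ is the counting function, defined in the context, of the Jordan blocks of the matrix $$R=\begin{pmatrix}A&-B\Gamma^{-1}B^{*}\\ -G&-A^{*}\end{pmatrix}.$$
   Context: Let $J=\begin{pmatrix}0&-I\\ I&0\end{pmatrix}\in\mathbb{C}^{2n\times 2n}$. A matrix $K\in\mathbb{C}^{2n\times 2n}$ is called Hamiltonian if $JK$ is Hermitian; $R$ is Hamiltonian. "Imaginary axis" includes $0$. Index of a Jordan block. For a Hamiltonian matrix $R$ with Jordan blocks $J_1,\dots,J_N$ at imaginary-axis eigenvalues $i\omega_1,\dots,i\omega_N$ (upper triangular Jordan blocks with $i\omega_j$, $\omega_j\in\mathbb{R}$, on the diagonal and $1$ on the superdiagonal), of sizes $n_1,\dots,n_N$, it is known that there exist matrices $S_j\in\mathbb{C}^{2n\times n_j}$ with linearly independent columns, whose columns together form a basis of the sum of the root subspaces of $R$ at imaginary-axis eigenvalues, and numbers $\beta_j\in\{-1,1\}$, such that $RS_j=S_jJ_j$, $S_{j_1}^{*}JS_{j_2}=0$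 for $j_1\ne j_2$, and $S_j^{*}JS_j=\epsilon_jP_j$, where $P_j$ is the $n_j\times n_j$ matrix whose only nonzero entries are $(P_j)_{k,\,n_j+1-k}=(-1)^k$, $k=1,\dots,n_j$, and - $\epsilon_j=(-1)^{n_j/2}\beta_j$ if $n_j$ is even, - $\epsilon_j=(-1)^{(n_j-1)/2}\,i\,\beta_j$ if $n_j$ is odd. The number $\beta_j$ is called the index of $J_j$; the collection of triples (eigenvalue, size, index), with multiplicities, is uniquely determined by $R$. Counting function. For $\omega\in\mathbb{R}$ let - $m_+(\omega)$ be the number of Jordan blocks $J_j$ of odd size with $\omega_j<\omega$ and $\beta_j=1$; - $m_-(\omega)$ be the number of Jordan blocks $J_j$ of odd size with $\omega_j\le\omega$ and $\beta_j=-1$; - $m_0(\omega)$ be the number of Jordan blocks $J_j$ of even size with $\omega_j=\omega$ and $\beta_j=-1$; and $s(\omega)=m_+(\omega)-m_-(\omega)-m_0(\omega)$. *)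

theory Defs
  imports
    "Jordan_Normal_Form.Jordan_Normal_Form"
    "Jordan_Normal_Form.Schur_Decomposition"
    "HOL-Library.Multiset"
begin

definition hermitian_mat :: "complex mat \<Rightarrow> bool" where
  "hermitian_mat M \<longleftrightarrow> mat_adjoint M = M"

definition neg_definite :: "complex mat \<Rightarrow> bool" where
  "neg_definite M \<longleftrightarrow> hermitian_mat M \<and>
     (\<forall>x \<in> carrier_vec (dim_row M). x \<noteq> 0\<^sub>v (dim_row M) \<longrightarrow> Re ((M *\<^sub>v x) \<bullet>c x) < 0)"

text \<open>Meaningful for invertible matrices only.\<close>

definition inv_mat :: "complex mat \<Rightarrow> complex mat" where
  "inv_mat M = the (mat_inverse M)"

definition riccati_expr ::
  "complex mat \<Rightarrow> complex mat \<Rightarrow> complex mat \<Rightarrow> complex mat \<Rightarrow> complex mat \<Rightarrow> complex mat" where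
  "riccati_expr A B G \<Gamma> H =
     H * A + mat_adjoint A * H + G - H * B * inv_mat \<Gamma> * mat_adjoint B * H"

definition riccati_hamiltonian ::
  "complex mat \<Rightarrow> complex mat \<Rightarrow> complex mat \<Rightarrow> complex mat \<Rightarrow> complex mat" where
  "riccati_hamiltonian A B G \<Gamma> =
     four_block_mat A (- (B * inv_mat \<Gamma> * mat_adjoint B)) (- G) (- mat_adjoint A)"

definition symp_J :: "nat \<Rightarrow> complex mat" where
  "symp_J n = four_block_mat (0\<^sub>m n n) (- 1\<^sub>m n) (1\<^sub>m n) (0\<^sub>m n n)"

definition root_subspace :: "complex mat \<Rightarrow> complex \<Rightarrow> complex vec set" where
  "root_subspace R ev =
     {v \<in> carrier_vec (dim_row R). \<exists>k. (char_matrix R ev ^\<^sub>m k) *\<^sub>v v = 0\<^sub>v (dim_row R)}"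

text \<open>The sum runs over all of the imaginary axis; points that are not eigenvalues contribute
  the zero subspace.\<close>

definition imag_root_space :: "complex mat \<Rightarrow> complex vec set" where
  "imag_root_space R =
     LinearCombinations.module.span class_ring (module_vec TYPE(complex) (dim_row R))
       (\<Union>\<omega>::real. root_subspace R (Complex 0 \<omega>))"

text \<open>With matrix indices starting at 0, the nonzero entries $(P)_{k,\,n+1-k} = (-1)^k$ of the
  one-based description are at the positions (i, j) with i + j + 1 = n and have value
  $(-1)^{i+1}$.\<close>

definition alt_flip_mat :: "nat \<Rightarrow> complex mat" where
  "alt_flip_mat n = mat n n (\<lambda>(i, j). if i + j + 1 = n then (-1) ^ (i + 1) else 0)"

definition block_eps :: "nat \<Rightarrow> int \<Rightarrow> complex" where
  "block_eps n \<beta> =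
     (if even n then (-1) ^ (n div 2) * of_int \<beta>
      else (-1) ^ ((n - 1) div 2) * \<i> * of_int \<beta>)"

text \<open>Each entry \<open>(\<omega>, k, \<beta>)\<close> of \<open>bs\<close> stands for a Jordan block of size \<open>k\<close> at \<open>i\<omega>\<close> with index
  \<open>\<beta>\<close>; the matrix at the same position of \<open>Ss\<close> carries the corresponding Jordan chain. Since the
  columns of all matrices in \<open>Ss\<close> form a basis of the spectral subspace of \<open>R\<close> at the imaginary
  axis, the equations \<open>R * S = S * jordan_block k (i\<omega>)\<close> say that the blocks listed in \<open>bs\<close> are
  precisely the Jordan blocks of \<open>R\<close> at imaginary-axis eigenvalues.\<close>

definition indexed_jordan_basis ::
  "nat \<Rightarrow> complex mat \<Rightarrow> (real \<times> nat \<times> int) list \<Rightarrow> complex mat list \<Rightarrow> bool" where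
  "indexed_jordan_basis n R bs Ss \<longleftrightarrow>
     length Ss = length bs \<and>
     (\<forall>j < length bs. case bs ! j of (\<omega>, k, \<beta>) \<Rightarrow>
        k > 0 \<and> \<beta> \<in> {-1, 1} \<and>
        Ss ! j \<in> carrier_mat (2 * n) k \<and>
        R * Ss ! j = Ss ! j * jordan_block k (Complex 0 \<omega>) \<and>
        mat_adjoint (Ss ! j) * symp_J n * Ss ! j = block_eps k \<beta> \<cdot>\<^sub>m alt_flip_mat k) \<and>
     (\<forall>i < length bs. \<forall>j < length bs. i \<noteq> j \<longrightarrow>
        mat_adjoint (Ss ! i) * symp_J n * Ss ! j = 0\<^sub>m (dim_col (Ss ! i)) (dim_col (Ss ! j))) \<and>
     (let cs = concat (map cols Ss) in
        distinct cs \<and>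
        \<not> LinearCombinations.module.lin_dep class_ring (module_vec TYPE(complex) (2 * n)) (set cs) \<and>
        LinearCombinations.module.span class_ring (module_vec TYPE(complex) (2 * n)) (set cs) =
           imag_root_space R)"

text \<open>The multiset of triples (\<open>\<omega>\<close>, size, index). For a Hamiltonian matrix \<open>R\<close> of size \<open>2n\<close> such a
  multiset exists and is uniquely determined by \<open>R\<close>, so the choice operator picks that one.\<close>

definition indexed_blocks :: "nat \<Rightarrow> complex mat \<Rightarrow> (real \<times> nat \<times> int) multiset" where
  "indexed_blocks n R = (SOME M. \<exists>bs Ss. indexed_jordan_basis n R bs Ss \<and> M = mset bs)"

definition m_plus :: "nat \<Rightarrow> complex mat \<Rightarrow> real \<Rightarrow> nat" where
  "m_plus n R \<omega> = size {#(\<nu>, k, \<beta>) \<in># indexed_blocks n R. odd k \<and> \<nu> < \<omega> \<and> \<beta> = 1#}"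

definition m_minus :: "nat \<Rightarrow> complex mat \<Rightarrow> real \<Rightarrow> nat" where
  "m_minus n R \<omega> = size {#(\<nu>, k, \<beta>) \<in># indexed_blocks n R. odd k \<and> \<nu> \<le> \<omega> \<and> \<beta> = -1#}"

definition m_zero :: "nat \<Rightarrow> complex mat \<Rightarrow> real \<Rightarrow> nat" where
  "m_zero n R \<omega> = size {#(\<nu>, k, \<beta>) \<in># indexed_blocks n R. even k \<and> \<nu> = \<omega> \<and> \<beta> = -1#}"

definition s_count :: "nat \<Rightarrow> complex mat \<Rightarrow> real \<Rightarrow> int" where
  "s_count n R \<omega> = int (m_plus n R \<omega>) - int (m_minus n R \<omega>) - int (m_zero n R \<omega>)"

end

theory Submission
  imports Defs "HOL-Library.Function_Algebras"
begin

text \<open>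
  Put \<open>T = - i R\<close> and \<open>h x y = i y\<^sup>* J x\<close>. Then \<open>h\<close> is a Hermitian form of signature \<open>(n, n)\<close>,
  \<open>T\<close> is \<open>h\<close>-selfadjoint, and the graph of a Hermitian matrix \<open>H\<close> is a Lagrangian (isotropic of
  dimension \<open>n\<close>) subspace on which the form \<open>h (T v) v\<close> represents the Riccati expression. So the
  inequality is solvable iff there is a Lagrangian subspace on which \<open>h (T v) v\<close> is negative definite;
  that it can be taken to be a graph is a matter of a small perturbation. Rescaling the columns of the
  matrices \<open>S\<^sub>j\<close> by powers of \<open>i\<close> gives Jordan chains of \<open>T\<close> with
  \<open>h e\<^sub>i e\<^sub>j = \<kappa>\<close> for \<open>i + j + 1 = k\<close> and \<open>0\<close> otherwise, where \<open>\<kappa> = (-1)\<^bsup>k + 1\<^esup> \<beta>\<close>.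

  Necessity: on such a Lagrangian subspace \<open>h ((T - t) v) v\<close> is negative too, so every subspace on which
  this form is nonnegative has dimension at most \<open>n\<close>. Suitable initial segments of the Jordan chains,
  together with a half-dimensional subspace of the part of \<open>T\<close> without real eigenvalues on which
  \<open>h\<close> and \<open>h (T v) v\<close> vanish, form such a subspace, and its dimension yields \<open>s(t) \<ge> 0\<close>.

  Sufficiency: adding to \<open>T\<close> a small nonnegative perturbation in the corner of each Jordan block
  leaves only simple real eigenvalues: a positive eigenvector slightly to the right of \<open>\<omega>\<close> for each
  block with \<open>\<kappa> = 1\<close> and a negative one slightly to the left for each block with \<open>\<kappa> = (-1)\<^sup>k\<close>. The
  condition on \<open>s\<close> allows one to match each negative eigenvector with a positive one of a smaller
  eigenvalue; the sums of the matched pairs and a suitable half-dimensional subspace of the rest span the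
  required Lagrangian subspace.
\<close>

section \<open>Hermitian forms and selfadjoint operators\<close>

text \<open>The criterion is a count of excess. On a chain of length \<open>k\<close> the form
  \<open>h ((T - t) v) v\<close> vanishes on the first half, rounded down, and at most one further
  chain vector can be added with the form staying nonnegative; the position of \<open>t\<close>
  decides whether it can. Summed over the blocks, twice these dimensions minus the lengths is a
  constant minus twice \<open>s\<close> at \<open>t\<close>. In the perturbation, the corner entry
  of a block of size \<open>k\<close> has size \<open>d ^ k\<close>, so the eigenvalue equation
  becomes \<open>z ^ k = d ^ k * \<kappa>\<close>, whose only possible real solutions are
  \<open>d\<close> and \<open>- d\<close>. A nonnegative perturbation only raises
  \<open>h (T v) v\<close>, so negativity passes back to \<open>T\<close>. Since the passage to a
  graph changes the subspace, definiteness is carried along with a uniform constant. Vectors are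
  functions \<open>nat \<Rightarrow> complex\<close>, so that span and independence on a whole type
  apply; dimension bounds are attached to subspaces. The blocks of \<open>R\<close> enter through a
  choice operator, so an indexed Jordan basis must be shown to exist and be translated to and from
  chains of \<open>T\<close>.\<close>

locale hermitian_form = vector_space scale
  for scale :: "complex \<Rightarrow> 'a::ab_group_add \<Rightarrow> 'a" (infixr "*s" 75) +
  fixes h :: "'a \<Rightarrow> 'a \<Rightarrow> complex"
  assumes h_add_left: "h (x + y) z = h x z + h y z"
    and h_scale_left: "h (c *s x) z = c * h x z"
    and h_cnj: "cnj (h x y) = h y x"
begin

abbreviation lin :: "('a \<Rightarrow> 'a) \<Rightarrow> bool"
  where "lin T \<equiv> Modules.module_hom scale scale T"

lemma h_add_right: "h z (x + y) = h z x + h z y"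
  by (metis h_add_left h_cnj complex_cnj_add)

lemma h_scale_right: "h z (c *s x) = cnj c * h z x"
  by (metis h_scale_left h_cnj complex_cnj_mult)

lemma h_zero_left [simp]: "h 0 z = 0"
  by (metis h_scale_left scale_zero_left mult_zero_left)

lemma h_zero_right [simp]: "h z 0 = 0"
  by (metis h_zero_left h_cnj complex_cnj_zero)

lemma h_uminus_left: "h (- x) z = - h x z"
  by (metis add.right_inverse h_add_left h_zero_left minus_unique)

lemma h_diff_left: "h (x - y) z = h x z - h y z"
  by (metis diff_add_cancel h_add_left add_diff_cancel_right')

lemma h_diff_right: "h z (x - y) = h z x - h z y"
  by (metis diff_add_cancel h_add_right add_diff_cancel_right')

lemma h_sum_left: "h (sum f A) z = (\<Sum>a\<in>A. h (f a) z)"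
  by (induction A rule: infinite_finite_induct) (auto simp: h_add_left)

lemma h_sum_right: "h z (sum f A) = (\<Sum>a\<in>A. h z (f a))"
  by (induction A rule: infinite_finite_induct) (auto simp: h_add_right)

lemma h_eq_0_sym: "h x y = 0 \<longleftrightarrow> h y x = 0"
  by (metis h_cnj complex_cnj_zero_iff)

lemma h_self_real: "h x x = of_real (Re (h x x))"
  by (metis Reals_cnj_iff h_cnj complex_is_Real_iff of_real_Re)

lemma h_span_zero:
  assumes "\<And>x. x \<in> S \<Longrightarrow> h v x = 0" "y \<in> span S" shows "h v y = 0"
  using assms(2)
  by (induction rule: span_induct_alt) (auto simp: h_add_right h_scale_right assms(1))

section \<open>Orthogonal complements, bounded dimension and Gram systems\<close>

definition perp :: "'i set \<Rightarrow> ('i \<Rightarrow> 'a) \<Rightarrow> 'a set \<Rightarrow> 'a set"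
  where "perp I e W = {v \<in> W. \<forall>i\<in>I. h v (e i) = 0}"

lemma subspace_perp: assumes "subspace W" shows "subspace (perp I e W)"
  using assms by (auto simp: perp_def subspace_def h_add_left h_scale_left)

definition nondeg :: "'a set \<Rightarrow> bool"
  where "nondeg W \<longleftrightarrow> (\<forall>x\<in>W. (\<forall>y\<in>W. h x y = 0) \<longrightarrow> x = 0)"

text \<open>The ambient type may have infinite dimension, so only an upper bound on a subspace is
  recorded; \<open>m\<close> is the induction parameter of the structure results.\<close>

definition dim_le :: "nat \<Rightarrow> 'a set \<Rightarrow> bool"
  where "dim_le m W \<longleftrightarrow> (\<forall>B\<subseteq>W. independent B \<longrightarrow> finite B \<and> card B \<le> m)"

lemma dim_leD: "dim_le m W \<Longrightarrow> B \<subseteq> W \<Longrightarrow> independent B \<Longrightarrow> finite B \<and> card B \<le> m"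
  by (simp add: dim_le_def)

lemma dim_le_0: assumes "dim_le 0 W" "x \<in> W" shows "x = 0"
proof (rule ccontr)
  assume "x \<noteq> 0"
  then have "independent {x}" by simp
  moreover have "{x} \<subseteq> W" using assms(2) by simp
  ultimately have "card {x} \<le> 0" using dim_leD[OF assms(1)] by blast
  then show False by simp
qed

text \<open>A vector outside \<open>U\<close> extends every independent subset of \<open>U\<close>,
  so the bound drops by one. This drives the inductions that split off a chain or a hyperbolic
  pair.\<close>

lemma dim_le_proper:
  assumes "dim_le (Suc m) W" "U \<subseteq> W" "subspace U" "x \<in> W" "x \<notin> U"
  shows "dim_le m U"
  unfolding dim_le_def
proof (intro allI impI)
  fix B assume B: "B \<subseteq> U" "independent B"
  have "x \<notin> span B" using span_minimal[OF B(1) assms(3)] assms(5) by (rule contra_subsetD)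
  then have "independent (insert x B)" using B(2) by (rule independent_insertI)
  moreover have "x \<notin> B" using B(1) assms(5) by (rule contra_subsetD)
  moreover have "insert x B \<subseteq> W" using B(1) assms(2,4) by (simp only: insert_subset) (meson order_trans)
  ultimately have "finite (insert x B) \<and> card (insert x B) \<le> Suc m"
    by (intro dim_leD[OF assms(1)])
  then have "finite B" "card (insert x B) \<le> Suc m" by simp_all
  with \<open>x \<notin> B\<close> show "finite B \<and> card B \<le> m" by (simp only: card_insert_disjoint Suc_le_mono simp_thms)
qed

lemma dim_le_subset: "dim_le m W \<Longrightarrow> U \<subseteq> W \<Longrightarrow> dim_le m U"
  unfolding dim_le_def by blast

lemma dim_le_span: assumes "finite S" "W \<subseteq> span S" shows "dim_le (card S) W"
  unfolding dim_le_def using assms independent_span_bound by (meson order_trans)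

text \<open>A finite family whose Gram matrix has exactly one nonzero entry in each row and column,
  placed symmetrically by the involution \<open>\<sigma>\<close>; it splits off as an orthogonal summand.\<close>

definition gram_system :: "'i set \<Rightarrow> ('i \<Rightarrow> 'a) \<Rightarrow> ('i \<Rightarrow> 'i) \<Rightarrow> ('i \<Rightarrow> complex) \<Rightarrow> bool"
  where "gram_system I e \<sigma> \<kappa> \<longleftrightarrow> finite I \<and> (\<forall>i\<in>I. \<sigma> i \<in> I \<and> \<sigma> (\<sigma> i) = i \<and> \<kappa> i \<noteq> 0 \<and>
     (\<forall>j\<in>I. h (e i) (e j) = (if j = \<sigma> i then \<kappa> i else 0)))"

lemma gram_systemD:
  assumes "gram_system I e \<sigma> \<kappa>"
  shows "finite I" "i \<in> I \<Longrightarrow> \<sigma> i \<in> I" "i \<in> I \<Longrightarrow> \<sigma> (\<sigma> i) = i" "i \<in> I \<Longrightarrow> \<kappa> i \<noteq> 0"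
    "i \<in> I \<Longrightarrow> j \<in> I \<Longrightarrow> h (e i) (e j) = (if j = \<sigma> i then \<kappa> i else 0)"
  using assms unfolding gram_system_def by blast+

text \<open>Pairing with the partner \<open>e (\<sigma> j)\<close> isolates one coefficient;
  independence and the projection along the complement rest on this.\<close>

lemma gram_system_pair_sum:
  assumes g: "gram_system I e \<sigma> \<kappa>" and j: "j \<in> I"
  shows "h (\<Sum>i\<in>I. c i *s e i) (e (\<sigma> j)) = c j * \<kappa> j"
proof -
  have "h (\<Sum>i\<in>I. c i *s e i) (e (\<sigma> j)) = (\<Sum>i\<in>I. if i = j then c j * \<kappa> j else 0)"
    unfolding h_sum_left
  proof (rule sum.cong[OF refl])
    fix i assume i: "i \<in> I"
    show "h (c i *s e i) (e (\<sigma> j)) = (if i = j then c j * \<kappa> j else 0)"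
    proof (cases "i = j")
      case True
      then show ?thesis
        using gram_systemD(5)[OF g i gram_systemD(2)[OF g j]] by (simp add: h_scale_left)
    next
      case False
      then have "\<sigma> j \<noteq> \<sigma> i" using gram_systemD(3)[OF g i] gram_systemD(3)[OF g j] by metis
      then show ?thesis
        using False gram_systemD(5)[OF g i gram_systemD(2)[OF g j]] by (simp add: h_scale_left)
    qed
  qed
  then show ?thesis using j gram_systemD(1)[OF g] by simp
qed

lemma gram_system_indep:
  assumes g: "gram_system I e \<sigma> \<kappa>" and z: "(\<Sum>i\<in>I. c i *s e i) = 0" and j: "j \<in> I"
  shows "c j = 0"
  using gram_system_pair_sum[OF g j, of c] z gram_systemD(4)[OF g j] by auto

lemma gram_system_decomp:
  assumes g: "gram_system I e \<sigma> \<kappa>" and W: "subspace W" and e: "\<And>i. i \<in> I \<Longrightarrow> e i \<in> W"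
    and v: "v \<in> W"
  obtains c where "v - (\<Sum>i\<in>I. c i *s e i) \<in> perp I e W"
proof -
  \<comment> \<open>Since \<open>h (e i) (e (\<sigma> i)) = \<kappa> i\<close>, these are the
    coefficients of the projection of \<open>v\<close> onto the family.\<close>
  define c where "c i = h v (e (\<sigma> i)) / \<kappa> i" for i
  have "h (v - (\<Sum>i\<in>I. c i *s e i)) (e j) = 0" if j: "j \<in> I" for j
  proof -
    have sj: "\<sigma> j \<in> I" "\<sigma> (\<sigma> j) = j" using gram_systemD[OF g] j by auto
    have "h (\<Sum>i\<in>I. c i *s e i) (e j) = c (\<sigma> j) * \<kappa> (\<sigma> j)"
      using gram_system_pair_sum[OF g sj(1), of c] sj(2) by simp
    also have "\<dots> = h v (e j)" using gram_systemD(4)[OF g sj(1)] sj(2) by (simp add: c_def)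
    finally show ?thesis by (simp add: h_diff_left)
  qed
  moreover have "v - (\<Sum>i\<in>I. c i *s e i) \<in> W"
    using v e W by (intro subspace_diff subspace_sum subspace_scale) auto
  ultimately show ?thesis by (intro that[of c]) (auto simp: perp_def)
qed

text \<open>A vector of the complement that is orthogonal to the complement is orthogonal to the
  family as well, hence to all of \<open>W\<close>.\<close>

lemma gram_system_nondeg_perp:
  assumes g: "gram_system I e \<sigma> \<kappa>" and W: "subspace W" and e: "\<And>i. i \<in> I \<Longrightarrow> e i \<in> W"
    and n: "nondeg W"
  shows "nondeg (perp I e W)"
  unfolding nondeg_def
proof (intro ballI impI)
  fix x assume x: "x \<in> perp I e W" and 0: "\<forall>y\<in>perp I e W. h x y = 0"
  have "h x y = 0" if y: "y \<in> W" for y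
  proof -
    obtain c where c: "y - (\<Sum>i\<in>I. c i *s e i) \<in> perp I e W"
      using gram_system_decomp[OF g W e y] .
    have "h x (\<Sum>i\<in>I. c i *s e i) = 0"
      using x by (simp add: h_sum_right h_scale_right perp_def)
    then show ?thesis using 0 c by (metis h_diff_right diff_zero)
  qed
  then show "x = 0" using n x unfolding nondeg_def perp_def by blast
qed

lemma gram_system_span:
  assumes g: "gram_system I e \<sigma> \<kappa>" and W: "subspace W" and e: "\<And>i. i \<in> I \<Longrightarrow> e i \<in> W"
    and S: "perp I e W \<subseteq> span S"
  shows "W \<subseteq> span (e ` I \<union> S)"
proof
  fix v assume v: "v \<in> W"
  obtain c where c: "v - (\<Sum>i\<in>I. c i *s e i) \<in> perp I e W"
    using gram_system_decomp[OF g W e v] .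
  then have "v - (\<Sum>i\<in>I. c i *s e i) \<in> span (e ` I \<union> S)"
    using S span_mono[of S "e ` I \<union> S"] by blast
  moreover have "(\<Sum>i\<in>I. c i *s e i) \<in> span (e ` I \<union> S)"
    by (intro span_sum span_scale span_base) auto
  ultimately have "(v - (\<Sum>i\<in>I. c i *s e i)) + (\<Sum>i\<in>I. c i *s e i) \<in> span (e ` I \<union> S)"
    by (rule span_add)
  then show "v \<in> span (e ` I \<union> S)" by simp
qed

text \<open>The pairings with the partners are nonzero multiples of the coefficients, so the span of
  the family meets its complement only in 0.\<close>

lemma gram_system_span_perp:
  assumes g: "gram_system I e \<sigma> \<kappa>" and v: "v \<in> span (e ` I)"
    and 0: "\<And>i. i \<in> I \<Longrightarrow> h v (e i) = 0"
  shows "v = 0"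
proof -
  have "span (e ` I) \<subseteq> {x. \<exists>c. x = (\<Sum>i\<in>I. c i *s e i)}"
  proof (rule span_minimal)
    show "subspace {x. \<exists>c. x = (\<Sum>i\<in>I. c i *s e i)}"
      unfolding subspace_def
    proof (intro conjI ballI allI)
      show "0 \<in> {x. \<exists>c. x = (\<Sum>i\<in>I. c i *s e i)}" by (auto intro!: exI[of _ "\<lambda>_. 0"])
    next
      fix x y assume "x \<in> {x. \<exists>c. x = (\<Sum>i\<in>I. c i *s e i)}" "y \<in> {x. \<exists>c. x = (\<Sum>i\<in>I. c i *s e i)}"
      then obtain c d where "x = (\<Sum>i\<in>I. c i *s e i)" "y = (\<Sum>i\<in>I. d i *s e i)" by blast
      then have "x + y = (\<Sum>i\<in>I. (c i + d i) *s e i)" by (simp add: sum.distrib scale_left_distrib)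
      then show "x + y \<in> {x. \<exists>c. x = (\<Sum>i\<in>I. c i *s e i)}" by (auto intro: exI[of _ "\<lambda>i. c i + d i"])
    next
      fix a x assume "x \<in> {x. \<exists>c. x = (\<Sum>i\<in>I. c i *s e i)}"
      then obtain c where "x = (\<Sum>i\<in>I. c i *s e i)" by blast
      then have "a *s x = (\<Sum>i\<in>I. (a * c i) *s e i)" by (simp add: scale_sum_right)
      then show "a *s x \<in> {x. \<exists>c. x = (\<Sum>i\<in>I. c i *s e i)}" by (auto intro: exI[of _ "\<lambda>i. a * c i"])
    qed
    show "e ` I \<subseteq> {x. \<exists>c. x = (\<Sum>i\<in>I. c i *s e i)}"
    proof clarify
      fix j assume j: "j \<in> I"
      have "(\<Sum>i\<in>I. (if i = j then 1 else 0) *s e i) = (\<Sum>i\<in>I. if i = j then e i else 0)"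
        by (intro sum.cong) auto
      also have "\<dots> = e j" using j gram_systemD(1)[OF g] by simp
      finally show "\<exists>c. e j = (\<Sum>i\<in>I. c i *s e i)" by (intro exI[of _ "\<lambda>i. if i = j then 1 else 0"]) simp
    qed
  qed
  then obtain c where c: "v = (\<Sum>i\<in>I. c i *s e i)" using v by blast
  have "c j = 0" if "j \<in> I" for j
    using gram_system_pair_sum[OF g that, of c] 0[OF gram_systemD(2)[OF g that]]
      gram_systemD(4)[OF g that] unfolding c by simp
  then show ?thesis using c by (auto intro!: sum.neutral)
qed

section \<open>Selfadjoint operators on nondegenerate subspaces\<close>

definition sa_space :: "('a \<Rightarrow> 'a) \<Rightarrow> 'a set \<Rightarrow> bool"
  where "sa_space T W \<longleftrightarrow> subspace W \<and> (\<exists>m. dim_le m W) \<and> nondeg W \<and> lin T \<and> T ` W \<subseteq> W \<and>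
     (\<forall>x\<in>W. \<forall>y\<in>W. h (T x) y = h x (T y))"

definition no_real :: "('a \<Rightarrow> 'a) \<Rightarrow> 'a set \<Rightarrow> bool"
  where "no_real T W \<longleftrightarrow> (\<forall>x\<in>W. \<forall>\<mu>::real. T x = of_real \<mu> *s x \<longrightarrow> x = 0)"

lemma sa_spaceD:
  assumes "sa_space T W"
  shows "subspace W" "nondeg W" "lin T" "x \<in> W \<Longrightarrow> T x \<in> W"
    "x \<in> W \<Longrightarrow> y \<in> W \<Longrightarrow> h (T x) y = h x (T y)"
  using assms unfolding sa_space_def by auto

text \<open>Selfadjointness moves \<open>T\<close> onto the family, whose span is invariant, so the
  complement is invariant too. Hence pieces can be split off one after the other.\<close>

lemma sa_space_perp:
  assumes s: "sa_space T W" and g: "gram_system I e \<sigma> \<kappa>" and e: "\<And>i. i \<in> I \<Longrightarrow> e i \<in> W"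
    and T: "\<And>i. i \<in> I \<Longrightarrow> T (e i) \<in> span (e ` I)"
  shows "sa_space T (perp I e W)"
proof -
  note W = sa_spaceD[OF s]
  have "T x \<in> perp I e W" if x: "x \<in> perp I e W" for x
  proof -
    have xW: "x \<in> W" using x by (simp add: perp_def)
    have "h (T x) (e i) = 0" if i: "i \<in> I" for i
    proof -
      have "h (T x) (e i) = h x (T (e i))" using W(5)[OF xW e[OF i]] .
      also have "\<dots> = 0"
        by (rule h_span_zero[OF _ T[OF i]]) (use x in \<open>auto simp: perp_def\<close>)
      finally show ?thesis .
    qed
    then show ?thesis using W(4)[OF xW] by (auto simp: perp_def)
  qed
  moreover obtain m where "dim_le m W" using s unfolding sa_space_def by auto
  then have "dim_le m (perp I e W)" by (rule dim_le_subset) (auto simp: perp_def)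
  ultimately show ?thesis
    using subspace_perp[OF W(1), of I e] gram_system_nondeg_perp[OF g W(1) e W(2)] W(3,5)
    unfolding sa_space_def by (auto simp: perp_def)
qed

lemma lin_simps:
  assumes "lin T"
  shows "T 0 = 0" "T (x + y) = T x + T y" "T (x - y) = T x - T y" "T (c *s x) = c *s T x"
    "T (sum f A) = (\<Sum>a\<in>A. T (f a))"
proof -
  interpret Modules.module_hom scale scale T by fact
  show "T 0 = 0" "T (x + y) = T x + T y" "T (x - y) = T x - T y" "T (c *s x) = c *s T x"
    "T (sum f A) = (\<Sum>a\<in>A. T (f a))"
    by (simp_all add: add diff scale sum)
qed

lemma linI: "(\<And>x y. T (x + y) = T x + T y) \<Longrightarrow> (\<And>c x. T (c *s x) = c *s T x) \<Longrightarrow> lin T"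
  by unfold_locales auto

text \<open>\<open>independent\<close> speaks of a set and cannot see repeated vectors; injectivity
  is therefore part of the result, so that index sets can be counted.\<close>

lemma family_independent:
  assumes fin: "finite I"
    and ind: "\<forall>c. (\<Sum>i\<in>I. c i *s v i) = 0 \<longrightarrow> (\<forall>i\<in>I. c i = 0)"
  shows "inj_on v I" "independent (v ` I)"
proof -
  show inj: "inj_on v I"
  proof (rule inj_onI, rule ccontr)
    fix i j assume ij: "i \<in> I" "j \<in> I" "v i = v j" "i \<noteq> j"
    define c where "c l = (if l = i then 1 else if l = j then - 1 else (0::complex))" for l
    have "(\<Sum>l\<in>I. c l *s v l) = (\<Sum>l\<in>I. (if l = i then v i else 0) - (if l = j then v j else 0))"
      using ij(4) by (intro sum.cong) (simp_all add: c_def)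
    also have "\<dots> = 0" using ij fin by (simp add: sum_subtractf)
    finally have "c i = 0" using ind[rule_format, of c i] ij(1) by simp
    then show False by (simp add: c_def)
  qed
  show "independent (v ` I)"
  proof
    assume "dependent (v ` I)"
    then obtain u where u: "\<exists>x\<in>v ` I. u x \<noteq> 0" "(\<Sum>x\<in>v ` I. u x *s x) = 0"
      unfolding dependent_finite[OF finite_imageI[OF fin]] by blast
    have "(\<Sum>i\<in>I. u (v i) *s v i) = 0" using u(2) inj by (simp add: sum.reindex)
    then have "u (v i) = 0" if "i \<in> I" for i using ind[rule_format, of "\<lambda>i. u (v i)" i] that by simp
    then show False using u(1) by auto
  qed
qed

lemma family_card_le:
  assumes "dim_le m W" "finite I" "v ` I \<subseteq> W"
    and ind: "\<And>c i. (\<Sum>i\<in>I. c i *s v i) = 0 \<Longrightarrow> i \<in> I \<Longrightarrow> c i = 0"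
  shows "card I \<le> m"
proof -
  have ind': "\<forall>c. (\<Sum>i\<in>I. c i *s v i) = 0 \<longrightarrow> (\<forall>i\<in>I. c i = 0)"
  proof (intro allI impI ballI)
    fix c i assume "(\<Sum>i\<in>I. c i *s v i) = 0" "i \<in> I"
    then show "c i = 0" using ind[of c i] by simp
  qed
  note I = family_independent[OF assms(2) ind']
  have "card (v ` I) \<le> m" by (rule dim_leD[OF assms(1,3) I(2), THEN conjunct2])
  then show ?thesis using I(1) by (simp add: card_image)
qed

section \<open>Jordan chains\<close>

definition poly_op :: "('a \<Rightarrow> 'a) \<Rightarrow> complex poly \<Rightarrow> 'a \<Rightarrow> 'a"
  where "poly_op T p x = (\<Sum>i\<le>degree p. coeff p i *s (T ^^ i) x)"

lemma poly_op_bound: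
  assumes "degree p \<le> n" shows "poly_op T p x = (\<Sum>i\<le>n. coeff p i *s (T ^^ i) x)"
  unfolding poly_op_def using assms
  by (intro sum.mono_neutral_left) (auto simp: coeff_eq_0)

lemma poly_op_0 [simp]: "poly_op T 0 x = 0"
  by (simp add: poly_op_def)

lemma poly_op_add: "poly_op T (p + q) x = poly_op T p x + poly_op T q x"
proof -
  let ?n = "max (degree p) (degree q)"
  have "degree (p + q) \<le> ?n" by (rule degree_add_le_max)
  then show ?thesis
    by (simp add: poly_op_bound[of _ ?n] scale_left_distrib sum.distrib)
qed

lemma poly_op_smult: "poly_op T (Polynomial.smult c p) x = c *s poly_op T p x"
proof -
  have "poly_op T (Polynomial.smult c p) x
      = (\<Sum>i\<le>degree p. coeff (Polynomial.smult c p) i *s (T ^^ i) x)"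
    by (rule poly_op_bound) (rule degree_smult_le)
  then show ?thesis unfolding poly_op_def by (simp add: scale_sum_right)
qed

lemma poly_op_pCons:
  assumes "lin T" shows "poly_op T (pCons a p) x = a *s x + T (poly_op T p x)"
proof -
  have "poly_op T (pCons a p) x = (\<Sum>i\<le>Suc (degree p). coeff (pCons a p) i *s (T ^^ i) x)"
    by (rule poly_op_bound) (rule degree_pCons_le)
  also have "\<dots> = a *s x + (\<Sum>i\<le>degree p. coeff p i *s (T ^^ Suc i) x)"
    by (subst sum.atMost_Suc_shift) simp
  also have "\<dots> = a *s x + T (poly_op T p x)"
    unfolding poly_op_def by (simp add: lin_simps[OF assms])
  finally show ?thesis .
qed

lemma poly_op_mult:
  assumes T: "lin T" shows "poly_op T (p * q) x = poly_op T p (poly_op T q x)"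
  by (induction p) (simp_all add: poly_op_add poly_op_smult poly_op_pCons[OF T])

lemma poly_op_linear_factor:
  assumes "lin T" shows "poly_op T [:- a, 1:] x = T x - a *s x"
  by (simp add: poly_op_pCons[OF assms] lin_simps[OF assms])

lemma poly_op_linear_factor_power:
  assumes "lin T" shows "poly_op T ([:- a, 1:] ^ k) x = ((\<lambda>x. T x - a *s x) ^^ k) x"
proof (induction k)
  case 0
  show ?case using poly_op_pCons[OF assms, of 1 0 x] by (simp add: lin_simps[OF assms] one_pCons)
qed (simp add: poly_op_mult[OF assms] poly_op_linear_factor[OF assms] del: mult_pCons_left)

lemma poly_op_lin: assumes T: "lin T" shows "lin (poly_op T p)"
proof (induction p)
  case 0
  show ?case by (intro linI) auto
next
  case (pCons a p)
  show ?case
    by (intro linI) (simp_all add: poly_op_pCons[OF T] lin_simps[OF pCons(2)] lin_simps[OF T]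
      scale_right_distrib mult.commute)
qed

lemma poly_op_in:
  assumes "subspace W" "lin T" "T ` W \<subseteq> W" "x \<in> W" shows "poly_op T p x \<in> W"
proof (induction p)
  case 0
  show ?case using assms by (simp add: subspace_0)
next
  case (pCons a p)
  then show ?case using assms
    by (auto simp: poly_op_pCons[OF assms(2)] intro!: subspace_add subspace_scale)
qed

text \<open>The \<open>m + 1\<close> iterates of \<open>x\<close> up to \<open>T ^^ m\<close> exceed
  the dimension bound; a nontrivial relation between them is the polynomial.\<close>

lemma annihilator_vector:
  assumes W: "subspace W" "lin T" "T ` W \<subseteq> W" "dim_le m W" and x: "x \<in> W"
  obtains p where "p \<noteq> 0" "poly_op T p x = 0"
proof -
  have "(T ^^ i) x \<in> W" for i by (induction i) (use x W in auto)
  then have sub: "(\<lambda>i. (T ^^ i) x) ` {..m} \<subseteq> W" by auto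
  have "\<exists>c. (\<Sum>i\<in>{..m}. c i *s (T ^^ i) x) = 0 \<and> (\<exists>i\<in>{..m}. c i \<noteq> 0)"
  proof (rule ccontr)
    assume "\<not> ?thesis"
    then have "c i = 0" if "(\<Sum>i\<in>{..m}. c i *s (T ^^ i) x) = 0" "i \<in> {..m}" for c i
      using that by meson
    then have "card {..m} \<le> m" by (rule family_card_le[OF W(4) finite_atMost sub])
    then show False by simp
  qed
  then obtain c i where c: "(\<Sum>i\<in>{..m}. c i *s (T ^^ i) x) = 0" "i \<in> {..m}" "c i \<noteq> 0" by metis
  define p where "p = (\<Sum>i\<le>m. Polynomial.monom (c i) i)"
  have co: "coeff p j = (if j \<le> m then c j else 0)" for j
    by (simp add: p_def coeff_sum coeff_monom)
  have "degree p \<le> m" by (rule degree_le) (simp add: co)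
  then have "poly_op T p x = (\<Sum>i\<le>m. c i *s (T ^^ i) x)"
    by (simp add: poly_op_bound co)
  moreover have "p \<noteq> 0" using c co[of i] by auto
  ultimately show ?thesis using c(1) that by simp
qed

text \<open>The product of annihilators of the vectors of a basis annihilates the whole space; among
  all annihilators one of least degree is taken.\<close>

lemma minimal_annihilator:
  assumes W: "subspace W" "lin T" "T ` W \<subseteq> W" "dim_le m W"
  obtains p where "p \<noteq> 0" "\<forall>x\<in>W. poly_op T p x = 0"
    "\<forall>q. q \<noteq> 0 \<longrightarrow> degree q < degree p \<longrightarrow> (\<exists>x\<in>W. poly_op T q x \<noteq> 0)"
proof -
  obtain B where B: "B \<subseteq> W" "independent B" "W \<subseteq> span B" by (rule maximal_independent_subset)
  have fin: "finite B" by (rule dim_leD[OF W(4) B(1,2), THEN conjunct1])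
  have "\<exists>p. p \<noteq> 0 \<and> (\<forall>x\<in>B. poly_op T p x = 0)"
    using fin B(1)
  proof (induction B)
    case empty
    then show ?case by (auto intro: exI[of _ 1])
  next
    case (insert b B)
    then obtain p where p: "p \<noteq> 0" "\<forall>x\<in>B. poly_op T p x = 0" by auto
    obtain q where q: "q \<noteq> 0" "poly_op T q b = 0"
      using annihilator_vector[OF W, of b] insert by auto
    have "poly_op T (q * p) x = 0" if "x \<in> B" for x
      using p that by (simp add: poly_op_mult[OF W(2)] lin_simps[OF poly_op_lin[OF W(2)]])
    moreover have "poly_op T (p * q) b = 0"
      using q by (simp add: poly_op_mult[OF W(2)] lin_simps[OF poly_op_lin[OF W(2)]])
    ultimately show ?case using p(1) q(1) by (intro exI[of _ "p * q"]) (auto simp: mult.commute)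
  qed
  then obtain p0 where p0: "p0 \<noteq> 0" "\<forall>x\<in>B. poly_op T p0 x = 0" by blast
  have "poly_op T p0 x = 0" if "x \<in> W" for x
  proof -
    have "x \<in> span B" using B(3) that by blast
    then show ?thesis
      by (induction rule: span_induct_alt)
        (use p0 in \<open>simp_all add: lin_simps[OF poly_op_lin[OF W(2)]]\<close>)
  qed
  then have ex: "\<exists>p. p \<noteq> 0 \<and> (\<forall>x\<in>W. poly_op T p x = 0)" using p0(1) by blast
  let ?P = "\<lambda>p. p \<noteq> 0 \<and> (\<forall>x\<in>W. poly_op T p x = 0)"
  obtain p where p: "?P p" and min: "\<forall>q. ?P q \<longrightarrow> degree p \<le> degree q"
    using ex_has_least_nat[of ?P _ degree] ex by metis
  have "\<forall>q. q \<noteq> 0 \<longrightarrow> degree q < degree p \<longrightarrow> (\<exists>x\<in>W. poly_op T q x \<noteq> 0)"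
    using min by (metis leD)
  with p show ?thesis using that[of p] by simp
qed

text \<open>A root \<open>a\<close> of a minimal annihilator splits off a linear factor. The
  cofactor has smaller degree, so it does not annihilate \<open>W\<close>, and any nonzero vector in
  its image is an eigenvector for \<open>a\<close>.\<close>

lemma eigenvector_exists:
  assumes W: "subspace W" "lin T" "T ` W \<subseteq> W" "dim_le m W" and w: "w \<in> W" "w \<noteq> 0"
  obtains x c where "x \<in> W" "x \<noteq> 0" "T x = c *s x"
proof -
  obtain p :: "complex poly" where p: "p \<noteq> 0" "\<forall>x\<in>W. poly_op T p x = 0"
    "\<forall>q. q \<noteq> 0 \<longrightarrow> degree q < degree p \<longrightarrow> (\<exists>x\<in>W. poly_op T q x \<noteq> 0)"
    using minimal_annihilator[OF W] .
  have "degree p \<noteq> 0"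
  proof
    assume "degree p = 0"
    then obtain c where c: "p = [:c:]" by (rule degree_eq_zeroE)
    then have "c *s w = 0" using p(2)[rule_format, OF w(1)] by (simp add: poly_op_pCons[OF W(2)] lin_simps[OF W(2)])
    then show False using c p(1) w(2) by simp
  qed
  then have "\<not> constant (poly p)" by (simp add: constant_degree)
  then obtain a where "poly p a = 0" using fundamental_theorem_of_algebra by blast
  then obtain q where q: "p = [:- a, 1:] * q" unfolding poly_eq_0_iff_dvd by (rule dvdE)
  then have q0: "q \<noteq> 0" using p(1) by auto
  have "degree p = Suc (degree q)" unfolding q using q0 by (subst degree_mult_eq) auto
  then obtain x where x: "x \<in> W" "poly_op T q x \<noteq> 0" using p(3)[rule_format, OF q0] by auto
  have "T (poly_op T q x) - a *s poly_op T q x = 0"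
    using p(2)[rule_format, OF x(1)] unfolding q poly_op_mult[OF W(2)] poly_op_linear_factor[OF W(2)] .
  then show ?thesis
    using that[of "poly_op T q x" a] x poly_op_in[OF W(1-3) x(1)] by auto
qed

lemma poly_op_eigenvector:
  assumes "lin T" "T x = a *s x" shows "poly_op T p x = poly p a *s x"
  by (induction p) (simp_all add: poly_op_pCons[OF assms(1)] lin_simps[OF assms(1)] assms(2)
      scale_left_distrib mult.commute)

lemma lin_funpow: "lin S \<Longrightarrow> lin (S ^^ j)"
  by (induction j) (auto intro!: linI simp: lin_simps)

lemma sa_space_shift:
  assumes s: "sa_space T W" and S: "\<And>x. S x = T x - of_real \<omega> *s x"
  shows "lin S" "x \<in> W \<Longrightarrow> (S ^^ j) x \<in> W"
    "x \<in> W \<Longrightarrow> y \<in> W \<Longrightarrow> h ((S ^^ j) x) y = h x ((S ^^ j) y)"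
proof -
  note W = sa_spaceD[OF s]
  show lS: "lin S"
    by (intro linI) (simp_all add: S lin_simps[OF W(3)] algebra_simps)
  have SW: "S x \<in> W" if "x \<in> W" for x
    using that W(1,4) by (simp add: S subspace_diff subspace_scale)
  then have SjW: "(S ^^ j) x \<in> W" if "x \<in> W" for x j
    using that by (induction j) auto
  have sa: "h (S x) y = h x (S y)" if "x \<in> W" "y \<in> W" for x y
    using W(5)[OF that] by (simp add: S h_diff_left h_diff_right h_scale_left h_scale_right)
  show "x \<in> W \<Longrightarrow> (S ^^ j) x \<in> W" by (rule SjW)
  show "h ((S ^^ j) x) y = h x ((S ^^ j) y)" if "x \<in> W" "y \<in> W"
    using that
  proof (induction j arbitrary: y)
    case (Suc j)
    have "h ((S ^^ Suc j) x) y = h (S ((S ^^ j) x)) y" by simp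
    also have "\<dots> = h ((S ^^ j) x) (S y)" using Suc.prems SjW sa by blast
    also have "\<dots> = h x ((S ^^ j) (S y))" using Suc SW by blast
    finally show ?case by (simp only: funpow_Suc_right o_apply)
  qed simp
qed

text \<open>The exponent is the order of \<open>\<omega>\<close> in the minimal polynomial; \<open>v\<^sub>1\<close> below is the component
  of \<open>v\<close> in the root space, so that the top form of the root space is not identically zero.\<close>

lemma chain_generator_exists:
  assumes s: "sa_space T W" and x0: "x0 \<in> W" "x0 \<noteq> 0" "T x0 = of_real \<omega> *s x0"
    and S: "S = (\<lambda>x. T x - of_real \<omega> *s x)"
  obtains k :: nat and u where "k > 0" "u \<in> W" "(S ^^ k) u = 0" "h ((S ^^ (k - 1)) u) u \<noteq> 0"
proof -
  note W = sa_spaceD[OF s]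
  obtain m where m: "dim_le m W" using s unfolding sa_space_def by blast
  have TW: "T ` W \<subseteq> W" using W(4) by blast
  note Sh = sa_space_shift[OF s fun_cong[OF S]]
  note lS = Sh(1) and SjW = Sh(2) and saj = Sh(3)
  note lSj = lin_funpow[OF lS]
  note pm = poly_op_mult[OF W(3)]
  note pW = poly_op_in[OF W(1,3) TW]
  obtain p :: "complex poly" where p: "p \<noteq> 0" "\<forall>x\<in>W. poly_op T p x = 0"
    "\<forall>q. q \<noteq> 0 \<longrightarrow> degree q < degree p \<longrightarrow> (\<exists>x\<in>W. poly_op T q x \<noteq> 0)"
    using minimal_annihilator[OF W(1,3) TW m] .
  let ?o = "of_real \<omega> :: complex"
  define l where "l = [:- ?o, 1:]"
  have pl: "poly_op T (l ^ j) x = (S ^^ j) x" for j x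
    unfolding l_def S by (rule poly_op_linear_factor_power[OF W(3)])
  define k where "k = Polynomial.order ?o p"
  obtain q where q: "p = l ^ k * q" "\<not> l dvd q"
    using order_decomp[OF p(1), of ?o] unfolding k_def l_def by blast
  have "poly p ?o *s x0 = 0" using p(2)[rule_format, OF x0(1)] poly_op_eigenvector[OF W(3) x0(3)] by simp
  then have "poly p ?o = 0" using x0(2) by simp
  then have k: "k > 0" using p(1) unfolding k_def by (simp add: order_root)
  define c where "c = poly q ?o"
  have c: "c \<noteq> 0" using q(2) unfolding c_def l_def by (simp add: poly_eq_0_iff_dvd)
  have q0: "q \<noteq> 0" and l0: "l \<noteq> 0" using c by (auto simp: c_def l_def)
  have dl: "degree (l ^ j) = j" for j unfolding l_def by (rule degree_linear_power)
  \<comment> \<open>With one linear factor fewer the degree is below the minimum, so some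
    \<open>w\<close> is not annihilated; this makes \<open>u0\<close> a root vector of height
    exactly \<open>k\<close>.\<close>
  have "degree (l ^ (k - 1) * q) < degree p"
    unfolding q(1) using k l0 q0 by (simp add: degree_mult_eq dl)
  then obtain w where w: "w \<in> W" "poly_op T (l ^ (k - 1) * q) w \<noteq> 0"
    using p(3)[rule_format, of "l ^ (k - 1) * q"] l0 q0 by auto
  define u0 where "u0 = poly_op T q w"
  have u0: "u0 \<in> W" "(S ^^ (k - 1)) u0 \<noteq> 0" "(S ^^ k) u0 = 0"
    using w p(2)[rule_format, OF w(1)] pW unfolding u0_def by (simp_all add: pl[symmetric] pm[symmetric] q(1))
  define y where "y = (S ^^ (k - 1)) u0"
  have y: "y \<in> W" "y \<noteq> 0" using u0 SjW by (auto simp: y_def)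
  have "(S ^^ k) y = (S ^^ (k - 1)) ((S ^^ k) u0)"
    unfolding y_def by (metis add.commute comp_apply funpow_add)
  then have Sky: "(S ^^ k) y = 0" using u0(3) by (simp add: lin_simps[OF lSj])
  obtain v where v: "v \<in> W" "h y v \<noteq> 0" using W(2) y unfolding nondeg_def by blast
  \<comment> \<open>\<open>g\<close> vanishes at \<open>\<omega>\<close>, so \<open>g ^ k\<close> is
    a multiple of \<open>l ^ k\<close>, while \<open>1 - g ^ k\<close> is a multiple of
    \<open>q\<close>. Evaluated at \<open>T\<close>, these two split \<open>v\<close> into a root
    vector \<open>v1\<close> and a vector in the range of \<open>S ^^ k\<close>; the latter is
    orthogonal to \<open>y\<close>.\<close>
  define g where "g = 1 - Polynomial.smult (1 / c) q"
  have "poly g ?o = 0" using c by (simp add: g_def c_def[symmetric])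
  then obtain r where r: "g = l * r" unfolding poly_eq_0_iff_dvd l_def by blast
  define s where "s = (\<Sum>i<k. g ^ i)"
  have gk: "1 - g ^ k = Polynomial.smult (1 / c) q * s"
    using one_diff_power_eq[of g k] by (simp add: g_def s_def)
  define v1 where "v1 = poly_op T (1 - g ^ k) v"
  have v1W: "v1 \<in> W" unfolding v1_def by (rule pW[OF v(1)])
  have "(S ^^ k) v1 = poly_op T (l ^ k * (1 - g ^ k)) v"
    unfolding v1_def by (simp add: pm pl)
  also have "l ^ k * (1 - g ^ k) = Polynomial.smult (1 / c) s * p"
    unfolding gk q(1) by (simp add: mult_ac)
  also have "poly_op T \<dots> v = 0"
    unfolding pm p(2)[rule_format, OF v(1)] by (rule lin_simps(1)[OF poly_op_lin[OF W(3)]])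
  finally have Sv1: "(S ^^ k) v1 = 0" .
  define z where "z = poly_op T (r ^ k) v"
  have "v = poly_op T ((1 - g ^ k) + g ^ k) v"
    using poly_op_pCons[OF W(3), of 1 0 v] by (simp add: one_pCons lin_simps[OF W(3)])
  also have "\<dots> = v1 + (S ^^ k) z"
    unfolding poly_op_add v1_def z_def r by (simp add: power_mult_distrib pm pl)
  finally have "h y v = h y v1 + h y ((S ^^ k) z)" by (metis h_add_right)
  also have "h y ((S ^^ k) z) = 0"
    using saj[OF y(1), of z k] pW[OF v(1)] Sky by (simp add: z_def)
  finally have nz: "h ((S ^^ (k - 1)) u0) v1 \<noteq> 0" using v(2) by (simp add: y_def)
  \<comment> \<open>Polarisation: the form \<open>h ((S ^^ (k - 1)) u) v\<close> is nonzero at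
    \<open>u0\<close> and \<open>v1\<close>, so its diagonal cannot vanish at all of
    \<open>u0\<close>, \<open>v1\<close>, \<open>u0 + v1\<close> and
    \<open>u0 + \<i> *s v1\<close>.\<close>
  have "\<exists>u\<in>W. (S ^^ k) u = 0 \<and> h ((S ^^ (k - 1)) u) u \<noteq> 0"
  proof (rule ccontr)
    assume "\<not> ?thesis"
    then have 0: "h ((S ^^ (k - 1)) u) u = 0" if "u \<in> W" "(S ^^ k) u = 0" for u
      using that by blast
    let ?g = "\<lambda>u v. h ((S ^^ (k - 1)) u) v"
    have a: "?g u0 u0 = 0" "?g v1 v1 = 0" using 0 u0 v1W Sv1 by auto
    have b: "?g (u0 + v1) (u0 + v1) = 0"
      by (rule 0[OF subspace_add[OF W(1) u0(1) v1W]]) (simp add: lin_simps[OF lSj] u0 Sv1)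
    have c: "?g (u0 + \<i> *s v1) (u0 + \<i> *s v1) = 0"
      by (rule 0[OF subspace_add[OF W(1) u0(1) subspace_scale[OF W(1) v1W]]])
        (simp add: lin_simps[OF lSj] u0 Sv1)
    have "?g u0 v1 + ?g v1 u0 = 0" using a b
      by (simp add: lin_simps[OF lSj] h_add_left h_add_right add.commute)
    moreover have "\<i> * (?g v1 u0 - ?g u0 v1) = 0" using a c
      by (simp add: lin_simps[OF lSj] h_add_left h_add_right h_scale_left h_scale_right right_diff_distrib)
    ultimately show False using nz by simp
  qed
  then show ?thesis using that k by blast
qed

text \<open>The pairing \<open>h ((S ^^ (k - 1)) u) u\<close> of a generator is real and nonzero. It
  is scaled to a sign; then the pairings with lower powers of \<open>S\<close> are removed, from the
  largest power down, by adding multiples of \<open>(S ^^ d) u\<close>. Iterating \<open>S\<close>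
  now yields an antidiagonal Gram matrix.\<close>

lemma chain_exists:
  assumes s: "sa_space T W" and x0: "x0 \<in> W" "x0 \<noteq> 0" "T x0 = of_real \<omega> *s x0"
  obtains k :: nat and \<kappa> e where "k > 0" "\<kappa> \<in> {1, -1}" "\<And>j. j < k \<Longrightarrow> e j \<in> W"
    "\<And>j. j < k \<Longrightarrow> T (e j) = of_real \<omega> *s e j + (if j = 0 then 0 else e (j - 1))"
    "\<And>i j. i < k \<Longrightarrow> j < k \<Longrightarrow> h (e i) (e j) = (if i + j + 1 = k then \<kappa> else 0)"
proof -
  note W = sa_spaceD[OF s]
  define S where "S = (\<lambda>x. T x - of_real \<omega> *s x)"
  note Sh = sa_space_shift[OF s fun_cong[OF S_def]]
  note lS = Sh(1) and SjW = Sh(2) and saj = Sh(3)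
  note lSj = lin_simps[OF lin_funpow[OF lS]]
  obtain k u0 where k: "k > 0" and u0: "u0 \<in> W" "(S ^^ k) u0 = 0" "h ((S ^^ (k - 1)) u0) u0 \<noteq> 0"
    using chain_generator_exists[OF s x0 S_def] .
  have kill: "(S ^^ j) u = 0" if "j \<ge> k" "(S ^^ k) u = 0" for j u
  proof -
    have "(S ^^ j) u = (S ^^ (j - k)) ((S ^^ k) u)"
      using that(1) by (metis comp_apply funpow_add le_add_diff_inverse2)
    then show ?thesis using that(2) by (simp add: lSj)
  qed
  have real: "h ((S ^^ j) u) u = of_real (Re (h ((S ^^ j) u) u))" if "u \<in> W" for j u
  proof -
    have "cnj (h ((S ^^ j) u) u) = h ((S ^^ j) u) u" using saj[OF that that, of j] by (simp add: h_cnj)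
    then show ?thesis by (metis Reals_cnj_iff complex_is_Real_iff of_real_Re)
  qed
  define r where "r = Re (h ((S ^^ (k - 1)) u0) u0)"
  have r: "h ((S ^^ (k - 1)) u0) u0 = of_real r" using real[OF u0(1)] by (simp add: r_def)
  then have r0: "r \<noteq> 0" using u0(3) by auto
  define \<kappa> :: complex where "\<kappa> = of_real (sgn r)"
  have \<kappa>: "\<kappa> \<in> {1, -1}" using r0 by (auto simp: \<kappa>_def sgn_if)
  define u1 where "u1 = of_real (1 / sqrt \<bar>r\<bar>) *s u0"
  have "h ((S ^^ (k - 1)) u1) u1 = of_real (1 / sqrt \<bar>r\<bar> * (1 / sqrt \<bar>r\<bar>) * r)"
    by (simp only: u1_def lSj h_scale_left h_scale_right r complex_cnj_complex_of_real of_real_mult mult.assoc)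
  also have "1 / sqrt \<bar>r\<bar> * (1 / sqrt \<bar>r\<bar>) * r = sgn r"
    using r0 by (simp add: sgn_if)
  finally have u1k: "h ((S ^^ (k - 1)) u1) u1 = \<kappa>" by (simp add: \<kappa>_def)
  have u1: "u1 \<in> W" "(S ^^ k) u1 = 0" using u0 subspace_scale[OF W(1)] by (auto simp: u1_def lSj)
  \<comment> \<open>Invariant: the pairings with the \<open>m\<close> largest powers below
    \<open>k - 1\<close> have been removed.\<close>
  have "\<exists>u\<in>W. (S ^^ k) u = 0 \<and> h ((S ^^ (k - 1)) u) u = \<kappa> \<and>
      (\<forall>j. k - 1 - m \<le> j \<and> j < k - 1 \<longrightarrow> h ((S ^^ j) u) u = 0)" if "m \<le> k - 1" for m
    using that
  proof (induction m)
    case 0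
    show ?case using u1 u1k by auto
  next
    case (Suc m)
    then obtain u where u: "u \<in> W" "(S ^^ k) u = 0" "h ((S ^^ (k - 1)) u) u = \<kappa>"
      "\<And>j. k - 1 - m \<le> j \<Longrightarrow> j < k - 1 \<Longrightarrow> h ((S ^^ j) u) u = 0" by auto
    define d where "d = Suc m"
    define j0 where "j0 = k - 1 - d"
    have jd: "j0 + d = k - 1" "d \<ge> 1" using Suc.prems by (auto simp: j0_def d_def)
    define a where "a = Re (h ((S ^^ j0) u) u)"
    have a: "h ((S ^^ j0) u) u = of_real a" unfolding a_def by (rule real[OF u(1)])
    \<comment> \<open>As \<open>j0 + d = k - 1\<close>, the correction changes the pairing at
      \<open>j0\<close> by \<open>2 * c * sgn r = - a\<close>; its quadratic term has a power of at
      least \<open>k\<close> and vanishes. For larger \<open>j\<close> every correction term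
      vanishes for this reason.\<close>
    define c where "c = - a * sgn r / 2"
    define u' where "u' = u + of_real c *s (S ^^ d) u"
    have SS: "(S ^^ i) ((S ^^ j) x) = (S ^^ (i + j)) x" for i j x by (simp add: funpow_add)
    have F: "h ((S ^^ j) u') u' = h ((S ^^ j) u) u + of_real (2 * c) * h ((S ^^ (j + d)) u) u
       + of_real (c\<^sup>2) * h ((S ^^ (j + 2 * d)) u) u" for j
    proof -
      have 1: "h ((S ^^ j) u) ((S ^^ d) u) = h ((S ^^ (j + d)) u) u"
        using saj[OF SjW[OF u(1), of j] u(1), of d] by (simp add: SS add.commute)
      have 2: "h ((S ^^ (j + d)) u) ((S ^^ d) u) = h ((S ^^ (j + 2 * d)) u) u"
        using saj[OF SjW[OF u(1), of "j + d"] u(1), of d] by (simp add: SS add_ac mult_2)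
      show ?thesis
        by (simp add: u'_def lSj h_add_left h_add_right h_scale_left h_scale_right SS 1 2)
          (simp add: power2_eq_square algebra_simps)
    qed
    have z: "h ((S ^^ j) u) u = 0" if "j \<ge> k" for j using kill[OF that u(2)] by simp
    have "h ((S ^^ j) u') u' = 0" if j: "k - 1 - Suc m \<le> j" "j < k - 1" for j
    proof (cases "j = j0")
      case True
      have "h ((S ^^ (j0 + 2 * d)) u) u = 0" by (rule z) (use jd k in linarith)
      then have "h ((S ^^ j) u') u' = of_real (a + 2 * c * sgn r)"
        unfolding F True jd(1) u(3) a by (simp add: \<kappa>_def)
      also have "a + 2 * c * sgn r = 0" using r0 by (auto simp: c_def sgn_if)
      finally show ?thesis by simp
    next
      case False
      then have "k - 1 - m \<le> j" using j by (auto simp: j0_def d_def)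
      moreover have "j + d \<ge> k" using False j by (auto simp: j0_def d_def)
      then have "h ((S ^^ (j + d)) u) u = 0" "h ((S ^^ (j + 2 * d)) u) u = 0"
        by (auto intro!: z)
      ultimately show ?thesis unfolding F using u(4) j by simp
    qed
    moreover have "h ((S ^^ (k - 1)) u') u' = \<kappa>"
      unfolding F u(3) using jd(2) k z[of "k - 1 + d"] z[of "k - 1 + 2 * d"] by simp
    moreover have "u' \<in> W" unfolding u'_def
      using u(1) SjW subspace_add[OF W(1)] subspace_scale[OF W(1)] by blast
    moreover have "(S ^^ k) u' = 0" using kill[OF _ u(2)] by (simp add: u'_def lSj SS)
    ultimately show ?case by blast
  qed
  from this[of "k - 1"] obtain u where u: "u \<in> W" "(S ^^ k) u = 0" "h ((S ^^ (k - 1)) u) u = \<kappa>"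
    "\<And>j. j < k - 1 \<Longrightarrow> h ((S ^^ j) u) u = 0" by auto
  \<comment> \<open>Reversed numbering: \<open>e 0\<close> is the eigenvector, and \<open>S\<close>
    lowers the index.\<close>
  define e where "e j = (S ^^ (k - 1 - j)) u" for j
  show ?thesis
  proof (rule that[OF k \<kappa>, of e])
    show "e j \<in> W" for j unfolding e_def by (rule SjW[OF u(1)])
    show "T (e j) = of_real \<omega> *s e j + (if j = 0 then 0 else e (j - 1))" if "j < k" for j
    proof -
      have "S (e j) = (S ^^ Suc (k - 1 - j)) u" by (simp add: e_def)
      also have "\<dots> = (if j = 0 then 0 else e (j - 1))"
      proof (cases "j = 0")
        case True
        then show ?thesis using k u(2) by (metis Suc_diff_1 minus_nat.diff_0)
      next
        case False
        then have "Suc (k - 1 - j) = k - 1 - (j - 1)" using that by simp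
        then show ?thesis using False by (simp only: e_def if_False)
      qed
      finally show ?thesis by (simp add: S_def algebra_simps)
    qed
    show "h (e i) (e j) = (if i + j + 1 = k then \<kappa> else 0)" if "i < k" "j < k" for i j
    proof -
      let ?l = "(k - 1 - j) + (k - 1 - i)"
      have "h (e i) (e j) = h ((S ^^ ?l) u) u"
        using saj[OF SjW[OF u(1), of "k - 1 - i"] u(1), of "k - 1 - j"]
        by (simp add: e_def funpow_add)
      moreover consider "i + j + 1 = k" | "i + j + 1 < k" | "i + j + 1 > k" by linarith
      then have "h ((S ^^ ?l) u) u = (if i + j + 1 = k then \<kappa> else 0)"
      proof cases
        case 1
        then have "?l = k - 1" by linarith
        then show ?thesis using 1 u(3) by simp
      next
        case 2
        then have "?l \<ge> k" by linarith
        then show ?thesis using 2 kill[OF _ u(2)] by simp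
      next
        case 3
        then have "?l < k - 1" using that by linarith
        then show ?thesis using 3 u(4) by simp
      qed
      ultimately show ?thesis by simp
    qed
  qed
qed

section \<open>Families of pairwise orthogonal Jordan chains\<close>

abbreviation chain_idx :: "nat \<Rightarrow> (nat \<Rightarrow> nat) \<Rightarrow> (nat \<times> nat) set"
  where "chain_idx N k \<equiv> SIGMA b:{..<N}. {..<k b}"

text \<open>The chains need not exhaust the real eigenvalues of \<open>T\<close>; that they do is
  expressed separately, by \<open>no_real\<close> on their orthogonal complement.\<close>

definition jordan_family ::
    "('a \<Rightarrow> 'a) \<Rightarrow> 'a set \<Rightarrow> nat \<Rightarrow> (nat \<Rightarrow> real) \<Rightarrow> (nat \<Rightarrow> nat) \<Rightarrow> (nat \<Rightarrow> complex) \<Rightarrow>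
      (nat \<Rightarrow> nat \<Rightarrow> 'a) \<Rightarrow> bool"
  where "jordan_family T W N w k \<kappa> e \<longleftrightarrow>
    (\<forall>b<N. k b > 0 \<and> \<kappa> b \<in> {1, -1} \<and>
      (\<forall>j<k b. e b j \<in> W \<and>
        T (e b j) = of_real (w b) *s e b j + (if j = 0 then 0 else e b (j - 1)))) \<and>
    (\<forall>b<N. \<forall>b'<N. \<forall>i<k b. \<forall>j<k b'.
      h (e b i) (e b' j) = (if b = b' \<and> i + j + 1 = k b then \<kappa> b else 0))"

lemma jordan_familyD:
  assumes "jordan_family T W N w k \<kappa> e"
  shows "b < N \<Longrightarrow> k b > 0" "b < N \<Longrightarrow> \<kappa> b \<in> {1, -1}" "b < N \<Longrightarrow> j < k b \<Longrightarrow> e b j \<in> W"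
    "b < N \<Longrightarrow> j < k b \<Longrightarrow> T (e b j) = of_real (w b) *s e b j + (if j = 0 then 0 else e b (j - 1))"
    "b < N \<Longrightarrow> b' < N \<Longrightarrow> i < k b \<Longrightarrow> j < k b' \<Longrightarrow>
      h (e b i) (e b' j) = (if b = b' \<and> i + j + 1 = k b then \<kappa> b else 0)"
  using assms unfolding jordan_family_def by simp_all

text \<open>The Gram matrix of a chain is antidiagonal and different chains are orthogonal, so the
  involution reverses each chain.\<close>

lemma jordan_family_gram_system:
  assumes j: "jordan_family T W N w k \<kappa> e"
  shows "gram_system (chain_idx N k) (case_prod e) (\<lambda>(b, j). (b, k b - 1 - j)) (\<lambda>(b, j). \<kappa> b)"
  unfolding gram_system_def
proof (intro conjI ballI)
  fix x y assume x: "x \<in> chain_idx N k" and y: "y \<in> chain_idx N k"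
  obtain b i where b: "x = (b, i)" "b < N" "i < k b" using x by auto
  obtain b' i' where b': "y = (b', i')" "b' < N" "i' < k b'" using y by auto
  show "h (case_prod e x) (case_prod e y)
      = (if y = (\<lambda>(b, j). (b, k b - 1 - j)) x then (\<lambda>(b, j). \<kappa> b) x else 0)"
    using jordan_familyD(5)[OF j b(2) b'(2) b(3) b'(3)] b b' by auto
next
  fix x assume "x \<in> chain_idx N k"
  then show "(\<lambda>(b, j). \<kappa> b) x \<noteq> 0" using jordan_familyD(2)[OF j, of "fst x"] by auto
qed auto

lemma jordan_family_in: "jordan_family T W N w k \<kappa> e \<Longrightarrow> x \<in> chain_idx N k \<Longrightarrow> case_prod e x \<in> W"
  using jordan_familyD(3) by auto

lemma jordan_family_chain_in_span:
  assumes J: "jordan_family T V N w k \<kappa> e" and p: "p \<in> chain_idx N k"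
  shows "T (case_prod e p) \<in> span (case_prod e ` chain_idx N k)"
proof -
  obtain b j where b: "p = (b, j)" "b < N" "j < k b" using p by auto
  have "e b i \<in> span (case_prod e ` chain_idx N k)" if "i < k b" for i
    by (rule span_base) (use that b(2) in force)
  then show ?thesis unfolding b(1) using jordan_familyD(4)[OF J b(2,3)] b(3)
    by (auto intro!: span_add span_scale intro: span_zero)
qed

lemma chain_gram_system:
  fixes k :: nat
  assumes "k > 0" "\<kappa> \<in> {1, -1}"
    "\<And>i j. i < k \<Longrightarrow> j < k \<Longrightarrow> h (e i) (e j) = (if i + j + 1 = k then \<kappa> else 0)"
  shows "gram_system {..<k} e (\<lambda>j. k - 1 - j) (\<lambda>_. \<kappa>)"
  unfolding gram_system_def using assms(1,2) by (auto simp: assms(3))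

lemma jordan_family_extend:
  assumes j: "jordan_family T (perp {..<k0} e0 W) N w k \<kappa> e"
    and k0: "k0 > 0" and \<kappa>0: "\<kappa>0 \<in> {1, -1}" and e0: "\<And>j. j < k0 \<Longrightarrow> e0 j \<in> W"
    and Te0: "\<And>j. j < k0 \<Longrightarrow> T (e0 j) = of_real \<omega> *s e0 j + (if j = 0 then 0 else e0 (j - 1))"
    and he0: "\<And>i j. i < k0 \<Longrightarrow> j < k0 \<Longrightarrow> h (e0 i) (e0 j) = (if i + j + 1 = k0 then \<kappa>0 else 0)"
  shows "jordan_family T W (Suc N) (w(N := \<omega>)) (k(N := k0)) (\<kappa>(N := \<kappa>0)) (e(N := e0))"
proof -
  note jD = jordan_familyD[OF j]
  have eW: "e b i \<in> W" and e0': "i' < k0 \<Longrightarrow> h (e b i) (e0 i') = 0" if "b < N" "i < k b" for b i i'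
    using jD(3)[OF that] by (auto simp: perp_def)
  have e0'': "h (e0 i') (e b i) = 0" if "b < N" "i < k b" "i' < k0" for b i i'
    using e0'[OF that] h_eq_0_sym by blast
  show ?thesis
    unfolding jordan_family_def
  proof (rule conjI; intro allI impI)
    fix b assume "b < Suc N"
    then consider "b = N" | "b < N" "b \<noteq> N" by linarith
    then show "(k(N := k0)) b > 0 \<and> (\<kappa>(N := \<kappa>0)) b \<in> {1, -1} \<and>
      (\<forall>j<(k(N := k0)) b. (e(N := e0)) b j \<in> W \<and> T ((e(N := e0)) b j)
        = of_real ((w(N := \<omega>)) b) *s (e(N := e0)) b j + (if j = 0 then 0 else (e(N := e0)) b (j - 1)))"
    proof cases
      case 1
      then show ?thesis using k0 \<kappa>0 e0 Te0 by simp
    next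
      case 2
      then show ?thesis using jD(1,2,4) eW by simp
    qed
  next
    fix b b' i i' assume b: "b < Suc N" "b' < Suc N" "i < (k(N := k0)) b" "i' < (k(N := k0)) b'"
    consider "b = N" "b' = N" | "b = N" "b' < N" | "b < N" "b' = N" | "b < N" "b' < N"
      using b(1,2) by linarith
    then show "h ((e(N := e0)) b i) ((e(N := e0)) b' i')
      = (if b = b' \<and> i + i' + 1 = (k(N := k0)) b then (\<kappa>(N := \<kappa>0)) b else 0)"
    proof cases
      case 1
      then show ?thesis using b he0 by simp
    next
      case 2
      then show ?thesis using b e0'' by simp
    next
      case 3
      then show ?thesis using b e0' by simp
    next
      case 4
      then show ?thesis using b jD(5)[of b b' i i'] by simp
    qed
  qed
qed

lemma no_real_mono: "no_real T W \<Longrightarrow> U \<subseteq> W \<Longrightarrow> no_real T U"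
  unfolding no_real_def by (meson subsetD)

text \<open>As long as a real eigenvalue remains, a chain is split off; its complement is again a
  selfadjoint space with a smaller dimension bound. What is left at the end has only nonreal
  eigenvalues.\<close>

lemma jordan_family_exists:
  assumes "sa_space T W"
  shows "\<exists>N w k \<kappa> e. jordan_family T W N w k \<kappa> e \<and> no_real T (perp (chain_idx N k) (case_prod e) W)"
proof -
  obtain m where m: "dim_le m W" using assms unfolding sa_space_def by blast
  show ?thesis using m assms
  proof (induction m arbitrary: W)
    case 0
    have "no_real T W" unfolding no_real_def using dim_le_0[OF 0(1)] by meson
    moreover have "jordan_family T W 0 (\<lambda>_. 0) (\<lambda>_. 0) (\<lambda>_. 0) (\<lambda>_ _. 0)"
      by (simp add: jordan_family_def)
    ultimately show ?case by (fastforce simp: perp_def intro: no_real_mono)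
  next
    case (Suc m)
    show ?case
    proof (cases "no_real T W")
      case True
      moreover have "jordan_family T W 0 (\<lambda>_. 0) (\<lambda>_. 0) (\<lambda>_. 0) (\<lambda>_ _. 0)"
        by (simp add: jordan_family_def)
      ultimately show ?thesis by (fastforce simp: perp_def intro: no_real_mono)
    next
      case False
      then obtain x0 \<omega> where x0: "x0 \<in> W" "T x0 = of_real \<omega> *s x0" "x0 \<noteq> 0"
        unfolding no_real_def by metis
      obtain k0 :: nat and \<kappa>0 e0 where k0: "k0 > 0" and \<kappa>0: "\<kappa>0 \<in> {1, -1}"
        and e0: "\<And>j. j < k0 \<Longrightarrow> e0 j \<in> W"
        and Te0: "\<And>j. j < k0 \<Longrightarrow> T (e0 j) = of_real \<omega> *s e0 j + (if j = 0 then 0 else e0 (j - 1))"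
        and he0: "\<And>i j. i < k0 \<Longrightarrow> j < k0 \<Longrightarrow> h (e0 i) (e0 j) = (if i + j + 1 = k0 then \<kappa>0 else 0)"
        by (rule chain_exists[OF Suc.prems(2) x0(1,3,2)]) metis
      have g: "gram_system {..<k0} e0 (\<lambda>j. k0 - 1 - j) (\<lambda>_. \<kappa>0)"
        by (rule chain_gram_system[OF k0 \<kappa>0 he0])
      have "T (e0 j) \<in> span (e0 ` {..<k0})" if "j \<in> {..<k0}" for j
        using that by (auto simp: Te0 intro!: span_add span_scale intro: span_base span_zero)
      then have sa: "sa_space T (perp {..<k0} e0 W)"
        by (intro sa_space_perp[OF Suc.prems(2) g]) (use e0 in auto)
      \<comment> \<open>The first vector of the chain pairs to \<open>\<kappa>0\<close> with the
        last one, so the complement is a proper subspace.\<close>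
      have "e0 0 \<notin> perp {..<k0} e0 W"
      proof
        assume "e0 0 \<in> perp {..<k0} e0 W"
        then have "h (e0 0) (e0 (k0 - 1)) = 0" using k0 by (simp add: perp_def)
        then show False using he0[of 0 "k0 - 1"] k0 \<kappa>0 by auto
      qed
      then have "dim_le m (perp {..<k0} e0 W)"
        using dim_le_proper[OF Suc.prems(1) _ _ e0[OF k0], of "perp {..<k0} e0 W"] sa_spaceD(1)[OF sa]
        by (simp add: perp_def)
      then obtain N w k \<kappa> e where J: "jordan_family T (perp {..<k0} e0 W) N w k \<kappa> e"
        and n: "no_real T (perp (chain_idx N k) (case_prod e) (perp {..<k0} e0 W))"
        using Suc.IH sa by blast
      have "perp (chain_idx (Suc N) (k(N := k0))) (case_prod (e(N := e0))) W
          \<subseteq> perp (chain_idx N k) (case_prod e) (perp {..<k0} e0 W)"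
      proof
        fix v assume v: "v \<in> perp (chain_idx (Suc N) (k(N := k0))) (case_prod (e(N := e0))) W"
        then have v': "h v ((e(N := e0)) b j) = 0" if "b < Suc N" "j < (k(N := k0)) b" for b j
          using that by (force simp: perp_def)
        have "h v (e b j) = 0" if "b < N" "j < k b" for b j using v'[of b j] that by simp
        moreover have "h v (e0 j) = 0" if "j < k0" for j using v'[of N j] that by simp
        moreover have "v \<in> W" using v by (simp add: perp_def)
        ultimately show "v \<in> perp (chain_idx N k) (case_prod e) (perp {..<k0} e0 W)"
          by (auto simp: perp_def)
      qed
      then show ?thesis
        using no_real_mono[OF n] jordan_family_extend[OF J k0 \<kappa>0 e0 Te0 he0] by blast
    qed
  qed
qed

section \<open>Lagrangian subspaces in the absence of real eigenvalues\<close>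

text \<open>The induction splits off the hyperbolic pair of an eigenvector \<open>x0\<close> at a nonreal eigenvalue
  and an isotropic dual vector \<open>y1\<close>; the compression of \<open>T\<close> to the orthogonal complement of the pair
  again has no real eigenvalues.\<close>

lemma hyperbolic_pair_exists:
  assumes s: "sa_space T W" and n: "no_real T W" and w: "w \<in> W" "w \<noteq> 0"
  obtains x0 c y1 where "x0 \<in> W" "y1 \<in> W" "T x0 = c *s x0" "Im c \<noteq> 0"
    "h x0 x0 = 0" "h x0 y1 = 1" "h y1 x0 = 1" "h y1 y1 = 0"
proof -
  note W = sa_spaceD[OF s]
  obtain m where m: "dim_le m W" using s unfolding sa_space_def by blast
  have TW: "T ` W \<subseteq> W" using W(4) by blast
  obtain x0 c where x0: "x0 \<in> W" "x0 \<noteq> 0" "T x0 = c *s x0"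
    using eigenvector_exists[OF W(1,3) TW m w] .
  have c: "Im c \<noteq> 0"
  proof
    assume "Im c = 0"
    then have "c = of_real (Re c)" by (simp add: complex_eq_iff)
    then show False using n x0 unfolding no_real_def by metis
  qed
  have "c * h x0 x0 = cnj c * h x0 x0"
    using W(5)[OF x0(1) x0(1)] by (simp add: x0(3) h_scale_left h_scale_right)
  moreover have "c \<noteq> cnj c" using c by (simp add: complex_eq_iff)
  ultimately have h0: "h x0 x0 = 0" by simp
  obtain y where y: "y \<in> W" "h x0 y \<noteq> 0" using W(2) x0(1,2) unfolding nondeg_def by blast
  \<comment> \<open>The conjugate appears because \<open>h\<close> is conjugate linear on the right.
    Subtracting half of the real number \<open>h y' y'\<close> along \<open>x0\<close> then makes
    the partner isotropic.\<close>
  define y' where "y' = (1 / cnj (h x0 y)) *s y"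
  have y': "y' \<in> W" "h x0 y' = 1" using y subspace_scale[OF W(1)] by (auto simp: y'_def h_scale_right)
  have y'': "h y' x0 = 1" using y'(2) by (metis h_cnj complex_cnj_one)
  define a where "a = Re (h y' y') / 2"
  define y1 where "y1 = y' - of_real a *s x0"
  have "h y1 y1 = h y' y' - of_real (2 * a)"
    by (simp add: y1_def h_diff_left h_diff_right h_scale_left h_scale_right y' y'' h0)
  also have "\<dots> = 0" using h_self_real[of y'] by (simp add: a_def)
  finally have "h y1 y1 = 0" .
  moreover have "h x0 y1 = 1" by (simp add: y1_def h_diff_right h_scale_right y' h0)
  then have "h x0 y1 = 1" "h y1 x0 = 1" using h_cnj[of x0 y1] by auto
  moreover have "y1 \<in> W" using y' x0 subspace_diff[OF W(1)] subspace_scale[OF W(1)] by (simp add: y1_def)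
  ultimately show ?thesis using that[OF x0(1) _ x0(3) c h0] by blast
qed

text \<open>For small \<open>s\<close> of sign opposite to \<open>a\<close> the linear term
  dominates. The witness minimises \<open>s * a + C * s\<^sup>2\<close>, where \<open>C\<close> is
  positive and bounds \<open>b + c\<close>.\<close>

lemma small_scalar_exists:
  fixes a b c :: real
  assumes "a \<noteq> 0"
  obtains s where "s * a + s\<^sup>2 * b + s\<^sup>2 * c < 0"
proof -
  define C where "C = \<bar>b\<bar> + \<bar>c\<bar> + 1"
  have C: "C > 0" "b + c \<le> C" by (auto simp: C_def)
  define s where "s = - a / (2 * C)"
  have s2: "s * a = - 2 * C * s\<^sup>2" using C(1) by (simp add: s_def power2_eq_square field_simps)
  have "s\<^sup>2 > 0" using assms C(1) by (simp add: s_def)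
  have "s * a + s\<^sup>2 * b + s\<^sup>2 * c = s\<^sup>2 * (b + c - 2 * C)" unfolding s2 by (simp add: algebra_simps)
  also have "\<dots> < 0" using \<open>s\<^sup>2 > 0\<close> C by (intro mult_pos_neg) auto
  finally show ?thesis using that by blast
qed

text \<open>The bound on the spanning set says that \<open>r\<close> is at least half the dimension.
  The \<open>x i\<close>, on which both forms vanish, enlarge the nonnegative families of the
  dimension counts; the \<open>y i\<close> become part of the negative Lagrangian subspace.
  Independence of the \<open>y i\<close> is implicit in their diagonal Gram matrix.\<close>

definition lagrangian_pair ::
    "('a \<Rightarrow> 'a) \<Rightarrow> 'a set \<Rightarrow> nat \<Rightarrow> (nat \<Rightarrow> 'a) \<Rightarrow> (nat \<Rightarrow> 'a) \<Rightarrow> bool"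
  where "lagrangian_pair T W r x y \<longleftrightarrow>
    (\<exists>S. finite S \<and> card S \<le> 2 * r \<and> W \<subseteq> span S) \<and>
    (\<forall>i<r. x i \<in> W \<and> y i \<in> W) \<and>
    (\<forall>c. (\<Sum>i<r. c i *s x i) = 0 \<longrightarrow> (\<forall>i<r. c i = 0)) \<and>
    (\<forall>i<r. \<forall>j<r. h (x i) (x j) = 0 \<and> h (T (x i)) (x j) = 0) \<and>
    (\<forall>i<r. \<forall>j<r. h (y i) (y j) = 0 \<and> h (T (y i)) (y j) = (if i = j then - 1 else 0))"

lemma lagrangian_pairD:
  assumes "lagrangian_pair T W r x y"
  shows "\<exists>S. finite S \<and> card S \<le> 2 * r \<and> W \<subseteq> span S"
    "i < r \<Longrightarrow> x i \<in> W" "i < r \<Longrightarrow> y i \<in> W"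
    "\<forall>c. (\<Sum>i<r. c i *s x i) = 0 \<longrightarrow> (\<forall>i<r. c i = 0)"
    "i < r \<Longrightarrow> j < r \<Longrightarrow> h (x i) (x j) = 0" "i < r \<Longrightarrow> j < r \<Longrightarrow> h (T (x i)) (x j) = 0"
    "i < r \<Longrightarrow> j < r \<Longrightarrow> h (y i) (y j) = 0"
    "i < r \<Longrightarrow> j < r \<Longrightarrow> h (T (y i)) (y j) = (if i = j then - 1 else 0)"
  using assms unfolding lagrangian_pair_def by simp_all

text \<open>The eigenvector \<open>x0\<close> joins the \<open>x i\<close> as it is. For the
  \<open>y i\<close> it is tilted towards \<open>y1\<close> by a small imaginary amount: this keeps
  it isotropic and gives the form of \<open>T\<close> a first-order term proportional to
  \<open>Im c\<close>, which can be made negative. Orthogonalisation and scaling follow.\<close>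

lemma lagrangian_pair_extend:
  assumes s: "sa_space T W" and x0: "x0 \<in> W" "y1 \<in> W" "T x0 = c *s x0" "Im c \<noteq> 0"
    and hx: "h x0 x0 = 0" "h x0 y1 = 1" "h y1 x0 = 1" "h y1 y1 = 0"
    and U: "U \<subseteq> W" "\<And>u. u \<in> U \<Longrightarrow> h u x0 = 0" "\<And>u. u \<in> U \<Longrightarrow> h u y1 = 0"
    and WU: "\<And>S. U \<subseteq> span S \<Longrightarrow> W \<subseteq> span (insert x0 (insert y1 S))"
    and T1: "\<And>u v. u \<in> U \<Longrightarrow> v \<in> U \<Longrightarrow> h (T1 u) v = h (T u) v"
    and L: "lagrangian_pair T1 U r x y"
  obtains x' y' where "lagrangian_pair T W (Suc r) x' y'"
proof -
  note W = sa_spaceD[OF s]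
  note LD = lagrangian_pairD[OF L]
  obtain S where S: "finite S" "card S \<le> 2 * r" "U \<subseteq> span S" using LD(1) by metis
  note xy = LD(2,3) and xi = LD(4) and xx = LD(5,6) and yy = LD(7,8)
  have xW: "x i \<in> W" and yW: "y i \<in> W" if "i < r" for i
    using xy[OF that] U(1) by (simp_all add: subsetD)
  have sym: "h u v = 0" if "h v u = 0" for u v using that h_eq_0_sym by blast
  have xT: "h (T (x i)) (x j) = 0" and yT: "h (T (y i)) (y j) = (if i = j then - 1 else 0)"
    if "i < r" "j < r" for i j
    using xx(2)[OF that] yy(2)[OF that] T1[OF xy(1)[OF that(1)] xy(1)[OF that(2)]]
      T1[OF xy(2)[OF that(1)] xy(2)[OF that(2)]] by simp_all
  have Tx0: "h (T x0) u = 0" "h (T u) x0 = 0" if "u \<in> U" for u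
  proof -
    show "h (T x0) u = 0" using sym[OF U(2)[OF that]] by (simp add: x0(3) h_scale_left)
    then show "h (T u) x0 = 0" using W(5)[OF subsetD[OF U(1) that] x0(1)] sym by metis
  qed
  define q where "q i = h (T y1) (y i)" for i
  define b where "b = Re (h (T y1) y1)"
  have Tyy: "h (T y1) y1 = of_real b"
    using W(5)[OF x0(2,2)] h_cnj[of "T y1" y1] by (metis Reals_cnj_iff b_def complex_is_Real_iff of_real_Re)
  have qc: "h (T (y i)) y1 = cnj (q i)" if "i < r" for i
    using W(5)[OF yW[OF that] x0(2)] h_cnj[of "T y1" "y i"] by (simp add: q_def)
  \<comment> \<open>The first two terms are the value of the form at the tilted vector
    \<open>u\<close>; the last sum is the cost of making it orthogonal to the
    \<open>y i\<close>.\<close>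
  obtain t where t: "t * (2 * Im c) + t\<^sup>2 * b + t\<^sup>2 * (\<Sum>i<r. (cmod (q i))\<^sup>2) < 0"
    using small_scalar_exists[of "2 * Im c"] x0(4) by auto
  \<comment> \<open>Purely imaginary, so \<open>z + cnj z = 0\<close> and \<open>u\<close> is
    isotropic.\<close>
  define z where "z = \<i> * of_real t"
  define u where "u = x0 + z *s y1"
  have uW: "u \<in> W" using x0 subspace_add[OF W(1)] subspace_scale[OF W(1)] by (simp add: u_def)
  have hu: "h u u = 0"
    by (simp add: u_def h_add_left h_add_right h_scale_left h_scale_right hx z_def)
  have huy: "h u (y i) = 0" if "i < r" for i
    using sym[OF U(2)[OF xy(2)[OF that]]] sym[OF U(3)[OF xy(2)[OF that]]]
    by (simp add: u_def h_add_left h_scale_left)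
  have Tu: "T u = c *s x0 + z *s T y1" by (simp add: u_def lin_simps[OF W(3)] x0(3))
  have huy': "h (y i) u = 0" if "i < r" for i using sym[OF huy[OF that]] .
  have TuU: "h (T u) (y i) = z * q i" if "i < r" for i
    using sym[OF U(2)[OF xy(2)[OF that]]] by (simp add: Tu h_add_left h_scale_left q_def)
  have TUu: "h (T (y i)) u = cnj (z * q i)" if "i < r" for i
    using W(5)[OF yW[OF that] uW] TuU[OF that] h_cnj[of "T u" "y i"] by simp
  have Ty1x0: "h (T y1) x0 = cnj c"
    using W(5)[OF x0(2,1)] by (simp add: x0(3) h_scale_right hx)
  have "h (T u) u = h (c *s x0 + z *s T y1) (x0 + z *s y1)" by (simp only: Tu) (simp only: u_def)
  also have "\<dots> = of_real (t * (2 * Im c) + t\<^sup>2 * b)"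
    by (simp add: h_add_left h_add_right h_scale_left h_scale_right hx Ty1x0 Tyy z_def
        complex_eq_iff power2_eq_square algebra_simps)
  finally have hTu: "h (T u) u = of_real (t * (2 * Im c) + t\<^sup>2 * b)" .
  \<comment> \<open>A Gram-Schmidt step for the form of \<open>T\<close>; the correction has a plus
    sign because the \<open>y i\<close> have the value \<open>- 1\<close>.\<close>
  define v where "v = u + (\<Sum>i<r. (z * q i) *s y i)"
  have sW: "(\<Sum>i<r. (z * q i) *s y i) \<in> W"
    using yW by (intro subspace_sum[OF W(1)] subspace_scale[OF W(1)]) auto
  have vW: "v \<in> W" unfolding v_def using uW sW by (rule subspace_add[OF W(1)])
  have hvy: "h v (y j) = 0" if "j < r" for j
    using that huy yy(1) by (simp add: v_def h_add_left h_sum_left h_scale_left)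
  have hvv: "h v v = 0"
  proof -
    have "h v (\<Sum>i<r. (z * q i) *s y i) = 0" using hvy by (simp add: h_sum_right h_scale_right)
    then have "h v v = h v u" by (metis v_def h_add_right add.right_neutral)
    also have "\<dots> = h u u + (\<Sum>i<r. (z * q i) * h (y i) u)"
      by (simp add: v_def h_add_left h_sum_left h_scale_left)
    also have "\<dots> = 0" using huy' hu by simp
    finally show ?thesis .
  qed
  have Tv: "T v = T u + (\<Sum>i<r. (z * q i) *s T (y i))"
    by (simp add: v_def lin_simps[OF W(3)])
  have Tvy: "h (T v) (y j) = 0" if "j < r" for j
  proof -
    have "h (T v) (y j) = z * q j + (\<Sum>i<r. (z * q i) * (if i = j then - 1 else 0))"
      using that yT by (simp add: Tv h_add_left h_sum_left h_scale_left TuU)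
    also have "(\<Sum>i<r. (z * q i) * (if i = j then - 1 else 0)) = (\<Sum>i<r. if i = j then - (z * q j) else 0)"
      by (intro sum.cong) auto
    also have "\<dots> = - (z * q j)" using that by simp
    finally show ?thesis by simp
  qed
  have zq: "(z * q i) * cnj (z * q i) = of_real (t\<^sup>2 * (cmod (q i))\<^sup>2)" for i
  proof -
    have "(cmod (z * q i))\<^sup>2 = t\<^sup>2 * (cmod (q i))\<^sup>2"
      by (simp add: norm_mult z_def power_mult_distrib)
    then show ?thesis by (metis complex_norm_square)
  qed
  have "h (T v) v = h (T v) u"
  proof -
    have "h (T v) (\<Sum>i<r. (z * q i) *s y i) = 0" using Tvy by (simp add: h_sum_right h_scale_right)
    then show ?thesis by (metis v_def h_add_right add.right_neutral)
  qed
  also have "\<dots> = h (T u) u + (\<Sum>i<r. (z * q i) * cnj (z * q i))"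
    by (simp add: Tv h_add_left h_sum_left h_scale_left TUu)
  also have "(\<Sum>i<r. (z * q i) * cnj (z * q i)) = of_real (t\<^sup>2 * (\<Sum>i<r. (cmod (q i))\<^sup>2))"
    by (simp only: zq of_real_sum sum_distrib_left)
  finally have Tvv: "h (T v) v = of_real (t * (2 * Im c) + t\<^sup>2 * b + t\<^sup>2 * (\<Sum>i<r. (cmod (q i))\<^sup>2))"
    using hTu by simp
  define d where "d = - (t * (2 * Im c) + t\<^sup>2 * b + t\<^sup>2 * (\<Sum>i<r. (cmod (q i))\<^sup>2))"
  have d: "d > 0" "h (T v) v = of_real (- d)" using t Tvv by (auto simp: d_def)
  define v' where "v' = of_real (1 / sqrt d) *s v"
  have v'W: "v' \<in> W" unfolding v'_def using vW by (rule subspace_scale[OF W(1)])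
  have v': "h v' v' = 0" "\<And>j. j < r \<Longrightarrow> h v' (y j) = 0" "\<And>j. j < r \<Longrightarrow> h (T v') (y j) = 0"
    by (simp_all add: v'_def lin_simps[OF W(3)] h_scale_left h_scale_right hvv hvy Tvy)
  have "h (T v') v' = of_real (1 / sqrt d * (1 / sqrt d) * (- d))"
    by (simp only: v'_def lin_simps[OF W(3)] h_scale_left h_scale_right d(2)
        complex_cnj_complex_of_real of_real_mult mult.assoc)
  also have "1 / sqrt d * (1 / sqrt d) * (- d) = - 1" using d(1) by simp
  finally have Tv'v': "h (T v') v' = - 1" by simp
  have Tv'': "h (T (y j)) v' = 0" if "j < r" for j
    using W(5)[OF yW[OF that] v'W] sym[OF v'(3)[OF that]] by simp
  define x' where "x' = x(r := x0)"
  define y' where "y' = y(r := v')"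
  have "lagrangian_pair T W (Suc r) x' y'"
    unfolding lagrangian_pair_def
  proof (intro conjI allI impI)
    have "W \<subseteq> span (insert x0 (insert y1 S))" by (rule WU[OF S(3)])
    moreover have "card (insert x0 (insert y1 S)) \<le> 2 * Suc r"
      using S(1,2) by (simp add: card_insert_if)
    ultimately show "\<exists>S. finite S \<and> card S \<le> 2 * Suc r \<and> W \<subseteq> span S"
      using S(1) by (intro exI[of _ "insert x0 (insert y1 S)"]) simp
  next
    fix i assume "i < Suc r"
    then show "x' i \<in> W" "y' i \<in> W" using xW yW x0 v'W by (auto simp: x'_def y'_def less_Suc_eq)
  next
    fix c i assume z: "(\<Sum>i<Suc r. c i *s x' i) = 0" and i: "i < Suc r"
    have split: "(\<Sum>i<Suc r. c i *s x' i) = (\<Sum>i<r. c i *s x i) + c r *s x0"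
      by (simp add: x'_def)
    have "h (\<Sum>i<r. c i *s x i) y1 = 0" using U(3)[OF xy(1)] by (simp add: h_sum_left h_scale_left)
    then have "h (\<Sum>i<Suc r. c i *s x' i) y1 = c r"
      unfolding split by (simp add: h_add_left h_scale_left hx)
    then have "c r = 0" using z by simp
    then have "\<forall>i<r. c i = 0" using xi z split by simp
    then show "c i = 0" using \<open>c r = 0\<close> i by (auto simp: less_Suc_eq)
  next
    fix i j assume "i < Suc r" "j < Suc r"
    then show "h (x' i) (x' j) = 0" "h (T (x' i)) (x' j) = 0"
      using xx(1) xT hx(1) U(2)[OF xy(1)] sym[OF U(2)[OF xy(1)]] Tx0(2)[OF xy(1)]
      by (auto simp: x'_def less_Suc_eq x0(3) h_scale_left)
  next
    fix i j assume "i < Suc r" "j < Suc r"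
    then show "h (y' i) (y' j) = 0" "h (T (y' i)) (y' j) = (if i = j then - 1 else 0)"
      using yy(1) yT v' sym[OF v'(2)] Tv'v' Tv'' by (auto simp: y'_def less_Suc_eq)
  qed
  then show ?thesis by (rule that)
qed

lemma lagrangian_pair_exists:
  assumes "sa_space T W" "no_real T W"
  shows "\<exists>r x y. lagrangian_pair T W r x y"
proof -
  obtain m where m: "dim_le m W" using assms(1) unfolding sa_space_def by blast
  show ?thesis using m assms
  proof (induction m arbitrary: W T)
    case 0
    have "W \<subseteq> {0}" using dim_le_0[OF 0(1)] by blast
    then have "lagrangian_pair T W 0 (\<lambda>_. 0) (\<lambda>_. 0)"
      by (simp add: lagrangian_pair_def) (intro exI[of _ "{}"], simp)
    then show ?case by (intro exI)
  next
    case (Suc m)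
    show ?case
    proof (cases "W \<subseteq> {0}")
      case True
      then have "lagrangian_pair T W 0 (\<lambda>_. 0) (\<lambda>_. 0)"
        by (simp add: lagrangian_pair_def) (intro exI[of _ "{}"], simp)
      then show ?thesis by (intro exI)
    next
      case False
      then obtain w where w: "w \<in> W" "w \<noteq> 0" by blast
      note W = sa_spaceD[OF Suc.prems(2)]
      obtain x0 c y1 where x0: "x0 \<in> W" "y1 \<in> W" "T x0 = c *s x0" "Im c \<noteq> 0"
        and hx: "h x0 x0 = 0" "h x0 y1 = 1" "h y1 x0 = 1" "h y1 y1 = 0"
        using hyperbolic_pair_exists[OF Suc.prems(2,3) w] .
      define e where "e i = (if i = 0 then x0 else y1)" for i :: nat
      have g: "gram_system {0, 1} e (\<lambda>i. 1 - i) (\<lambda>_. 1)"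
        by (simp add: gram_system_def e_def hx)
      have eW: "e i \<in> W" for i using x0 by (simp add: e_def)
      define U where "U = perp {0, 1} e W"
      have U: "u \<in> U \<longleftrightarrow> u \<in> W \<and> h u x0 = 0 \<and> h u y1 = 0" for u
        by (auto simp: U_def perp_def e_def)
      have sU: "subspace U" unfolding U_def by (rule subspace_perp[OF W(1)])
      have nU: "nondeg U" unfolding U_def by (rule gram_system_nondeg_perp[OF g W(1) eW W(2)])
      have "x0 \<notin> U" using hx by (simp add: U)
      then have dU: "dim_le m U" using dim_le_proper[OF Suc.prems(1) _ sU x0(1)] U by blast
      \<comment> \<open>This removes the \<open>x0\<close> component of \<open>T u\<close>; its
        \<open>y1\<close> component is zero already, because \<open>x0\<close> is an eigenvector
        orthogonal to \<open>u\<close>. Pairings with vectors of \<open>U\<close> do not change,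
        since \<open>U\<close> is orthogonal to \<open>x0\<close>.\<close>
      define T1 where "T1 u = T u - h (T u) y1 *s x0" for u
      have lT1: "lin T1"
        by (intro linI) (simp_all add: T1_def lin_simps[OF W(3)] h_add_left h_scale_left algebra_simps)
      have T1U: "T1 u \<in> U" if "u \<in> U" for u
      proof -
        have u: "u \<in> W" "h u x0 = 0" using that U by auto
        have "h (T u) x0 = 0" using W(5)[OF u(1) x0(1)] u(2) by (simp add: x0(3) h_scale_right)
        then have "h (T1 u) x0 = 0" "h (T1 u) y1 = 0" by (simp_all add: T1_def h_diff_left h_scale_left hx)
        moreover have "T1 u \<in> W" unfolding T1_def
          by (intro subspace_diff[OF W(1)] subspace_scale[OF W(1)] W(4) u(1) x0(1))
        ultimately show ?thesis using U by blast
      qed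
      have hT1: "h (T1 u) v = h (T u) v" "h v (T1 u) = h v (T u)" if "v \<in> U" for u v
      proof -
        have "h v x0 = 0" "h x0 v = 0" using that U h_eq_0_sym by blast+
        then show "h (T1 u) v = h (T u) v" "h v (T1 u) = h v (T u)"
          by (simp_all add: T1_def h_diff_left h_diff_right h_scale_left h_scale_right)
      qed
      have "sa_space T1 U"
        unfolding sa_space_def
      proof (intro conjI ballI)
        show "\<exists>m. dim_le m U" using dU by blast
        show "T1 ` U \<subseteq> U" using T1U by blast
        fix u v assume "u \<in> U" "v \<in> U"
        then show "h (T1 u) v = h u (T1 v)" using hT1 W(5) U by simp
      qed (fact sU nU lT1)+
      moreover have "no_real T1 U"
        unfolding no_real_def
      proof (intro ballI allI impI)
        fix v and \<mu> :: real assume v: "v \<in> U" "T1 v = of_real \<mu> *s v"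
        let ?d = "h (T v) y1"
        have c\<mu>: "of_real \<mu> - c \<noteq> 0" using x0(4) by (auto simp: complex_eq_iff)
        \<comment> \<open>With this \<open>s\<close> a real eigenvector \<open>v\<close> of the
          compression lifts to the eigenvector \<open>v + s *s x0\<close> of \<open>T\<close>; the
          division is possible because \<open>c\<close> is not real.\<close>
        define s where "s = ?d / (of_real \<mu> - c)"
        have s: "?d + s * c = of_real \<mu> * s" using c\<mu> by (simp add: s_def field_simps)
        have "T v = of_real \<mu> *s v + ?d *s x0" using v(2) by (simp add: T1_def algebra_simps)
        then have "T (v + s *s x0) = of_real \<mu> *s v + (?d + s * c) *s x0"
          by (simp add: lin_simps[OF W(3)] x0(3) scale_left_distrib add.assoc)
        also have "\<dots> = of_real \<mu> *s (v + s *s x0)"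
          unfolding s by (simp add: scale_right_distrib)
        finally have "T (v + s *s x0) = of_real \<mu> *s (v + s *s x0)" .
        moreover have "v + s *s x0 \<in> W"
          using v(1) U x0(1) subspace_add[OF W(1)] subspace_scale[OF W(1)] by simp
        ultimately have z: "v + s *s x0 = 0" using Suc.prems(3) unfolding no_real_def by blast
        have "h (v + s *s x0) y1 = s" using v(1) U by (simp add: h_add_left h_scale_left hx)
        then have "s = 0" using z by simp
        then show "v = 0" using z by simp
      qed
      ultimately obtain r x y where L: "lagrangian_pair T1 U r x y"
        using Suc.IH[OF dU] by metis
      have "W \<subseteq> span (insert x0 (insert y1 S))" if "U \<subseteq> span S" for S
      proof -
        have "e ` {0, 1} \<union> S = insert x0 (insert y1 S)" by (auto simp: e_def)
        then show ?thesis using gram_system_span[OF g W(1) eW, of S] that by (simp add: U_def)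
      qed
      moreover have "U \<subseteq> W" "\<And>u. u \<in> U \<Longrightarrow> h u x0 = 0" "\<And>u. u \<in> U \<Longrightarrow> h u y1 = 0" using U by auto
      ultimately obtain x' y' where "lagrangian_pair T W (Suc r) x' y'"
        using lagrangian_pair_extend[OF Suc.prems(2) x0 hx _ _ _ _ hT1(1) L] by metis
      then show ?thesis by (intro exI)
    qed
  qed
qed

end

section \<open>Nonnegative segments of Jordan chains\<close>

text \<open>This is \<open>s\<close> in terms of \<open>\<kappa> = (-1) ^ (k + 1) * \<beta>\<close>.
  An odd block satisfies exactly one of the conditions \<open>\<kappa> = 1\<close> and
  \<open>\<kappa> = (-1) ^ k\<close>, according to its index. An even block satisfies both if its
  index is \<open>- 1\<close>, and neither otherwise; in the former case the two counts differ only
  at \<open>w b = t\<close>, which gives the term \<open>m_zero\<close>.\<close>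

definition block_count ::
    "nat \<Rightarrow> (nat \<Rightarrow> real) \<Rightarrow> (nat \<Rightarrow> nat) \<Rightarrow> (nat \<Rightarrow> complex) \<Rightarrow> real \<Rightarrow> int"
  where "block_count N w k \<kappa> t =
    int (card {b \<in> {..<N}. \<kappa> b = 1 \<and> w b < t}) - int (card {b \<in> {..<N}. \<kappa> b = (-1) ^ k b \<and> w b \<le> t})"

text \<open>Twice the dimension, minus \<open>k\<close>, of the largest initial segment of a Jordan chain of length
  \<open>k\<close> on which the shifted form \<open>h ((T - t) v) v\<close> is nonnegative.\<close>

definition chain_part :: "nat \<Rightarrow> complex \<Rightarrow> real \<Rightarrow> real \<Rightarrow> nat"
  where "chain_part k \<kappa> w t =
    (if even k then (if w = t \<and> \<kappa> = 1 then k div 2 + 1 else k div 2)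
     else if (\<kappa> = 1 \<and> t \<le> w) \<or> (\<kappa> = -1 \<and> w \<le> t) then (k + 1) div 2 else (k - 1) div 2)"

lemma chain_part_le: "k > 0 \<Longrightarrow> chain_part k \<kappa> w t \<le> k"
  unfolding chain_part_def by (auto elim!: evenE oddE)

text \<open>The dimension \<open>chain_part\<close> is compared with half the length. The right-hand
  side separates a part constant in \<open>t\<close>, the signature of \<open>h\<close> on the
  chain, from twice the share of the block in \<open>block_count\<close>.\<close>

lemma chain_part_excess:
  assumes "\<kappa> \<in> {1, -1 :: complex}" "k > 0"
  shows "2 * int (chain_part k \<kappa> w t) - int k
    = of_bool (\<kappa> = 1) - of_bool (\<kappa> = (-1) ^ k)
      - 2 * (of_bool (\<kappa> = 1 \<and> w < t) - of_bool (\<kappa> = (-1) ^ k \<and> w \<le> t))"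
proof (cases "even k")
  case True
  then show ?thesis using assms(1) by (auto simp: chain_part_def elim!: evenE)
next
  case False
  then show ?thesis using assms(1) by (auto simp: chain_part_def elim!: oddE)
qed

section \<open>Dimension counts and necessity\<close>

context hermitian_form
begin

lemma diagonal_form:
  assumes S: "lin S" and fin: "finite X"
    and d: "\<And>p q. p \<in> X \<Longrightarrow> q \<in> X \<Longrightarrow> h (S (F p)) (F q) = (if p = q then of_real (\<gamma> p) else 0)"
  shows "h (S (\<Sum>p\<in>X. a p *s F p)) (\<Sum>p\<in>X. a p *s F p) = of_real (\<Sum>p\<in>X. (cmod (a p))\<^sup>2 * \<gamma> p)"
proof -
  have "h (S (\<Sum>p\<in>X. a p *s F p)) (\<Sum>p\<in>X. a p *s F p)
      = (\<Sum>p\<in>X. \<Sum>q\<in>X. cnj (a q) * (a p * h (S (F p)) (F q)))"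
    by (simp add: lin_simps[OF S] h_sum_left h_sum_right h_scale_left h_scale_right sum_distrib_left)
      (subst sum.swap, simp)
  also have "\<dots> = (\<Sum>p\<in>X. \<Sum>q\<in>X. if p = q then cnj (a p) * (a p * of_real (\<gamma> p)) else 0)"
    by (intro sum.cong refl) (simp add: d)
  also have "\<dots> = (\<Sum>p\<in>X. cnj (a p) * (a p * of_real (\<gamma> p)))"
    using fin by simp
  also have "\<dots> = (\<Sum>p\<in>X. of_real ((cmod (a p))\<^sup>2 * \<gamma> p))"
  proof (intro sum.cong refl)
    fix p
    have "cnj (a p) * (a p * of_real (\<gamma> p)) = (a p * cnj (a p)) * of_real (\<gamma> p)" by simp
    then show "cnj (a p) * (a p * of_real (\<gamma> p)) = of_real ((cmod (a p))\<^sup>2 * \<gamma> p)"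
      unfolding of_real_mult complex_norm_square .
  qed
  finally show ?thesis by simp
qed

lemma family_pair_card_le:
  assumes d: "dim_le m V" and fin: "finite I" "finite J"
    and f: "\<And>i. i \<in> I \<Longrightarrow> f i \<in> V" and g: "\<And>j. j \<in> J \<Longrightarrow> g j \<in> V"
    and ind: "\<And>c c'. (\<Sum>i\<in>I. c i *s f i) + (\<Sum>j\<in>J. c' j *s g j) = 0 \<Longrightarrow>
      (\<forall>i\<in>I. c i = 0) \<and> (\<forall>j\<in>J. c' j = 0)"
  shows "card I + card J \<le> m"
proof -
  have "card (I <+> J) \<le> m"
  proof (rule family_card_le[OF d])
    show "finite (I <+> J)" using fin by simp
    show "case_sum f g ` (I <+> J) \<subseteq> V" using f g by auto
    fix c i assume z: "(\<Sum>i\<in>I <+> J. c i *s case_sum f g i) = 0" and i: "i \<in> I <+> J"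
    have "(\<forall>i\<in>I. c (Inl i) = 0) \<and> (\<forall>j\<in>J. c (Inr j) = 0)"
      by (rule ind) (use z fin in \<open>simp add: sum.Plus\<close>)
    then show "c i = 0" using i by auto
  qed
  then show ?thesis using fin by (simp add: card_Plus)
qed

text \<open>A common vector of the two spans has a nonnegative value and, with nonzero coefficients
  on the \<open>l i\<close>, a negative one. So the dimensions add up. The case of a shifted
  \<open>T\<close> gives necessity; the case of the identity bounds the positive part of
  \<open>h\<close> in the sufficiency proof.\<close>

lemma definite_family_card_le:
  assumes d: "dim_le m V" and S: "lin S" and fin: "finite X" and F: "\<And>p. p \<in> X \<Longrightarrow> F p \<in> V"
    and dg: "\<And>p q. p \<in> X \<Longrightarrow> q \<in> X \<Longrightarrow> h (S (F p)) (F q) = (if p = q then of_real (\<gamma> p) else 0)"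
    and \<gamma>: "\<And>p. p \<in> X \<Longrightarrow> \<gamma> p \<ge> 0"
    and ind: "\<And>a. (\<Sum>p\<in>X. a p *s F p) = 0 \<Longrightarrow> \<forall>p\<in>X. a p = 0"
    and l: "\<And>i. i < n \<Longrightarrow> l i \<in> V"
    and neg: "\<And>c i. i < n \<Longrightarrow> c i \<noteq> 0 \<Longrightarrow> Re (h (S (\<Sum>i<n. c i *s l i)) (\<Sum>i<n. c i *s l i)) < 0"
  shows "card X + n \<le> m"
proof -
  have "card X + card {..<n} \<le> m"
  proof (rule family_pair_card_le[OF d fin finite_lessThan F])
    fix a c assume z: "(\<Sum>p\<in>X. a p *s F p) + (\<Sum>i<n. c i *s l i) = 0"
    define u where "u = (\<Sum>i<n. c i *s l i)"
    define v where "v = (\<Sum>p\<in>X. a p *s F p)"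
    have uv: "v = - u" using z by (simp add: u_def v_def eq_neg_iff_add_eq_0)
    have "Re (h (S u) u) = Re (h (S v) v)"
      using lin_simps(3)[OF S, of 0 u] by (simp add: uv lin_simps(1)[OF S] h_uminus_left h_diff_right[of _ 0 u, simplified])
    moreover have "Re (h (S v) v) \<ge> 0"
      unfolding v_def by (subst diagonal_form[OF S fin dg]) (auto intro!: sum_nonneg mult_nonneg_nonneg \<gamma>)
    ultimately have "\<not> Re (h (S u) u) < 0" by simp
    then have c: "c i = 0" if "i < n" for i using neg[OF that] unfolding u_def by metis
    then have "u = 0" by (simp add: u_def)
    then have "v = 0" using uv by simp
    then have "\<forall>p\<in>X. a p = 0" using ind unfolding v_def by simp
    then show "(\<forall>p\<in>X. a p = 0) \<and> (\<forall>i\<in>{..<n}. c i = 0)" using c by simp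
  qed (use l in auto)
  then show ?thesis by simp
qed

lemma chain_part_gram:
  fixes k :: nat
  assumes k: "k > 0" and \<kappa>: "\<kappa> \<in> {1, -1}" and i: "i < chain_part k \<kappa> w t" and j: "j < chain_part k \<kappa> w t"
  shows "of_real (w - t) * (if i + j + 1 = k then \<kappa> else 0) + (if i \<noteq> 0 \<and> i + j = k then \<kappa> else 0)
    = (if i = j then of_real (if i + 1 = chain_part k \<kappa> w t
         then (if even k then of_bool (w = t \<and> \<kappa> = 1)
           else if (\<kappa> = 1 \<and> t \<le> w) \<or> (\<kappa> = -1 \<and> w \<le> t) then \<bar>w - t\<bar> else 0) else 0) else 0)"
proof (cases "even k")
  case True
  then obtain m where m: "k = 2 * m" by (rule evenE)
  show ?thesis using k i j \<kappa> unfolding m chain_part_def by (auto split: if_splits)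
next
  case False
  then obtain m where m: "k = 2 * m + 1" by (rule oddE)
  show ?thesis using k i j \<kappa> unfolding m chain_part_def by (auto split: if_splits)
qed

lemma jordan_span_card:
  assumes s: "sa_space T V" and J: "jordan_family T V N w k \<kappa> e"
    and S: "finite S" "perp (chain_idx N k) (case_prod e) V \<subseteq> span S"
    and B: "independent B" "B \<subseteq> V"
  shows "card B \<le> (\<Sum>b<N. k b) + card S"
proof -
  let ?C = "chain_idx N k"
  have "V \<subseteq> span (case_prod e ` ?C \<union> S)"
    using gram_system_span[OF jordan_family_gram_system[OF J] sa_spaceD(1)[OF s]
        jordan_family_in[OF J] S(2)] .
  then have "B \<subseteq> span (case_prod e ` ?C \<union> S)" using B(2) by (rule order_trans[rotated])
  then have "card B \<le> card (case_prod e ` ?C \<union> S)"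
    using independent_span_bound[OF _ B(1)] S(1) by simp
  also have "\<dots> \<le> card (case_prod e ` ?C) + card S" by (rule card_Un_le)
  also have "card (case_prod e ` ?C) \<le> card ?C" by (rule card_image_le) simp
  also have "card ?C = (\<Sum>b<N. k b)" by simp
  finally show ?thesis by simp
qed

lemma block_count_nonneg:
  assumes s: "sa_space T V" and d: "dim_le (2 * n) V"
    and B: "independent B" "B \<subseteq> V" "card B = 2 * n"
    and J: "jordan_family T V N w k \<kappa> e" and nr: "no_real T (perp (chain_idx N k) (case_prod e) V)"
    and l: "\<And>i. i < n \<Longrightarrow> l i \<in> V" "\<And>i j. i < n \<Longrightarrow> j < n \<Longrightarrow> h (l i) (l j) = 0"
    and neg: "\<And>c i. i < n \<Longrightarrow> c i \<noteq> 0 \<Longrightarrow> Re (h (T (\<Sum>i<n. c i *s l i)) (\<Sum>i<n. c i *s l i)) < 0"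
  shows "block_count N w k \<kappa> t \<ge> 0"
proof -
  note V = sa_spaceD[OF s]
  note JD = jordan_familyD[OF J]
  let ?C = "chain_idx N k" and ?E = "case_prod e"
  note g = jordan_family_gram_system[OF J]
  let ?U = "perp ?C ?E V"
  have saU: "sa_space T ?U" by (rule sa_space_perp[OF s g jordan_family_in[OF J] jordan_family_chain_in_span[OF J]])
  obtain r x y where L: "lagrangian_pair T ?U r x y"
    using lagrangian_pair_exists[OF saU nr] by metis
  note LD = lagrangian_pairD[OF L]
  obtain S where S: "finite S" "card S \<le> 2 * r" "?U \<subseteq> span S" using LD(1) by metis
  have dimV: "2 * n \<le> (\<Sum>b<N. k b) + 2 * r"
    using jordan_span_card[OF s J S(1,3) B(1,2)] B(3) S(2) by linarith
  have xV: "x i \<in> V" and xe: "b < N \<Longrightarrow> j < k b \<Longrightarrow> h (x i) (e b j) = 0"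
    "b < N \<Longrightarrow> j < k b \<Longrightarrow> h (e b j) (x i) = 0" if "i < r" for i b j
    using LD(2)[OF that] h_eq_0_sym[of "x i"] by (auto simp: perp_def)
  \<comment> \<open>The nonnegative family consists of the chain segments and the
    \<open>x i\<close>; it is independent of the \<open>n\<close> negative vectors, so it has at
    most \<open>n\<close> members. Comparison with \<open>dimV\<close> cancels
    \<open>r\<close>.\<close>
  have main: "2 * (\<Sum>b<N. chain_part (k b) (\<kappa> b) (w b) t) \<le> (\<Sum>b<N. k b)" for t
  proof -
    let ?c = "\<lambda>b. chain_part (k b) (\<kappa> b) (w b) t"
    define A where "A u = T u - of_real t *s u" for u
    have lA: "lin A" by (intro linI) (simp_all add: A_def lin_simps[OF V(3)] algebra_simps)
    have hA: "h (A u) v = h u (A v)" if "u \<in> V" "v \<in> V" for u v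
      using V(5)[OF that] by (simp add: A_def h_diff_left h_diff_right h_scale_left h_scale_right)
    define D where "D = (SIGMA b:{..<N}. {..<?c b})"
    have DC: "D \<subseteq> ?C" using chain_part_le JD(1) unfolding D_def
      by (auto intro: order.strict_trans2)
    let ?X = "D <+> {..<r}" and ?F = "case_sum ?E x"
    define \<gamma> where "\<gamma> p = (case p of Inl (b, j) \<Rightarrow> (if j + 1 = ?c b
         then (if even (k b) then of_bool (w b = t \<and> \<kappa> b = 1)
           else if (\<kappa> b = 1 \<and> t \<le> w b) \<or> (\<kappa> b = -1 \<and> w b \<le> t) then \<bar>w b - t\<bar> else 0) else 0)
       | Inr _ \<Rightarrow> 0)" for p :: "(nat \<times> nat) + nat"
    have Ae: "A (e b j) = of_real (w b - t) *s e b j + (if j = 0 then 0 else e b (j - 1))"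
      if "b < N" "j < k b" for b j
      using JD(4)[OF that] by (simp add: A_def scale_left_diff_distrib)
    have dg: "h (A (?F p)) (?F q) = (if p = q then of_real (\<gamma> p) else 0)" if pq: "p \<in> ?X" "q \<in> ?X" for p q
    proof -
      have cc: "h (A (e b i)) (e b' j) = (if b = b' \<and> i = j then of_real (\<gamma> (Inl (b, i))) else 0)"
        if "(b, i) \<in> D" "(b', j) \<in> D" for b i b' j
      proof -
        have b: "b < N" "i < k b" "b' < N" "j < k b'" and ij: "i < ?c b" "j < ?c b'"
          using that DC by (auto simp: D_def)
        have "i - 1 < k b" using b by simp
        then have hA: "h (A (e b i)) (e b' j)
            = of_real (w b - t) * (if b = b' \<and> i + j + 1 = k b then \<kappa> b else 0)
            + (if i \<noteq> 0 \<and> b = b' \<and> i + j = k b then \<kappa> b else 0)"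
          unfolding Ae[OF b(1,2)] using JD(5)[OF b(1,3)] b by (auto simp: h_add_left h_scale_left)
        show ?thesis
        proof (cases "b = b'")
          case True
          then show ?thesis
            using chain_part_gram[OF JD(1,2)[OF b(1)] ij(1), of j] ij(2) hA by (simp add: \<gamma>_def)
        next
          case False
          then show ?thesis using hA by simp
        qed
      qed
      have cx: "h (A (e b i)) (x j) = 0" "h (A (x j)) (e b i) = 0" if "(b, i) \<in> D" "j < r" for b i j
      proof -
        have b: "b < N" "i < k b" using that DC by auto
        show "h (A (e b i)) (x j) = 0"
          unfolding Ae[OF b] using xe(2)[OF that(2) b(1)] b(2) by (simp add: h_add_left h_scale_left)
        then show "h (A (x j)) (e b i) = 0"
          using hA[OF xV[OF that(2)] JD(3)[OF b]] h_eq_0_sym by metis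
      qed
      have xx: "h (A (x i)) (x j) = 0" if "i < r" "j < r" for i j
        using LD(5,6)[OF that] by (simp add: A_def h_diff_left h_scale_left)
      show ?thesis
        using pq by (elim PlusE) (auto simp: cc cx xx \<gamma>_def split: if_splits)
    qed
    have "card ?X + n \<le> 2 * n"
    proof (rule definite_family_card_le[OF d lA _ _ dg])
      show "finite ?X" by (simp add: D_def)
      have "?E q \<in> V" if "q \<in> D" for q using jordan_family_in[OF J subsetD[OF DC that]] .
      then show "?F p \<in> V" if "p \<in> ?X" for p using that xV by (elim PlusE) simp_all
      show "\<gamma> p \<ge> 0" for p by (auto simp: \<gamma>_def split: sum.split)
      show "l i \<in> V" if "i < n" for i using l(1) that .
    next
      fix a assume z: "(\<Sum>p\<in>?X. a p *s ?F p) = 0"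
      \<comment> \<open>Extended by 0 from \<open>D\<close> to all chain positions, since the
        coefficients are read off with the reversed chain, which leaves \<open>D\<close>.\<close>
      define a' where "a' p = (if p \<in> D then a (Inl p) else 0)" for p
      define u where "u = (\<Sum>p\<in>?C. a' p *s ?E p)"
      define v where "v = (\<Sum>i<r. a (Inr i) *s x i)"
      have "(\<Sum>p\<in>D. a (Inl p) *s ?E p) = u"
        unfolding u_def a'_def by (rule sum.mono_neutral_cong_left) (use DC in auto)
      then have uv: "u + v = 0" using z by (simp add: sum.Plus D_def v_def)
      have a': "a' p = 0" if p: "p \<in> ?C" for p
      proof -
        obtain b j where b: "p = (b, j)" "b < N" "j < k b" using p by auto
        let ?s = "\<lambda>(b, j). (b, k b - 1 - j)"
        have "h u (?E (?s p)) = a' p * \<kappa> b"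
          using gram_system_pair_sum[OF g p, of a'] b(1) by (simp add: u_def)
        moreover have "h v (?E (?s p)) = 0"
          using b xe(1) by (simp add: v_def h_sum_left h_scale_left)
        ultimately have "h (u + v) (?E (?s p)) = a' p * \<kappa> b" by (simp add: h_add_left)
        then have "a' p * \<kappa> b = 0" using uv by simp
        then show ?thesis using JD(2)[OF b(2)] by auto
      qed
      then have "u = 0" unfolding u_def by (intro sum.neutral) simp
      then have "(\<Sum>i<r. a (Inr i) *s x i) = 0" using uv by (simp add: v_def)
      then have "\<forall>i<r. a (Inr i) = 0" using LD(4)[rule_format, of "\<lambda>i. a (Inr i)"] by simp
      moreover have "a (Inl p) = 0" if "p \<in> D" for p using a'[of p] that DC by (auto simp: a'_def)
      ultimately show "\<forall>p\<in>?X. a p = 0" by (auto simp: Plus_def)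
    next
      fix c :: "nat \<Rightarrow> complex" and i assume i: "i < n" "c i \<noteq> 0"
      define v where "v = (\<Sum>i<n. c i *s l i)"
      have "h v v = 0" using l(2) by (simp add: v_def h_sum_left h_sum_right h_scale_left h_scale_right)
      then have "h (A v) v = h (T v) v" by (simp add: A_def h_diff_left h_scale_left)
      then show "Re (h (A (\<Sum>i<n. c i *s l i)) (\<Sum>i<n. c i *s l i)) < 0"
        using neg[of i c] i by (simp add: v_def)
    qed
    moreover have "card ?X = (\<Sum>b<N. ?c b) + r" by (simp add: D_def card_Plus)
    ultimately show ?thesis using dimV by linarith
  qed
  \<comment> \<open>The part of the total excess that does not depend on \<open>t\<close>.\<close>
  define p where "p = (\<Sum>b<N. of_bool (\<kappa> b = 1) - of_bool (\<kappa> b = (-1) ^ k b) :: int)"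
  have bc: "block_count N w k \<kappa> t
    = (\<Sum>b<N. of_bool (\<kappa> b = 1 \<and> w b < t) - of_bool (\<kappa> b = (-1) ^ k b \<and> w b \<le> t))" for t
    by (simp add: block_count_def sum_subtractf of_bool_def sum.If_cases Int_def)
  have ineq: "p \<le> 2 * block_count N w k \<kappa> t" for t
  proof -
    have "(\<Sum>b<N. 2 * int (chain_part (k b) (\<kappa> b) (w b) t) - int (k b)) \<le> 0"
      using main[of t] by (simp add: sum_subtractf flip: sum_distrib_left of_nat_sum)
    also have "(\<Sum>b<N. 2 * int (chain_part (k b) (\<kappa> b) (w b) t) - int (k b))
      = (\<Sum>b<N. (of_bool (\<kappa> b = 1) - of_bool (\<kappa> b = (-1) ^ k b))
      - 2 * (of_bool (\<kappa> b = 1 \<and> w b < t) - of_bool (\<kappa> b = (-1) ^ k b \<and> w b \<le> t)))"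
      by (intro sum.cong refl chain_part_excess) (use JD(1,2) in auto)
    finally show ?thesis unfolding p_def bc by (simp add: sum_subtractf sum_distrib_left)
  qed
  obtain t0 where "w b < t0" if "b < N" for b
  proof (rule that)
    show "w b < (\<Sum>b<N. \<bar>w b\<bar>) + 1" if "b < N" for b
    proof -
      have "\<bar>w b\<bar> \<le> (\<Sum>b<N. \<bar>w b\<bar>)" using that by (intro member_le_sum) auto
      then show ?thesis by linarith
    qed
  qed
  \<comment> \<open>To the right of all eigenvalues every block is counted. So
    \<open>p \<le> 2 * p\<close>, hence \<open>p \<ge> 0\<close>, and the inequality at
    \<open>t\<close> gives the claim.\<close>
  then have "block_count N w k \<kappa> t0 = p"
    unfolding bc p_def by (intro sum.cong refl) (auto intro: less_imp_le)
  then have "p \<ge> 0" using ineq[of t0] by simp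
  then show ?thesis using ineq[of t] by simp
qed

end

section \<open>Perturbation and matching of Jordan blocks\<close>

text \<open>A marriage theorem on the line: the element of \<open>M\<close> with the largest
  \<open>v\<close> is matched last. At its value the hypothesis provides more candidates than the
  other elements have used.\<close>

lemma strictly_increasing_matching:
  fixes u v :: "'b \<Rightarrow> real"
  assumes "finite M" "finite P"
    and "\<And>t. card {b\<in>M. v b \<le> t} \<le> card {b\<in>P. u b < t}"
  shows "\<exists>f. inj_on f M \<and> f ` M \<subseteq> P \<and> (\<forall>b\<in>M. u (f b) < v b)"
  using assms(1,3)
proof (induction "card M" arbitrary: M)
  case 0
  then show ?case by simp
next
  case (Suc m)
  then have ne: "M \<noteq> {}" "finite M" by auto
  have "Max (v ` M) \<in> v ` M" using ne by (intro Max_in) auto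
  then obtain b where "b \<in> M" "v b = Max (v ` M)" by auto
  then have b: "b \<in> M" "\<And>x. x \<in> M \<Longrightarrow> v x \<le> v b" using ne(2) by simp_all
  let ?M = "M - {b}"
  have "card {x\<in>?M. v x \<le> t} \<le> card {x\<in>P. u x < t}" for t
    by (rule order_trans[OF card_mono Suc.prems(2)]) (use ne(2) in auto)
  moreover have "m = card ?M" using Suc.hyps(2) b(1) ne(2) by simp
  ultimately obtain f where f: "inj_on f ?M" "f ` ?M \<subseteq> P" "\<forall>x\<in>?M. u (f x) < v x"
    using Suc.hyps(1)[of ?M] finite_Diff[OF ne(2), of "{b}"] by metis
  have "{x\<in>M. v x \<le> v b} = M" using b(2) by auto
  then have "Suc m \<le> card {x\<in>P. u x < v b}" using Suc.prems(2)[of "v b"] Suc.hyps(2) by simp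
  moreover have "card (f ` ?M) \<le> m"
    using card_image_le[of ?M f] ne(2) \<open>m = card ?M\<close> by simp
  ultimately have card_less: "card (f ` ?M) < card {x\<in>P. u x < v b}" by linarith
  have "\<not> {x\<in>P. u x < v b} \<subseteq> f ` ?M"
  proof
    assume "{x\<in>P. u x < v b} \<subseteq> f ` ?M"
    then have "card {x\<in>P. u x < v b} \<le> card (f ` ?M)" using ne(2) by (intro card_mono) auto
    then show False using card_less by linarith
  qed
  then obtain a where a: "a \<in> P" "u a < v b" "a \<notin> f ` ?M" by blast
  have "(f(b := a)) ` (?M - {b}) = f ` ?M" by (intro image_cong) auto
  then have "inj_on (f(b := a)) (insert b ?M)"
    unfolding inj_on_insert using inj_on_fun_updI[OF f(1) a(3)] a(3) by simp
  then have "inj_on (f(b := a)) M" using b(1) by (simp add: insert_absorb)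
  moreover have "(f(b := a)) ` M \<subseteq> P" using a(1) f(2) by auto
  moreover have "\<forall>x\<in>M. u ((f(b := a)) x) < v x" using a(2) f(3) by auto
  ultimately show ?case by (intro exI[of _ "f(b := a)"] conjI)
qed

section \<open>The corner perturbation, its eigenvectors and sufficiency\<close>

context hermitian_form
begin

text \<open>A rank-one term per block closes the chain to a cycle: the image of \<open>e b 0\<close>
  acquires a multiple of the last chain vector. The new eigenvalues are \<open>w b + z\<close> with
  \<open>z ^ k b = d ^ k b * \<kappa> b\<close>.\<close>

definition corner_op :: "nat \<Rightarrow> (nat \<Rightarrow> nat) \<Rightarrow> (nat \<Rightarrow> nat \<Rightarrow> 'a) \<Rightarrow> real \<Rightarrow> ('a \<Rightarrow> 'a) \<Rightarrow> 'a \<Rightarrow> 'a"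
  where "corner_op N k e d T u =
    T u + (\<Sum>b<N. (of_real (d ^ k b) * h u (e b (k b - 1))) *s e b (k b - 1))"

definition chain_vec :: "(nat \<Rightarrow> nat) \<Rightarrow> (nat \<Rightarrow> nat \<Rightarrow> 'a) \<Rightarrow> nat \<Rightarrow> real \<Rightarrow> 'a"
  where "chain_vec k e b z = (\<Sum>j<k b. of_real (z ^ j) *s e b j)"

lemma corner_op_sa_space:
  assumes s: "sa_space T V" and J: "jordan_family T V N w k \<kappa> e"
  shows "sa_space (corner_op N k e d T) V"
proof -
  note V = sa_spaceD[OF s]
  note JD = jordan_familyD[OF J]
  have eV: "e b (k b - 1) \<in> V" if "b < N" for b using JD(1,3) that by simp
  have "lin (corner_op N k e d T)"
    by (intro linI) (simp_all add: corner_op_def lin_simps[OF V(3)] h_add_left h_scale_left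
      distrib_left scale_left_distrib sum.distrib scale_right_distrib scale_sum_right mult.left_commute)
  moreover have "corner_op N k e d T ` V \<subseteq> V"
    using V(4) eV by (auto simp: corner_op_def intro!: subspace_add[OF V(1)] subspace_sum[OF V(1)]
        subspace_scale[OF V(1)])
  moreover have "h (corner_op N k e d T x) y = h x (corner_op N k e d T y)" if "x \<in> V" "y \<in> V" for x y
    using V(5)[OF that] by (simp add: corner_op_def h_add_left h_add_right h_sum_left h_sum_right
        h_scale_left h_scale_right h_cnj mult_ac)
  ultimately show ?thesis using s unfolding sa_space_def by simp
qed

text \<open>Each block adds a nonnegative multiple of a squared modulus, so a negative bound for the
  perturbed operator is one for \<open>T\<close>.\<close>

lemma corner_op_form_ge:
  assumes "d \<ge> 0" shows "Re (h (T u) u) \<le> Re (h (corner_op N k e d T u) u)"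
proof -
  have "h (corner_op N k e d T u) u
    = h (T u) u + (\<Sum>b<N. of_real (d ^ k b * (cmod (h u (e b (k b - 1))))\<^sup>2))"
  proof -
    have "h ((of_real (d ^ k b) * h u (e b (k b - 1))) *s e b (k b - 1)) u
      = of_real (d ^ k b * (cmod (h u (e b (k b - 1))))\<^sup>2)" for b
    proof -
      have "h ((of_real (d ^ k b) * h u (e b (k b - 1))) *s e b (k b - 1)) u
        = of_real (d ^ k b) * (h u (e b (k b - 1)) * cnj (h u (e b (k b - 1))))"
        by (simp add: h_scale_left h_cnj)
      then show ?thesis unfolding of_real_mult complex_norm_square .
    qed
    then show ?thesis by (simp add: corner_op_def h_add_left h_sum_left)
  qed
  then show ?thesis using assms by (simp add: sum_nonneg)
qed

lemma corner_op_chain: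
  assumes J: "jordan_family T V N w k \<kappa> e" and b: "b < N" and j: "j < k b"
  shows "corner_op N k e d T (e b j) = of_real (w b) *s e b j
    + (if j = 0 then (of_real (d ^ k b) * \<kappa> b) *s e b (k b - 1) else e b (j - 1))"
proof -
  note JD = jordan_familyD[OF J]
  have "(\<Sum>b'<N. (of_real (d ^ k b') * h (e b j) (e b' (k b' - 1))) *s e b' (k b' - 1))
    = (\<Sum>b'<N. if b' = b then (if j = 0 then (of_real (d ^ k b) * \<kappa> b) *s e b (k b - 1) else 0) else 0)"
  proof (intro sum.cong refl)
    fix b' assume "b' \<in> {..<N}"
    then have b': "b' < N" by simp
    have "k b' - 1 < k b'" using JD(1)[OF b'] by simp
    then show "(of_real (d ^ k b') * h (e b j) (e b' (k b' - 1))) *s e b' (k b' - 1)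
      = (if b' = b then (if j = 0 then (of_real (d ^ k b) * \<kappa> b) *s e b (k b - 1) else 0) else 0)"
      using JD(5)[OF b b' j] JD(1)[OF b'] j by auto
  qed
  also have "\<dots> = (if j = 0 then (of_real (d ^ k b) * \<kappa> b) *s e b (k b - 1) else 0)"
    using b by simp
  finally show ?thesis unfolding corner_op_def JD(4)[OF b j] by (simp add: add.assoc)
qed

text \<open>The shift multiplies a geometric sequence of coefficients by \<open>z\<close>, and the
  cycle closes at the last vector because of the equation for \<open>z\<close>.\<close>

lemma corner_op_chain_vec:
  assumes J: "jordan_family T V N w k \<kappa> e" and b: "b < N" and s: "sa_space T V"
    and z: "of_real (z ^ k b) = of_real (d ^ k b) * \<kappa> b"
  shows "corner_op N k e d T (chain_vec k e b z) = of_real (w b + z) *s chain_vec k e b z"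
proof -
  let ?T = "corner_op N k e d T"
  have l: "lin ?T" using sa_spaceD(3)[OF corner_op_sa_space[OF s J]] .
  obtain m where m: "k b = Suc m" using jordan_familyD(1)[OF J b] by (cases "k b") auto
  have "?T (chain_vec k e b z) = (\<Sum>j<k b. of_real (z ^ j) *s ?T (e b j))"
    by (simp add: chain_vec_def lin_simps[OF l])
  also have "\<dots> = (\<Sum>j<k b. of_real (z ^ j) *s of_real (w b) *s e b j)
      + (\<Sum>j<k b. of_real (z ^ j) *s (if j = 0 then of_real (z ^ k b) *s e b (k b - 1) else e b (j - 1)))"
    by (simp add: corner_op_chain[OF J b, where d = d, folded z] scale_right_distrib sum.distrib)
  also have "(\<Sum>j<k b. of_real (z ^ j) *s (if j = 0 then of_real (z ^ k b) *s e b (k b - 1) else e b (j - 1)))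
      = of_real (z ^ k b) *s e b m + (\<Sum>j<m. of_real (z ^ Suc j) *s e b j)"
    unfolding m by (subst sum.lessThan_Suc_shift) simp
  also have "\<dots> = (\<Sum>j<k b. of_real (z ^ Suc j) *s e b j)"
    unfolding m by (simp add: add.commute)
  also have "\<dots> = of_real z *s chain_vec k e b z"
    by (simp add: chain_vec_def scale_sum_right)
  also have "(\<Sum>j<k b. of_real (z ^ j) *s of_real (w b) *s e b j) = of_real (w b) *s chain_vec k e b z"
    by (simp add: chain_vec_def scale_sum_right mult.commute)
  finally show ?thesis by (simp add: scale_left_distrib)
qed

text \<open>Only the \<open>k b\<close> index pairs with \<open>i + j + 1 = k b\<close> contribute,
  all equally. For \<open>d > 0\<close> this is positive at \<open>z = d\<close>,
  \<open>\<kappa> b = 1\<close>, and negative at \<open>z = - d\<close>,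
  \<open>\<kappa> b = (-1) ^ k b\<close>.\<close>

lemma h_chain_vec:
  assumes J: "jordan_family T V N w k \<kappa> e" and b: "b < N"
  shows "h (chain_vec k e b z) (chain_vec k e b z) = of_nat (k b) * of_real (z ^ (k b - 1)) * \<kappa> b"
proof -
  note JD = jordan_familyD[OF J]
  have "h (e b i) (chain_vec k e b z) = of_real (z ^ (k b - 1 - i)) * \<kappa> b" if i: "i < k b" for i
  proof -
    have "h (e b i) (chain_vec k e b z)
      = (\<Sum>j<k b. if j = k b - 1 - i then of_real (z ^ (k b - 1 - i)) * \<kappa> b else 0)"
      unfolding chain_vec_def h_sum_right h_scale_right
      by (intro sum.cong refl) (use JD(5)[OF b b i] i in \<open>auto simp del: of_real_power\<close>)
    then show ?thesis using i by simp
  qed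
  then have "h (chain_vec k e b z) (chain_vec k e b z)
    = (\<Sum>i<k b. of_real (z ^ i) * (of_real (z ^ (k b - 1 - i)) * \<kappa> b))"
    unfolding chain_vec_def[of k e b z] h_sum_left h_scale_left by (simp add: chain_vec_def)
  also have "\<dots> = (\<Sum>i<k b. of_real (z ^ (k b - 1)) * \<kappa> b)"
  proof (intro sum.cong refl)
    fix i assume "i \<in> {..<k b}"
    then have "z ^ i * z ^ (k b - 1 - i) = z ^ (k b - 1)" by (simp flip: power_add)
    then show "of_real (z ^ i) * (of_real (z ^ (k b - 1 - i)) * \<kappa> b) = of_real (z ^ (k b - 1)) * \<kappa> b"
      by (metis mult.assoc of_real_mult)
  qed
  finally show ?thesis by simp
qed

lemma chain_vec_in:
  assumes "jordan_family T V N w k \<kappa> e" "b < N" "subspace V"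
  shows "chain_vec k e b z \<in> V"
  unfolding chain_vec_def using jordan_familyD(3)[OF assms(1,2)] assms(3)
  by (auto intro!: subspace_sum subspace_scale)

lemma real_eigenvectors_orthogonal:
  assumes s: "sa_space T V" and u: "u \<in> V" "T u = of_real a *s u"
    and v: "v \<in> V" "T v = of_real b *s v" and ab: "a \<noteq> b"
  shows "h u v = 0"
proof -
  have "of_real a * h u v = of_real b * h u v"
    using sa_spaceD(5)[OF s u(1) v(1)] by (simp add: u(2) v(2) h_scale_left h_scale_right)
  then show ?thesis using ab by simp
qed

text \<open>Absolute values leave \<open>z = d\<close> or \<open>z = - d\<close>, and the equation
  then determines \<open>\<kappa>\<close>. The two cases become the sets \<open>P\<close> and
  \<open>M\<close> of blocks below.\<close>

lemma real_power_eq_sign_power: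
  fixes d z :: real and \<kappa> :: complex
  assumes "d > 0" "k > 0" "\<kappa> \<in> {1, -1}" "of_real (z ^ k) = of_real (d ^ k) * \<kappa>"
  shows "(z = d \<and> \<kappa> = 1) \<or> (z = - d \<and> \<kappa> = (-1) ^ k)"
proof -
  have d: "of_real (d ^ k) \<noteq> (0::complex)" using assms(1) by simp
  have "\<bar>z\<bar> ^ k = d ^ k"
  proof -
    have "cmod (of_real (z ^ k)) = cmod (of_real (d ^ k) * \<kappa>)" using assms(4) by (rule arg_cong)
    moreover have "cmod \<kappa> = 1" using assms(3) by auto
    ultimately have "\<bar>z ^ k\<bar> = \<bar>d ^ k\<bar>" by (simp only: norm_mult norm_of_real mult_1_right)
    then show ?thesis using assms(1) by (simp add: power_abs)
  qed
  then have "\<bar>z\<bar> = d" by (rule power_eq_imp_eq_base) (use assms(1,2) in auto)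
  then consider "z = d" | "z = - d" by linarith
  then show ?thesis
  proof cases
    case 1
    then have "of_real (d ^ k) * \<kappa> = of_real (d ^ k) * 1" using assms(4) by simp
    then have "\<kappa> = 1" unfolding mult_left_cancel[OF d] .
    then show ?thesis using 1 by blast
  next
    case 2
    then have "z ^ k = d ^ k * (-1) ^ k" using power_minus[of d k] by (simp only: mult.commute)
    then have "of_real (d ^ k) * \<kappa> = of_real (d ^ k) * (-1) ^ k"
      using assms(4) by (simp only: of_real_mult of_real_power of_real_minus of_real_1)
    then have "\<kappa> = (-1) ^ k" unfolding mult_left_cancel[OF d] .
    then show ?thesis using 2 by blast
  qed
qed

text \<open>The pairings of a real eigenvector with a chain form a geometric sequence with ratio
  \<open>z\<close>. Unless they vanish, closing the cycle makes \<open>z\<close> one of the real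
  solutions; then orthogonality to that \<open>chain_vec\<close> makes them vanish after all. So the
  vector is orthogonal to all chains, where the perturbation is not felt.\<close>

lemma corner_op_no_real:
  assumes s: "sa_space T V" and J: "jordan_family T V N w k \<kappa> e"
    and nr: "no_real T (perp (chain_idx N k) (case_prod e) V)" and d: "d > 0"
    and U: "U \<subseteq> V"
    and plus: "\<And>u b. u \<in> U \<Longrightarrow> b < N \<Longrightarrow> \<kappa> b = 1 \<Longrightarrow> h u (chain_vec k e b d) = 0"
    and minus: "\<And>u b. u \<in> U \<Longrightarrow> b < N \<Longrightarrow> \<kappa> b = (-1) ^ k b \<Longrightarrow> h u (chain_vec k e b (- d)) = 0"
  shows "no_real (corner_op N k e d T) U"
  unfolding no_real_def
proof (intro ballI allI impI)
  fix v and \<mu> :: real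
  assume v: "v \<in> U" and Tv: "corner_op N k e d T v = of_real \<mu> *s v"
  note V = sa_spaceD[OF s]
  note JD = jordan_familyD[OF J]
  note V' = sa_spaceD[OF corner_op_sa_space[OF s J, of d]]
  have vV: "v \<in> V" using v U by blast
  have z: "h v (e b j) = 0" if b: "b < N" and j: "j < k b" for b j
  proof -
    define a where "a i = h v (e b i)" for i
    define z where "z = \<mu> - w b"
    have rec: "of_real z * a i = (if i = 0 then of_real (d ^ k b) * \<kappa> b * a (k b - 1) else a (i - 1))"
      if i: "i < k b" for i
    proof -
      have "cnj (\<kappa> b) = \<kappa> b" using JD(2)[OF b] by auto
      moreover have "of_real \<mu> * a i = h v (corner_op N k e d T (e b i))"
        using V'(5)[OF vV JD(3)[OF b i]] by (simp add: a_def Tv h_scale_left)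
      ultimately show ?thesis unfolding corner_op_chain[OF J b i]
        by (auto simp: h_add_right h_scale_right a_def z_def algebra_simps)
    qed
    define A where "A = a (k b - 1)"
    have a: "a (k b - 1 - i) = of_real (z ^ i) * A" if "i < k b" for i
      using that
    proof (induction i)
      case 0
      show ?case by (simp add: A_def)
    next
      case (Suc i)
      have "of_real z * a (k b - 1 - i) = a (k b - 1 - i - 1)"
        using rec[of "k b - 1 - i"] Suc.prems by simp
      then show ?case using Suc by (simp add: mult.assoc)
    qed
    have k: "k b > 0" by (rule JD(1)[OF b])
    have "a 0 = of_real (z ^ (k b - 1)) * A" using a[of "k b - 1"] k by simp
    then have "of_real z * (of_real (z ^ (k b - 1)) * A) = of_real (d ^ k b) * \<kappa> b * A"
      using rec[OF k] by (simp add: A_def)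
    moreover have "z * z ^ (k b - 1) = z ^ k b" using k by (simp flip: power_Suc)
    ultimately have zk: "(of_real (z ^ k b) - of_real (d ^ k b) * \<kappa> b) * A = 0"
      by (metis left_diff_distrib mult.assoc of_real_mult right_minus_eq)
    have "A = 0"
    proof (rule ccontr)
      assume "A \<noteq> 0"
      then have zk: "of_real (z ^ k b) = of_real (d ^ k b) * \<kappa> b" using zk by simp
      have zd: "(z = d \<and> \<kappa> b = 1) \<or> (z = - d \<and> \<kappa> b = (-1) ^ k b)"
        by (rule real_power_eq_sign_power[OF d k JD(2)[OF b] zk])
      then have "h v (chain_vec k e b z) = 0" using plus[OF v b] minus[OF v b] by auto
      moreover have "h v (chain_vec k e b z) = of_nat (k b) * (of_real (z ^ (k b - 1)) * A)"
      proof -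
        have "h v (chain_vec k e b z) = (\<Sum>i<k b. of_real (z ^ i) * a i)"
          by (simp add: chain_vec_def h_sum_right h_scale_right a_def)
        also have "\<dots> = (\<Sum>i<k b. of_real (z ^ (k b - 1)) * A)"
        proof (intro sum.cong refl)
          fix i assume "i \<in> {..<k b}"
          then have i: "i < k b" "k b - 1 - (k b - 1 - i) = i" "k b - 1 - i < k b" by auto
          have "a i = of_real (z ^ (k b - 1 - i)) * A" using a[OF i(3)] i(2) by simp
          moreover have "z ^ i * z ^ (k b - 1 - i) = z ^ (k b - 1)" using i(1) by (simp flip: power_add)
          ultimately show "of_real (z ^ i) * a i = of_real (z ^ (k b - 1)) * A"
            by (metis mult.assoc of_real_mult)
        qed
        finally show ?thesis by simp
      qed
      ultimately show False using \<open>A \<noteq> 0\<close> k zd d by auto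
    qed
    then show "h v (e b j) = 0" using a[of "k b - 1 - j"] j by (simp add: a_def)
  qed
  then have "v \<in> perp (chain_idx N k) (case_prod e) V" using vV by (auto simp: perp_def)
  moreover have "corner_op N k e d T v = T v"
    unfolding corner_op_def using z JD(1) by (simp add: sum.neutral)
  ultimately show "v = 0" using nr Tv unfolding no_real_def by metis
qed

text \<open>The uniform constant \<open>m\<close> leaves room for a later small change of the
  subspace. The \<open>h\<close>-negative family \<open>g\<close> enters a dimension count that
  limits the positive eigenvectors.\<close>

lemma negative_lagrangian_family:
  assumes s: "sa_space T V" and d: "dim_le (2 * n) V"
    and B: "independent B" "B \<subseteq> V" "card B = 2 * n"
    and J: "jordan_family T V N w k \<kappa> e" and nr: "no_real T (perp (chain_idx N k) (case_prod e) V)"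
    and g: "\<And>i. i < n \<Longrightarrow> g i \<in> V"
    and gneg: "\<And>c i. i < n \<Longrightarrow> c i \<noteq> 0 \<Longrightarrow> Re (h (\<Sum>i<n. c i *s g i) (\<Sum>i<n. c i *s g i)) < 0"
    and cnt: "\<And>t. block_count N w k \<kappa> t \<ge> 0"
  obtains l m where "\<forall>i<n. l i \<in> V" "\<forall>i<n. \<forall>j<n. h (l i) (l j) = 0" "m > 0"
    "\<forall>c. Re (h (T (\<Sum>i<n. c i *s l i)) (\<Sum>i<n. c i *s l i)) \<le> - m * (\<Sum>i<n. (cmod (c i))\<^sup>2)"
proof -
  note V = sa_spaceD[OF s]
  note JD = jordan_familyD[OF J]
  define P where "P = {b \<in> {..<N}. \<kappa> b = 1}"
  define M where "M = {b \<in> {..<N}. \<kappa> b = (-1) ^ k b}"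
  have fin: "finite P" "finite M" and PN: "b \<in> P \<Longrightarrow> b < N" and MN: "b \<in> M \<Longrightarrow> b < N" for b
    by (auto simp: P_def M_def)
  have "card {b\<in>M. w b \<le> t} \<le> card {b\<in>P. w b < t}" for t
    using cnt[of t] by (simp add: block_count_def P_def M_def conj_assoc)
  then obtain \<phi> where \<phi>: "inj_on \<phi> M" "\<phi> ` M \<subseteq> P" "\<forall>b\<in>M. w (\<phi> b) < w b"
    using strictly_increasing_matching[OF fin(2,1), of w w] by metis
  \<comment> \<open>A quarter of each gap keeps matched eigenvalues in order after both have moved
    by \<open>dl\<close> towards each other; the 1 covers an empty \<open>M\<close>.\<close>
  define dl where "dl = Min (insert 1 ((\<lambda>b. (w b - w (\<phi> b)) / 4) ` M))"
  have dl: "dl > 0" using fin(2) \<phi>(3) by (simp add: dl_def)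
  have gap: "w (\<phi> b) + dl < w b - dl" if "b \<in> M" for b
  proof -
    have "dl \<le> (w b - w (\<phi> b)) / 4"
      unfolding dl_def by (rule Min_le) (use that fin(2) in auto)
    then show ?thesis using \<phi>(3) that dl by force
  qed
  define T' where "T' = corner_op N k e dl T"
  have s': "sa_space T' V" unfolding T'_def by (rule corner_op_sa_space[OF s J])
  note V' = sa_spaceD[OF s']
  define q where "q b = real (k b) * dl ^ (k b - 1)" for b
  define \<rho> where "\<rho> b = 1 / sqrt (q b)" for b
  have \<rho>: "\<rho> b > 0" "of_real (\<rho> b) * (of_real (\<rho> b) * of_real (q b)) = (1 :: complex)" if "b < N" for b
  proof -
    have q: "q b > 0" using JD(1)[OF that] dl by (simp add: q_def)
    then show "\<rho> b > 0" by (simp add: \<rho>_def)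
    have "\<rho> b * (\<rho> b * q b) = 1" using q by (simp add: \<rho>_def)
    then show "of_real (\<rho> b) * (of_real (\<rho> b) * of_real (q b)) = (1 :: complex)"
      by (metis of_real_1 of_real_mult)
  qed
  have hP: "h (chain_vec k e b dl) (chain_vec k e b dl) = of_real (q b)" if "b \<in> P" for b
    using h_chain_vec[OF J PN[OF that], of dl] that by (simp add: q_def P_def)
  have hM: "h (chain_vec k e b (- dl)) (chain_vec k e b (- dl)) = - of_real (q b)" if b: "b \<in> M" for b
  proof -
    obtain m where m: "k b = Suc m" using JD(1)[OF MN[OF b]] by (cases "k b") auto
    have "(- dl) ^ (k b - 1) * (-1) ^ k b = - (dl ^ (k b - 1))"
      unfolding m by (simp flip: power_mult_distrib)
    then have "q b = - (real (k b) * ((- dl) ^ (k b - 1) * (-1) ^ k b))" by (simp add: q_def)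
    moreover have "h (chain_vec k e b (- dl)) (chain_vec k e b (- dl))
        = of_real (real (k b) * ((- dl) ^ (k b - 1) * (-1) ^ k b))"
      using h_chain_vec[OF J MN[OF b], of "- dl"] b by (simp add: M_def mult.assoc)
    ultimately show ?thesis by simp
  qed
  define X where "X p = (case p of Inl b \<Rightarrow> of_real (\<rho> b) *s chain_vec k e b dl
    | Inr b \<Rightarrow> of_real (\<rho> b) *s chain_vec k e b (- dl))" for p
  define ev where "ev p = (case p of Inl b \<Rightarrow> w b + dl | Inr b \<Rightarrow> w b - dl)" for p :: "nat + nat"
  \<comment> \<open>A disjoint sum, since a block of even size with \<open>\<kappa> b = 1\<close>
    contributes an eigenvector of either sign.\<close>
  define I where "I = P <+> M"
  have PI: "Inl b \<in> I" if "b \<in> P" for b using that by (auto simp: I_def)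
  have XV: "X p \<in> V" if "p \<in> I" for p
    using that chain_vec_in[OF J _ V(1)] PN MN
    by (auto simp: I_def X_def intro!: subspace_scale[OF V(1)])
  have TX: "T' (X p) = of_real (ev p) *s X p" if "p \<in> I" for p
    using that
  proof (unfold I_def, elim PlusE)
    fix b assume b: "p = Inl b" "b \<in> P"
    then have "of_real (dl ^ k b) = of_real (dl ^ k b) * \<kappa> b" by (simp add: P_def)
    then show ?thesis using corner_op_chain_vec[OF J PN[OF b(2)] s, of dl dl] b(1)
      by (simp add: X_def ev_def lin_simps[OF V'(3)] mult.commute flip: T'_def)
  next
    fix b assume b: "p = Inr b" "b \<in> M"
    then have "of_real ((- dl) ^ k b) = of_real (dl ^ k b) * \<kappa> b"
      by (simp add: M_def power_minus[of "of_real dl"])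
    then show ?thesis using corner_op_chain_vec[OF J MN[OF b(2)] s, of "- dl" dl] b(1)
      by (simp add: X_def ev_def lin_simps[OF V'(3)] mult.commute flip: T'_def)
  qed
  have hcv0: "h (chain_vec k e b z) (chain_vec k e b' z') = 0" if "b < N" "b' < N" "b \<noteq> b'" for b b' z z'
    using JD(5)[OF that(1,2)] that(3)
    by (simp add: chain_vec_def h_sum_left h_sum_right h_scale_left h_scale_right)
  have hX: "h (X p) (X q) = (if p = q then (case p of Inl _ \<Rightarrow> 1 | Inr _ \<Rightarrow> -1) else 0)"
    if pq: "p \<in> I" "q \<in> I" for p q
  \<comment> \<open>Two eigenvectors of one block are orthogonal because their eigenvalues
    \<open>w b + dl\<close> and \<open>w b - dl\<close> differ; those of different blocks because
    the chains are orthogonal.\<close>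
  proof (cases "case_sum id id p = case_sum id id q \<and> p \<noteq> q")
    case True
    then have "ev p \<noteq> ev q" using dl by (auto simp: ev_def split: sum.splits)
    then show ?thesis
      using True real_eigenvectors_orthogonal[OF s' XV[OF pq(1)] TX[OF pq(1)] XV[OF pq(2)] TX[OF pq(2)]]
      by simp
  next
    case False
    have own: "h (X p) (X p) = (case p of Inl _ \<Rightarrow> 1 | Inr _ \<Rightarrow> -1)"
      using pq(1)
    proof (unfold I_def, elim PlusE)
      fix b assume b: "p = Inl b" "b \<in> P"
      show ?thesis unfolding b(1) using \<rho>(2)[OF PN[OF b(2)]] hP[OF b(2)]
        by (simp add: X_def h_scale_left h_scale_right)
    next
      fix b assume b: "p = Inr b" "b \<in> M"
      show ?thesis unfolding b(1) using \<rho>(2)[OF MN[OF b(2)]] hM[OF b(2)]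
        by (simp add: X_def h_scale_left h_scale_right)
    qed
    show ?thesis
    proof (cases "p = q")
      case True
      then show ?thesis using own by simp
    next
      case pnq: False
      then have "case_sum id id p \<noteq> case_sum id id q" using False by simp
      then show ?thesis using pq pnq PN MN hcv0
        by (auto simp: I_def X_def h_scale_left h_scale_right)
    qed
  qed
  have gI: "gram_system I X (\<lambda>p. p) (\<lambda>p. case p of Inl _ \<Rightarrow> 1 | Inr _ \<Rightarrow> -1)"
    unfolding gram_system_def
  proof (intro conjI ballI)
    show "finite I" using fin by (simp add: I_def)
    show "h (X p) (X q) = (if q = p then (case p of Inl _ \<Rightarrow> 1 | Inr _ \<Rightarrow> -1) else 0)"
      if "p \<in> I" "q \<in> I" for p q using hX[OF that] by (simp add: eq_commute)
  qed (auto split: sum.splits)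
  let ?U = "perp I X V"
  have sU: "sa_space T' ?U"
    by (rule sa_space_perp[OF s' gI XV]) (auto simp: TX intro!: span_scale intro: span_base)
  have UX: "h u (X p) = 0" "h (X p) u = 0" if "u \<in> ?U" "p \<in> I" for u p
    using that h_eq_0_sym[of u] by (auto simp: perp_def)
  have scale0: "h u v = 0" if "h u (of_real (\<rho> b) *s v) = 0" "b < N" for u v b
    using that \<rho>(1)[OF that(2)] by (simp add: h_scale_right)
  have nU: "no_real T' ?U"
    unfolding T'_def
  proof (rule corner_op_no_real[OF s J nr dl])
    show "?U \<subseteq> V" by (auto simp: perp_def)
    show "h u (chain_vec k e b dl) = 0" if "u \<in> ?U" "b < N" "\<kappa> b = 1" for u b
    proof (rule scale0[OF _ that(2)])
      have "b \<in> P" using that(2,3) by (simp add: P_def)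
      then show "h u (of_real (\<rho> b) *s chain_vec k e b dl) = 0"
        using UX(1)[OF that(1) PI] by (simp add: X_def)
    qed
    show "h u (chain_vec k e b (- dl)) = 0" if "u \<in> ?U" "b < N" "\<kappa> b = (-1) ^ k b" for u b
    proof (rule scale0[OF _ that(2)])
      have "b \<in> M" using that(2,3) by (simp add: M_def)
      then have "Inr b \<in> I" by (auto simp: I_def)
      then show "h u (of_real (\<rho> b) *s chain_vec k e b (- dl)) = 0"
        using UX(1)[OF that(1), of "Inr b"] by (simp add: X_def)
    qed
  qed
  obtain r x y where L: "lagrangian_pair T' ?U r x y"
    using lagrangian_pair_exists[OF sU nU] by metis
  note LD = lagrangian_pairD[OF L]
  obtain S where S: "finite S" "card S \<le> 2 * r" "?U \<subseteq> span S" using LD(1) by metis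
  have cI: "card I = card P + card M" unfolding I_def using fin by (simp add: card_Plus)
  have "V \<subseteq> span (X ` I \<union> S)" by (rule gram_system_span[OF gI V(1) XV S(3)])
  then have "B \<subseteq> span (X ` I \<union> S)" using B(2) by (rule order_trans[rotated])
  then have "card B \<le> card (X ` I \<union> S)"
    using independent_span_bound[OF _ B(1)] S(1) gram_systemD(1)[OF gI] by simp
  also have "\<dots> \<le> card (X ` I) + card S" by (rule card_Un_le)
  also have "card (X ` I) \<le> card I" by (rule card_image_le[OF gram_systemD(1)[OF gI]])
  finally have dim1: "2 * n \<le> card P + card M + 2 * r" using B(3) cI S(2) by linarith
  have xU: "x i \<in> ?U" "x i \<in> V" and yU: "y i \<in> ?U" "y i \<in> V" if "i < r" for i
    using LD(2,3)[OF that] by (auto simp: perp_def)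
  have lid: "lin (\<lambda>x. x)" by (intro linI) simp_all
  \<comment> \<open>\<open>h\<close> is nonnegative on the span of the positive eigenvectors and the
    isotropic \<open>x i\<close>, and negative on that of the \<open>g i\<close>.\<close>
  have "card (P <+> {..<r}) + n \<le> 2 * n"
  proof (rule definite_family_card_le[OF d lid _ _ _ _ _ g gneg])
    let ?F = "case_sum (\<lambda>b. X (Inl b)) x"
    show "finite (P <+> {..<r})" using fin by simp
    have XP: "X (Inl b) \<in> V" if "b \<in> P" for b using XV[OF PI[OF that]] .
    then show "?F p \<in> V" if "p \<in> P <+> {..<r}" for p using that xU(2) by (elim PlusE) simp_all
    have xP: "h (x i) (X (Inl b)) = 0" "h (X (Inl b)) (x i) = 0" if "i < r" "b \<in> P" for i b
      using UX[OF xU(1)[OF that(1)] PI[OF that(2)]] .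
    have PP: "h (X (Inl b)) (X (Inl b')) = (if b = b' then 1 else 0)" if "b \<in> P" "b' \<in> P" for b b'
      using hX[OF PI PI, OF that] by simp
    show "h (?F p) (?F q) = (if p = q then of_real (case_sum (\<lambda>_. 1) (\<lambda>_. 0) p) else 0)"
      if "p \<in> P <+> {..<r}" "q \<in> P <+> {..<r}" for p q
      using that xP PP LD(5) by (elim PlusE) (simp_all split: if_splits)
    show "0 \<le> case_sum (\<lambda>_. 1) (\<lambda>_. 0 :: real) p" for p :: "nat + nat" by (simp split: sum.split)
    fix a assume z: "(\<Sum>p\<in>P <+> {..<r}. a p *s ?F p) = 0"
    have z': "(\<Sum>b\<in>P. a (Inl b) *s X (Inl b)) + (\<Sum>i<r. a (Inr i) *s x i) = 0"
      using z fin by (simp add: sum.Plus)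
    have aP: "a (Inl b) = 0" if b: "b \<in> P" for b
    proof -
      have "h (\<Sum>i<r. a (Inr i) *s x i) (X (Inl b)) = 0"
        using xP(1)[OF _ b] by (simp add: h_sum_left h_scale_left)
      moreover have "h (\<Sum>b'\<in>P. a (Inl b') *s X (Inl b')) (X (Inl b))
          = (\<Sum>b'\<in>P. if b' = b then a (Inl b) else 0)"
        unfolding h_sum_left h_scale_left by (intro sum.cong refl) (simp add: PP[OF _ b])
      then have "h (\<Sum>b'\<in>P. a (Inl b') *s X (Inl b')) (X (Inl b)) = a (Inl b)"
        using fin(1) b by simp
      ultimately have "h ((\<Sum>b\<in>P. a (Inl b) *s X (Inl b)) + (\<Sum>i<r. a (Inr i) *s x i)) (X (Inl b))
          = a (Inl b)" by (simp add: h_add_left)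
      then show ?thesis unfolding z' by simp
    qed
    then have "(\<Sum>i<r. a (Inr i) *s x i) = 0" using z' by simp
    then have "\<forall>i<r. a (Inr i) = 0" using LD(4)[rule_format, of "\<lambda>i. a (Inr i)"] by simp
    then show "\<forall>p\<in>P <+> {..<r}. a p = 0" using aP by (auto simp: Plus_def)
  qed
  then have dim2: "card P + r \<le> n" using fin by (simp add: card_Plus)
  have "card M = card (\<phi> ` M)" using \<phi>(1) by (simp add: card_image)
  also have "\<dots> \<le> card P" using \<phi>(2) fin(1) by (intro card_mono)
  \<comment> \<open>\<open>card M \<le> card P\<close>, \<open>card P + r \<le> n\<close> and
    \<open>2 * n \<le> card P + card M + 2 * r\<close> leave no slack.\<close>
  finally have dim3: "card M + r = n" using dim1 dim2 by linarith
  \<comment> \<open>In a matched sum the values 1 and -1 of \<open>h\<close> cancel, while the form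
    of \<open>T'\<close> is the difference of the two eigenvalues, negative by
    \<open>gap\<close>.\<close>
  define F where "F p = (case p of Inl b \<Rightarrow> X (Inl (\<phi> b)) + X (Inr b) | Inr i \<Rightarrow> y i)" for p
  define \<gamma> where "\<gamma> p = (case p of Inl b \<Rightarrow> (w (\<phi> b) + dl) - (w b - dl) | Inr i \<Rightarrow> - 1)" for p :: "nat + nat"
  let ?Z = "M <+> {..<r}"
  have \<phi>I: "Inl (\<phi> b) \<in> I" "Inr b \<in> I" if "b \<in> M" for b using that \<phi>(2) by (auto simp: I_def)
  have FV: "F p \<in> V" if "p \<in> ?Z" for p
    using that XV[OF \<phi>I(1)] XV[OF \<phi>I(2)] yU(2) subspace_add[OF V(1)] by (elim PlusE) (simp_all add: F_def)
  have TF: "T' (F (Inl b)) = of_real (w (\<phi> b) + dl) *s X (Inl (\<phi> b)) + of_real (w b - dl) *s X (Inr b)"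
    if "b \<in> M" for b
    using TX[OF \<phi>I(1)[OF that]] TX[OF \<phi>I(2)[OF that]] by (simp add: F_def ev_def lin_simps[OF V'(3)])
  have hXX: "h (X (Inl (\<phi> b))) (X (Inl (\<phi> b'))) = (if b = b' then 1 else 0)"
    "h (X (Inr b)) (X (Inr b')) = (if b = b' then -1 else 0)"
    "h (X (Inl (\<phi> b))) (X (Inr b')) = 0" "h (X (Inr b)) (X (Inl (\<phi> b'))) = 0"
    if "b \<in> M" "b' \<in> M" for b b'
    using hX[OF \<phi>I(1)[OF that(1)] \<phi>I(1)[OF that(2)]] hX[OF \<phi>I(2)[OF that(1)] \<phi>I(2)[OF that(2)]]
      hX[OF \<phi>I(1)[OF that(1)] \<phi>I(2)[OF that(2)]] hX[OF \<phi>I(2)[OF that(1)] \<phi>I(1)[OF that(2)]]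
      inj_on_eq_iff[OF \<phi>(1) that] by simp_all
  have MM: "h (F (Inl b)) (F (Inl b')) = 0"
    "h (T' (F (Inl b))) (F (Inl b')) = (if b = b' then of_real (\<gamma> (Inl b)) else 0)"
    if "b \<in> M" "b' \<in> M" for b b'
    unfolding TF[OF that(1)] using hXX[OF that]
    by (simp_all add: F_def \<gamma>_def h_add_left h_add_right h_scale_left)
  have My: "h (F (Inl b)) (y i) = 0" "h (y i) (F (Inl b)) = 0" "h (T' (F (Inl b))) (y i) = 0"
    "h (T' (y i)) (F (Inl b)) = 0" if "b \<in> M" "i < r" for b i
  proof -
    note u = UX[OF yU(1)[OF that(2)] \<phi>I(1)[OF that(1)]] UX[OF yU(1)[OF that(2)] \<phi>I(2)[OF that(1)]]
    show "h (F (Inl b)) (y i) = 0" "h (y i) (F (Inl b)) = 0" "h (T' (F (Inl b))) (y i) = 0"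
      unfolding TF[OF that(1)] using u by (simp_all add: F_def h_add_left h_add_right h_scale_left)
    have "h (T' (y i)) (F (Inl b)) = h (y i) (T' (F (Inl b)))"
      using V'(5)[OF yU(2)[OF that(2)] FV[of "Inl b"]] that(1) by auto
    also have "\<dots> = 0" unfolding TF[OF that(1)] using u by (simp add: h_add_right h_scale_right)
    finally show "h (T' (y i)) (F (Inl b)) = 0" .
  qed
  have Fy: "F (Inr i) = y i" for i by (simp add: F_def)
  have hF: "h (F p) (F q) = 0" if "p \<in> ?Z" "q \<in> ?Z" for p q
    using that MM(1) My(1,2) LD(7) by (elim PlusE) (simp_all add: Fy)
  have hTF: "h (T' (F p)) (F q) = (if p = q then of_real (\<gamma> p) else 0)" if "p \<in> ?Z" "q \<in> ?Z" for p q
    using that MM(2) My(3,4) LD(8) by (elim PlusE) (simp_all add: Fy \<gamma>_def)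
  have "card ?Z = n" using fin dim3 by (simp add: card_Plus)
  then obtain \<beta> where \<beta>: "bij_betw \<beta> {..<n} ?Z"
    using ex_bij_betw_nat_finite[of ?Z] fin by (auto simp: atLeast0LessThan)
  have \<beta>Z: "\<beta> i \<in> ?Z" if "i < n" for i using bij_betwE[OF \<beta>] that by simp
  define l where "l i = F (\<beta> i)" for i
  have "\<gamma> (Inl b) < 0" if "b \<in> M" for b using gap[OF that] by (simp add: \<gamma>_def)
  then have \<gamma>neg: "\<gamma> p < 0" if "p \<in> ?Z" for p using that by (elim PlusE) (simp_all add: \<gamma>_def)
  define m where "m = Min (insert 1 ((\<lambda>i. - \<gamma> (\<beta> i)) ` {..<n}))"
  have m: "m > 0" unfolding m_def using \<gamma>neg \<beta>Z by simp
  have m\<gamma>: "\<gamma> (\<beta> i) \<le> - m" if "i < n" for i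
  proof -
    have "m \<le> - \<gamma> (\<beta> i)" unfolding m_def by (rule Min_le) (use that in auto)
    then show ?thesis by simp
  qed
  show ?thesis
  proof (rule that[of l m])
    show "\<forall>i<n. l i \<in> V" using FV \<beta>Z by (simp add: l_def)
    show "\<forall>i<n. \<forall>j<n. h (l i) (l j) = 0" using hF \<beta>Z by (simp add: l_def)
    show "\<forall>c. Re (h (T (\<Sum>i<n. c i *s l i)) (\<Sum>i<n. c i *s l i)) \<le> - m * (\<Sum>i<n. (cmod (c i))\<^sup>2)"
    proof
      fix c :: "nat \<Rightarrow> complex"
      let ?v = "\<Sum>i<n. c i *s l i"
      have "h (T' ?v) ?v = of_real (\<Sum>i<n. (cmod (c i))\<^sup>2 * \<gamma> (\<beta> i))"
      proof (rule diagonal_form[OF V'(3) finite_lessThan])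
        fix i j assume ij: "i \<in> {..<n}" "j \<in> {..<n}"
        then have "\<beta> i = \<beta> j \<longleftrightarrow> i = j" by (rule inj_on_eq_iff[OF bij_betw_imp_inj_on[OF \<beta>]])
        then show "h (T' (l i)) (l j) = (if i = j then of_real (\<gamma> (\<beta> i)) else 0)"
          using hTF[OF \<beta>Z \<beta>Z, of i j] ij by (simp add: l_def)
      qed
      moreover have "(\<Sum>i<n. (cmod (c i))\<^sup>2 * \<gamma> (\<beta> i)) \<le> (\<Sum>i<n. (cmod (c i))\<^sup>2 * - m)"
        by (intro sum_mono mult_left_mono m\<gamma>) auto
      moreover have "(\<Sum>i<n. (cmod (c i))\<^sup>2 * - m) = - m * (\<Sum>i<n. (cmod (c i))\<^sup>2)"
        by (simp only: sum_distrib_left mult.commute)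
      ultimately have "Re (h (T' ?v) ?v) \<le> - m * (\<Sum>i<n. (cmod (c i))\<^sup>2)" by simp
      then show "Re (h (T ?v) ?v) \<le> - m * (\<Sum>i<n. (cmod (c i))\<^sup>2)"
        using corner_op_form_ge[of dl T ?v N k e] dl unfolding T'_def by linarith
    qed
  qed (fact m)
qed

end

section \<open>The symplectic form on coordinate space\<close>

definition cscale :: "complex \<Rightarrow> (nat \<Rightarrow> complex) \<Rightarrow> nat \<Rightarrow> complex"
  where "cscale c f = (\<lambda>i. c * f i)"

text \<open>The form \<open>i y\<^sup>* J x\<close>.\<close>

definition symp_form :: "nat \<Rightarrow> (nat \<Rightarrow> complex) \<Rightarrow> (nat \<Rightarrow> complex) \<Rightarrow> complex"
  where "symp_form n x y = \<i> * (\<Sum>r<n. x r * cnj (y (n + r)) - x (n + r) * cnj (y r))"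

definition fun_space :: "nat \<Rightarrow> (nat \<Rightarrow> complex) set"
  where "fun_space n = {f. \<forall>i\<ge>n. f i = 0}"

definition unit_fun :: "nat \<Rightarrow> nat \<Rightarrow> complex"
  where "unit_fun i = (\<lambda>j. if j = i then 1 else 0)"

lemma sum_fun_apply: "(\<Sum>a\<in>A. f a) i = (\<Sum>a\<in>A. f a i :: complex)"
  by (induction A rule: infinite_finite_induct) auto

interpretation sf: hermitian_form cscale "symp_form n" for n
proof
  fix x y z :: "nat \<Rightarrow> complex" and c d
  show "cscale c (x + y) = cscale c x + cscale c y" "cscale (c + d) x = cscale c x + cscale d x"
    "cscale c (cscale d x) = cscale (c * d) x" "cscale 1 x = x"
    by (auto simp: cscale_def algebra_simps)
  show "symp_form n (x + y) z = symp_form n x z + symp_form n y z"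
    by (simp add: symp_form_def algebra_simps sum.distrib sum_subtractf)
  show "symp_form n (cscale c x) z = c * symp_form n x z"
    by (simp add: symp_form_def cscale_def algebra_simps sum_distrib_left sum_subtractf)
  show "cnj (symp_form n x y) = symp_form n y x"
    by (simp add: symp_form_def algebra_simps sum_subtractf)
qed

lemma subspace_fun_space: "sf.subspace (fun_space n)"
  by (auto simp: sf.subspace_def fun_space_def cscale_def)

lemma fun_space_decomp:
  assumes "f \<in> fun_space n" shows "f = (\<Sum>i<n. cscale (f i) (unit_fun i))"
proof
  fix j
  have "(\<Sum>i<n. cscale (f i) (unit_fun i)) j = (\<Sum>i<n. if j = i then f j else 0)"
    unfolding sum_fun_apply by (intro sum.cong) (auto simp: cscale_def unit_fun_def)
  also have "\<dots> = f j" using assms by (auto simp: fun_space_def)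
  finally show "f j = (\<Sum>i<n. cscale (f i) (unit_fun i)) j" ..
qed

lemma fun_space_span: "fun_space n \<subseteq> sf.span (unit_fun ` {..<n})"
proof
  fix f assume "f \<in> fun_space n"
  then have f: "f = (\<Sum>i<n. cscale (f i) (unit_fun i))" by (rule fun_space_decomp)
  show "f \<in> sf.span (unit_fun ` {..<n})"
    by (subst f) (intro sf.span_sum sf.span_scale sf.span_base imageI)
qed

text \<open>Each coordinate pairs only with the one shifted by \<open>n\<close>. Nondegeneracy and
  the dimension \<open>2 * n\<close> come from this.\<close>

lemma unit_fun_gram_system:
  "sf.gram_system n {..<2 * n} unit_fun (\<lambda>i. if i < n then i + n else i - n)
     (\<lambda>i. if i < n then \<i> else - \<i>)"
  unfolding sf.gram_system_def
proof (intro conjI ballI)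
  fix i j assume ij: "i \<in> {..<2 * n}" "j \<in> {..<2 * n}"
  have "symp_form n (unit_fun i) (unit_fun j) = \<i> * (\<Sum>r<n. (if r = i \<and> j = n + r then 1 else 0)
      - (if r = j \<and> i = n + r then 1 else 0))"
    unfolding symp_form_def unit_fun_def by (intro arg_cong2[of _ _ _ _ "(*)"] sum.cong) auto
  also have "\<dots> = \<i> * ((\<Sum>r<n. if r = i then (if j = n + i then 1 else 0) else 0)
      - (\<Sum>r<n. if r = j then (if i = n + j then 1 else 0) else 0))"
    unfolding sum_subtractf by (intro arg_cong2[of _ _ _ _ "(*)"] arg_cong2[of _ _ _ _ "(-)"] sum.cong) auto
  finally show "symp_form n (unit_fun i) (unit_fun j)
      = (if j = (if i < n then i + n else i - n) then if i < n then \<i> else - \<i> else 0)"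
    using ij by auto
qed auto

lemma unit_fun_in: "i < n \<Longrightarrow> unit_fun i \<in> fun_space n"
  by (simp add: unit_fun_def fun_space_def)

lemma nondeg_fun_space: "sf.nondeg n (fun_space (2 * n))"
  unfolding sf.nondeg_def
proof (intro ballI impI)
  fix v assume v: "v \<in> fun_space (2 * n)" and 0: "\<forall>y\<in>fun_space (2 * n). symp_form n v y = 0"
  show "v = 0"
  proof (rule sf.gram_system_span_perp[OF unit_fun_gram_system])
    show "v \<in> sf.span (unit_fun ` {..<2 * n})" using v fun_space_span by blast
  qed (use 0 unit_fun_in in auto)
qed

lemma fun_space_basis:
  "sf.independent (unit_fun ` {..<2 * n})" "unit_fun ` {..<2 * n} \<subseteq> fun_space (2 * n)"
  "card (unit_fun ` {..<2 * n}) = 2 * n" "sf.dim_le (2 * n) (fun_space (2 * n))"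
proof -
  have "\<forall>c. (\<Sum>i\<in>{..<2 * n}. cscale (c i) (unit_fun i)) = 0 \<longrightarrow> (\<forall>i\<in>{..<2 * n}. c i = 0)"
    using sf.gram_system_indep[OF unit_fun_gram_system] by blast
  note I = sf.family_independent[OF finite_lessThan this]
  show "sf.independent (unit_fun ` {..<2 * n})" by (rule I(2))
  show c: "card (unit_fun ` {..<2 * n}) = 2 * n" using I(1) by (simp add: card_image)
  show "unit_fun ` {..<2 * n} \<subseteq> fun_space (2 * n)" using unit_fun_in by auto
  show "sf.dim_le (2 * n) (fun_space (2 * n))"
    using sf.dim_le_span[OF _ fun_space_span[of "2 * n"]] c by simp
qed

text \<open>The vectors \<open>unit_fun i - \<i> unit_fun (n + i)\<close> are orthogonal with value
  \<open>- 2\<close>: the negative half of the signature.\<close>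

lemma negative_definite_family:
  obtains g where "\<And>i. i < n \<Longrightarrow> g i \<in> fun_space (2 * n)"
    "\<And>c i. i < n \<Longrightarrow> c i \<noteq> 0 \<Longrightarrow>
      Re (symp_form n (\<Sum>i<n. cscale (c i) (g i)) (\<Sum>i<n. cscale (c i) (g i))) < 0"
proof -
  define g where "g i = unit_fun i + cscale (- \<i>) (unit_fun (n + i))" for i
  note gu = sf.gram_systemD(5)[OF unit_fun_gram_system]
  have gg: "symp_form n (g i) (g j) = (if i = j then of_real (- 2) else 0)"
    if "i \<in> {..<n}" "j \<in> {..<n}" for i j
    using that by (simp add: g_def sf.h_add_left sf.h_add_right sf.h_diff_left sf.h_diff_right
      sf.h_scale_left sf.h_scale_right gu)
  have lid: "Modules.module_hom cscale cscale (\<lambda>x. x)" by (rule sf.linI) auto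
  show ?thesis
  proof (rule that[of g])
    show "g i \<in> fun_space (2 * n)" if "i < n" for i
      using that by (simp add: g_def unit_fun_def cscale_def fun_space_def)
    fix c :: "nat \<Rightarrow> complex" and i assume i: "i < n" "c i \<noteq> 0"
    have "(\<Sum>i<n. (cmod (c i))\<^sup>2 * - 2) < (\<Sum>i<n. 0 :: real)"
      by (rule sum_strict_mono_ex1) (use i in auto)
    then show "Re (symp_form n (\<Sum>i<n. cscale (c i) (g i)) (\<Sum>i<n. cscale (c i) (g i))) < 0"
      using sf.diagonal_form[OF lid finite_lessThan gg, where a = c] by simp
  qed
qed

text \<open>The operator \<open>- i R\<close>, which is selfadjoint for the above form when \<open>R\<close> is Hamiltonian.\<close>

definition mat_op :: "nat \<Rightarrow> complex mat \<Rightarrow> (nat \<Rightarrow> complex) \<Rightarrow> nat \<Rightarrow> complex"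
  where "mat_op n R f = (\<lambda>i. if i < 2 * n then - \<i> * (\<Sum>j<2 * n. R $$ (i, j) * f j) else 0)"

text \<open>The condition that \<open>J R\<close> is Hermitian, read off block by block: the
  off-diagonal blocks are Hermitian, and the diagonal ones are negative adjoints of each
  other.\<close>

definition hamiltonian_entries :: "nat \<Rightarrow> complex mat \<Rightarrow> bool"
  where "hamiltonian_entries n R \<longleftrightarrow> R \<in> carrier_mat (2 * n) (2 * n) \<and> (\<forall>a<n. \<forall>b<n.
     cnj (R $$ (n + a, b)) = R $$ (n + b, a) \<and> cnj (R $$ (a, n + b)) = R $$ (b, n + a) \<and>
     cnj (R $$ (a, b)) = - R $$ (n + b, n + a))"

lemma sum_lessThan_double: "(\<Sum>j<2 * n. f j) = (\<Sum>j<n. f j) + (\<Sum>j<n. f (n + j) :: complex)" for n :: nat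
  using sum.atLeastLessThan_concat[of 0 n "2 * n" f] sum.shift_bounds_nat_ivl[of f 0 n n]
  by (simp add: atLeast0LessThan mult_2 add.commute)

lemma symp_form_mat_op:
  "symp_form n (mat_op n R x) y = (\<Sum>r<n. (\<Sum>j<2 * n. R $$ (r, j) * x j) * cnj (y (n + r))
    - (\<Sum>j<2 * n. R $$ (n + r, j) * x j) * cnj (y r))"
proof -
  have "mat_op n R x r * cnj (y (n + r)) - mat_op n R x (n + r) * cnj (y r)
    = - \<i> * ((\<Sum>j<2 * n. R $$ (r, j) * x j) * cnj (y (n + r))
    - (\<Sum>j<2 * n. R $$ (n + r, j) * x j) * cnj (y r))" if "r < n" for r
    using that by (simp add: mat_op_def algebra_simps)
  then have "symp_form n (mat_op n R x) y = \<i> * (\<Sum>r<n. - \<i> * ((\<Sum>j<2 * n. R $$ (r, j) * x j) * cnj (y (n + r))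
    - (\<Sum>j<2 * n. R $$ (n + r, j) * x j) * cnj (y r)))"
    unfolding symp_form_def by (intro arg_cong2[of _ _ _ _ "(*)"] sum.cong refl) simp
  then show ?thesis by (simp only: sum_distrib_left[symmetric]) simp
qed

text \<open>The factors \<open>\<i>\<close> and \<open>- \<i>\<close> cancel, which leaves the form
  of \<open>J R\<close>, a Hermitian matrix. Of the four block sums, conjugation exchanges the two
  from diagonal blocks and fixes the other two.\<close>

lemma hamiltonian_form_swap:
  assumes R: "hamiltonian_entries n R"
  shows "cnj (symp_form n (mat_op n R x) y) = symp_form n (mat_op n R y) x"
proof -
  define K where "K a b = R $$ (a, b)" for a b
  have K: "cnj (K (n + a) b) = K (n + b) a" "cnj (K a (n + b)) = K b (n + a)"
    "cnj (K a b) = - K (n + b) (n + a)" "cnj (K (n + a) (n + b)) = - K b a" if "a < n" "b < n" for a b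
    using R that unfolding hamiltonian_entries_def K_def by (auto simp: complex_eq_iff)
  have F: "symp_form n (mat_op n R x) y = (\<Sum>r<n. \<Sum>j<n. K r j * x j * cnj (y (n + r)))
      + (\<Sum>r<n. \<Sum>j<n. K r (n + j) * x (n + j) * cnj (y (n + r)))
      - (\<Sum>r<n. \<Sum>j<n. K (n + r) j * x j * cnj (y r))
      - (\<Sum>r<n. \<Sum>j<n. K (n + r) (n + j) * x (n + j) * cnj (y r))" for x y
    unfolding symp_form_mat_op sum_lessThan_double K_def[symmetric]
    by (simp add: sum_subtractf sum.distrib sum_distrib_right sum_distrib_left algebra_simps)
  have s: "(\<Sum>r<n. \<Sum>j<n. f r j) = (\<Sum>r<n. \<Sum>j<n. f j r)" for f :: "nat \<Rightarrow> nat \<Rightarrow> complex"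
    by (rule sum.swap)
  have c1: "(\<Sum>r<n. \<Sum>j<n. cnj (K r j * x j * cnj (y (n + r))))
      = - (\<Sum>r<n. \<Sum>j<n. K (n + r) (n + j) * y (n + j) * cnj (x r))"
    unfolding sum_negf[symmetric] by (subst s) (intro sum.cong refl, simp add: K)
  have c2: "(\<Sum>r<n. \<Sum>j<n. cnj (K r (n + j) * x (n + j) * cnj (y (n + r))))
      = (\<Sum>r<n. \<Sum>j<n. K r (n + j) * y (n + j) * cnj (x (n + r)))"
    by (subst s) (intro sum.cong refl, simp add: K)
  have c3: "(\<Sum>r<n. \<Sum>j<n. cnj (K (n + r) j * x j * cnj (y r)))
      = (\<Sum>r<n. \<Sum>j<n. K (n + r) j * y j * cnj (x r))"
    by (subst s) (intro sum.cong refl, simp add: K)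
  have c4: "(\<Sum>r<n. \<Sum>j<n. cnj (K (n + r) (n + j) * x (n + j) * cnj (y r)))
      = - (\<Sum>r<n. \<Sum>j<n. K r j * y j * cnj (x (n + r)))"
    unfolding sum_negf[symmetric] by (subst s) (intro sum.cong refl, simp add: K)
  show ?thesis
    unfolding F complex_cnj_diff complex_cnj_add cnj_sum c1 c2 c3 c4 by simp
qed

lemma mat_op_lin: "Modules.module_hom cscale cscale (mat_op n R)"
proof (rule sf.linI)
  show "mat_op n R (x + y) = mat_op n R x + mat_op n R y" for x y
    by (rule ext) (simp add: mat_op_def algebra_simps sum.distrib)
  show "mat_op n R (cscale c x) = cscale c (mat_op n R x)" for c x
    by (rule ext) (simp add: mat_op_def cscale_def sum_distrib_left algebra_simps)
qed

lemma hamiltonian_sa_space: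
  assumes "hamiltonian_entries n R"
  shows "sf.sa_space n (mat_op n R) (fun_space (2 * n))"
  unfolding sf.sa_space_def
proof (intro conjI ballI)
  show "\<exists>m. sf.dim_le m (fun_space (2 * n))" using fun_space_basis(4) by blast
  show "mat_op n R ` fun_space (2 * n) \<subseteq> fun_space (2 * n)" by (auto simp: mat_op_def fun_space_def)
  show "symp_form n (mat_op n R x) y = symp_form n x (mat_op n R y)" for x y
    using hamiltonian_form_swap[OF assms, of y x] sf.h_cnj by metis
qed (fact subspace_fun_space nondeg_fun_space mat_op_lin)+

section \<open>Solutions of the inequality and Lagrangian subspaces\<close>

definition pair_fun :: "nat \<Rightarrow> complex vec \<Rightarrow> complex vec \<Rightarrow> nat \<Rightarrow> complex"
  where "pair_fun n x z = (\<lambda>r. if r < n then x $ r else if r < 2 * n then z $ (r - n) else 0)"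

lemma cscalar_prod_sum:
  "y \<in> carrier_vec n \<Longrightarrow> x \<bullet>c y = (\<Sum>r<n. x $ r * cnj (y $ r :: complex))"
  by (simp add: scalar_prod_def atLeast0LessThan)

lemma mult_mat_vec_sum:
  "M \<in> carrier_mat k n \<Longrightarrow> x \<in> carrier_vec n \<Longrightarrow> i < k \<Longrightarrow>
    (M *\<^sub>v x) $ i = (\<Sum>j<n. M $$ (i, j) * (x $ j :: complex))"
  by (simp add: scalar_prod_def atLeast0LessThan)

lemma mat_adjoint_index:
  assumes "M \<in> carrier_mat k n" "i < n" "j < k"
  shows "mat_adjoint M $$ (i, j) = cnj (M $$ (j, i) :: complex)"
  using assms by (simp add: mat_adjoint_def mat_of_rows_index)

lemma mat_adjoint_carrier: "M \<in> carrier_mat k n \<Longrightarrow> mat_adjoint M \<in> carrier_mat n k"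
  by (intro carrier_matI) (simp_all add: mat_adjoint_def)

lemma mat_adjoint_cscalar_prod:
  assumes M: "M \<in> carrier_mat k n" and x: "x \<in> carrier_vec n" and y: "y \<in> carrier_vec k"
  shows "(M *\<^sub>v x) \<bullet>c y = x \<bullet>c (mat_adjoint M *\<^sub>v (y :: complex vec))"
proof -
  have "(M *\<^sub>v x) \<bullet>c y = (\<Sum>r<k. \<Sum>j<n. M $$ (r, j) * x $ j * cnj (y $ r))"
    unfolding cscalar_prod_sum[OF y]
    by (intro sum.cong refl) (simp add: mult_mat_vec_sum[OF M x] sum_distrib_right del: index_mult_mat_vec)
  also have "\<dots> = (\<Sum>j<n. \<Sum>r<k. M $$ (r, j) * x $ j * cnj (y $ r))" by (rule sum.swap)
  also have "\<dots> = (\<Sum>j<n. x $ j * cnj ((mat_adjoint M *\<^sub>v y) $ j))"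
    by (intro sum.cong refl) (simp add: mult_mat_vec_sum[OF mat_adjoint_carrier[OF M] y]
      mat_adjoint_index[OF M] sum_distrib_left mult_ac del: index_mult_mat_vec)
  also have "\<dots> = x \<bullet>c (mat_adjoint M *\<^sub>v y)"
    using mat_adjoint_carrier[OF M] y by (subst cscalar_prod_sum[of _ n]) auto
  finally show ?thesis .
qed

text \<open>Pairings of unit vectors recover the entries.\<close>

lemma hermitian_matI:
  assumes M: "M \<in> carrier_mat n n"
    and swap: "\<And>x y. x \<in> carrier_vec n \<Longrightarrow> y \<in> carrier_vec n \<Longrightarrow>
      cnj ((M *\<^sub>v x) \<bullet>c y) = (M *\<^sub>v y) \<bullet>c x"
  shows "hermitian_mat M"
proof -
  have e: "(M *\<^sub>v unit_vec n j) \<bullet>c unit_vec n i = M $$ (i, j)" if "i < n" "j < n" for i j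
  proof -
    have "(M *\<^sub>v unit_vec n j) \<bullet>c unit_vec n i = (\<Sum>r<n. (if r = i then M $$ (i, j) else 0))"
      unfolding cscalar_prod_sum[OF unit_vec_carrier]
      by (intro sum.cong refl) (use that M in auto)
    then show ?thesis using that by simp
  qed
  have "mat_adjoint M $$ (i, j) = M $$ (i, j)" if "i < n" "j < n" for i j
    using swap[OF unit_vec_carrier unit_vec_carrier, of i j] e that by (simp add: mat_adjoint_index[OF M])
  then show ?thesis unfolding hermitian_mat_def
    using M mat_adjoint_carrier[OF M] by (intro eq_matI) auto
qed

lemma hermitian_mat_swap:
  assumes M: "M \<in> carrier_mat n n" "hermitian_mat M" and x: "x \<in> carrier_vec n" and y: "y \<in> carrier_vec n"
  shows "(M *\<^sub>v x) \<bullet>c y = x \<bullet>c (M *\<^sub>v y)"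
  using mat_adjoint_cscalar_prod[OF M(1) x y] M(2) by (simp add: hermitian_mat_def)

lemma hermitian_mat_entries:
  "M \<in> carrier_mat n n \<Longrightarrow> hermitian_mat M \<Longrightarrow> i < n \<Longrightarrow> j < n \<Longrightarrow> cnj (M $$ (i, j)) = M $$ (j, i)"
  using mat_adjoint_index[of M n n j i] by (simp add: hermitian_mat_def)

lemma cscalar_prod_cnj:
  assumes "x \<in> carrier_vec n" "y \<in> carrier_vec n"
  shows "cnj (x \<bullet>c y) = y \<bullet>c (x :: complex vec)"
  using assms by (simp add: cscalar_prod_sum[of _ n] mult.commute)

lemma cscalar_prod_add_left:
  "x \<in> carrier_vec n \<Longrightarrow> y \<in> carrier_vec n \<Longrightarrow> z \<in> carrier_vec n \<Longrightarrow>
    (x + y) \<bullet>c z = x \<bullet>c z + y \<bullet>c (z :: complex vec)"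
  by (simp add: cscalar_prod_sum[of _ n] sum.distrib distrib_right)

lemma cscalar_prod_diff_left:
  "x \<in> carrier_vec n \<Longrightarrow> y \<in> carrier_vec n \<Longrightarrow> z \<in> carrier_vec n \<Longrightarrow>
    (x - y) \<bullet>c z = x \<bullet>c z - y \<bullet>c (z :: complex vec)"
  by (simp add: cscalar_prod_sum[of _ n] sum_subtractf left_diff_distrib)

lemma symp_form_pair_fun:
  assumes "x \<in> carrier_vec n" "z \<in> carrier_vec n" "x' \<in> carrier_vec n" "z' \<in> carrier_vec n"
  shows "symp_form n (pair_fun n x z) (pair_fun n x' z') = \<i> * (x \<bullet>c z' - z \<bullet>c x')"
  using assms by (simp add: symp_form_def pair_fun_def cscalar_prod_sum[of _ n] sum_subtractf)

lemma pair_fun_in: "pair_fun n x z \<in> fun_space (2 * n)"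
  by (simp add: pair_fun_def fun_space_def)

text \<open>\<open>D\<close> stands for \<open>B * inv_mat \<Gamma> * mat_adjoint B\<close>; the
  possibly indefinite \<open>\<Gamma>\<close> enters through this Hermitian matrix.\<close>

locale riccati =
  fixes n :: nat and A G D :: "complex mat"
  assumes A: "A \<in> carrier_mat n n" and G: "G \<in> carrier_mat n n" and D: "D \<in> carrier_mat n n"
    and hG: "hermitian_mat G" and hD: "hermitian_mat D"
begin

abbreviation R :: "complex mat"
  where "R \<equiv> four_block_mat A (- D) (- G) (- mat_adjoint A)"

abbreviation ric :: "complex mat \<Rightarrow> complex mat"
  where "ric H \<equiv> H * A + mat_adjoint A * H + G - H * D * H"

lemmas Aadj = mat_adjoint_carrier[OF A]

lemma R_index:
  assumes "i < n" "j < n"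
  shows "R $$ (i, j) = A $$ (i, j)" "R $$ (i, n + j) = - D $$ (i, j)"
    "R $$ (n + i, j) = - G $$ (i, j)" "R $$ (n + i, n + j) = - mat_adjoint A $$ (i, j)"
  using assms A G D Aadj by auto

lemma R_hamiltonian: "hamiltonian_entries n R"
  unfolding hamiltonian_entries_def
proof (intro conjI allI impI)
  show "R \<in> carrier_mat (2 * n) (2 * n)" using A G D Aadj by (auto simp: mult_2)
qed (simp_all add: R_index hermitian_mat_entries[OF G hG] hermitian_mat_entries[OF D hD] mat_adjoint_index[OF A])

lemma symp_form_R:
  assumes x: "x \<in> carrier_vec n" and z: "z \<in> carrier_vec n"
    and x': "x' \<in> carrier_vec n" and z': "z' \<in> carrier_vec n"
  shows "symp_form n (mat_op n R (pair_fun n x z)) (pair_fun n x' z')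
    = (A *\<^sub>v x - D *\<^sub>v z) \<bullet>c z' + (G *\<^sub>v x + mat_adjoint A *\<^sub>v z) \<bullet>c x'"
proof -
  have p: "pair_fun n x z j = x $ j" "pair_fun n x z (n + j) = z $ j" "pair_fun n x' z' j = x' $ j"
    "pair_fun n x' z' (n + j) = z' $ j" if "j < n" for j
    using that by (simp_all add: pair_fun_def)
  have r1: "(\<Sum>j<2 * n. R $$ (r, j) * pair_fun n x z j) = (A *\<^sub>v x - D *\<^sub>v z) $ r" if "r < n" for r
    using that A D x z unfolding sum_lessThan_double
    by (simp add: R_index p mult_mat_vec_sum[of _ n n] sum_negf del: index_mult_mat_vec index_mat_four_block)
  have r2: "(\<Sum>j<2 * n. R $$ (n + r, j) * pair_fun n x z j) = - (G *\<^sub>v x + mat_adjoint A *\<^sub>v z) $ r"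
    if "r < n" for r
    using that G Aadj x z unfolding sum_lessThan_double
    by (simp add: R_index p mult_mat_vec_sum[of _ n n] sum_negf del: index_mult_mat_vec index_mat_four_block)
  have "symp_form n (mat_op n R (pair_fun n x z)) (pair_fun n x' z')
    = (\<Sum>r<n. (A *\<^sub>v x - D *\<^sub>v z) $ r * cnj (z' $ r) + (G *\<^sub>v x + mat_adjoint A *\<^sub>v z) $ r * cnj (x' $ r))"
    unfolding symp_form_mat_op by (intro sum.cong refl) (simp only: r1 r2 p lessThan_iff, simp)
  then show ?thesis unfolding cscalar_prod_sum[OF z'] cscalar_prod_sum[OF x'] by (simp only: sum.distrib)
qed

text \<open>The bridge between inequality and form. Hermitian symmetry moves the leftmost
  \<open>H\<close> to the other side of the scalar product, and the terms of the Riccati expression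
  become the pairings of \<open>symp_form_R\<close>.\<close>

lemma symp_form_graph:
  assumes H: "H \<in> carrier_mat n n" "hermitian_mat H" and x: "x \<in> carrier_vec n" and y: "y \<in> carrier_vec n"
  shows "symp_form n (mat_op n R (pair_fun n x (H *\<^sub>v x))) (pair_fun n y (H *\<^sub>v y)) = (ric H *\<^sub>v x) \<bullet>c y"
proof -
  note c = A G D Aadj H(1) x y
  have Hx: "H *\<^sub>v x \<in> carrier_vec n" "H *\<^sub>v y \<in> carrier_vec n" using c by auto
  have "ric H *\<^sub>v x = (H * A) *\<^sub>v x + (mat_adjoint A * H) *\<^sub>v x + G *\<^sub>v x - (H * D * H) *\<^sub>v x"
    using c by (simp add: minus_mult_distrib_mat_vec[of _ n n] add_mult_distrib_mat_vec[of _ n n])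
  also have "\<dots> = H *\<^sub>v (A *\<^sub>v x) + mat_adjoint A *\<^sub>v (H *\<^sub>v x) + G *\<^sub>v x - H *\<^sub>v (D *\<^sub>v (H *\<^sub>v x))"
    using c by (simp add: assoc_mult_mat_vec[of _ n n _ n])
  also have "\<dots> \<bullet>c y = (H *\<^sub>v (A *\<^sub>v x)) \<bullet>c y + (mat_adjoint A *\<^sub>v (H *\<^sub>v x)) \<bullet>c y + (G *\<^sub>v x) \<bullet>c y
      - (H *\<^sub>v (D *\<^sub>v (H *\<^sub>v x))) \<bullet>c y"
    using c by (simp add: cscalar_prod_add_left[of _ n] cscalar_prod_diff_left[of _ n])
  also have "\<dots> = (A *\<^sub>v x) \<bullet>c (H *\<^sub>v y) + (mat_adjoint A *\<^sub>v (H *\<^sub>v x)) \<bullet>c y + (G *\<^sub>v x) \<bullet>c y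
      - (D *\<^sub>v (H *\<^sub>v x)) \<bullet>c (H *\<^sub>v y)"
    using c by (simp add: hermitian_mat_swap[OF H])
  finally show ?thesis unfolding symp_form_R[OF x Hx(1) y Hx(2)]
    using c Hx by (simp add: cscalar_prod_add_left[of _ n] cscalar_prod_diff_left[of _ n])
qed

text \<open>Collecting upper and lower halves in two square matrices makes determinants available:
  the subspace is a graph once the upper matrix is invertible.\<close>

lemma pair_fun_sum:
  assumes l: "\<And>i. i < n \<Longrightarrow> l i \<in> fun_space (2 * n)" and a: "a \<in> carrier_vec n"
  shows "(\<Sum>i<n. cscale (a $ i) (l i))
    = pair_fun n (mat n n (\<lambda>(r, i). l i r) *\<^sub>v a) (mat n n (\<lambda>(r, i). l i (n + r)) *\<^sub>v a)"
proof
  fix r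
  have "(\<Sum>i<n. cscale (a $ i) (l i)) r = (\<Sum>i<n. l i r * a $ i)"
    by (simp add: sum_fun_apply cscale_def mult.commute)
  also have "\<dots> = pair_fun n (mat n n (\<lambda>(r, i). l i r) *\<^sub>v a) (mat n n (\<lambda>(r, i). l i (n + r)) *\<^sub>v a) r"
  proof -
    consider "r < n" | "r \<ge> n" "r < 2 * n" | "r \<ge> 2 * n" by linarith
    then show ?thesis
    proof cases
      case 1
      then show ?thesis using a
        by (simp add: pair_fun_def mult_mat_vec_sum[OF mat_carrier a] del: index_mult_mat_vec)
    next
      case 2
      then show ?thesis using a
        by (simp add: pair_fun_def mult_mat_vec_sum[OF mat_carrier a] del: index_mult_mat_vec)
    next
      case 3
      then show ?thesis using l by (simp add: pair_fun_def fun_space_def)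
    qed
  qed
  finally show "(\<Sum>i<n. cscale (a $ i) (l i)) r
    = pair_fun n (mat n n (\<lambda>(r, i). l i r) *\<^sub>v a) (mat n n (\<lambda>(r, i). l i (n + r)) *\<^sub>v a) r" .
qed

lemma solution_family:
  assumes H: "H \<in> carrier_mat n n" "hermitian_mat H" "neg_definite (ric H)"
  obtains l where "\<And>i. i < n \<Longrightarrow> l i \<in> fun_space (2 * n)"
    "\<And>i j. i < n \<Longrightarrow> j < n \<Longrightarrow> symp_form n (l i) (l j) = 0"
    "\<And>c i. i < n \<Longrightarrow> c i \<noteq> 0 \<Longrightarrow>
      Re (symp_form n (mat_op n R (\<Sum>i<n. cscale (c i) (l i))) (\<Sum>i<n. cscale (c i) (l i))) < 0"
proof -
  define l where "l i = pair_fun n (unit_vec n i) (H *\<^sub>v unit_vec n i)" for i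
  have lV: "l i \<in> fun_space (2 * n)" for i unfolding l_def by (rule pair_fun_in)
  show ?thesis
  proof (rule that[of l])
    show "l i \<in> fun_space (2 * n)" for i by (rule lV)
    show "symp_form n (l i) (l j) = 0" for i j
      unfolding l_def using H(1)
      by (subst symp_form_pair_fun) (auto simp: hermitian_mat_swap[OF H(1,2)])
    fix c :: "nat \<Rightarrow> complex" and i assume i: "i < n" "c i \<noteq> 0"
    define a where "a = vec n c"
    have a: "a \<in> carrier_vec n" "a \<noteq> 0\<^sub>v n" using i by (auto simp: a_def vec_eq_iff)
    have "(\<Sum>i<n. cscale (c i) (l i)) = (\<Sum>i<n. cscale (a $ i) (l i))" by (simp add: a_def)
    also have "\<dots> = pair_fun n (mat n n (\<lambda>(r, i). l i r) *\<^sub>v a) (mat n n (\<lambda>(r, i). l i (n + r)) *\<^sub>v a)"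
      by (rule pair_fun_sum[OF lV a(1)])
    also have "mat n n (\<lambda>(r, i). l i r) = 1\<^sub>m n" by (intro eq_matI) (auto simp: l_def pair_fun_def)
    also have "mat n n (\<lambda>(r, i). l i (n + r)) = H"
      using H(1) by (intro eq_matI) (auto simp: l_def pair_fun_def)
    finally have s: "(\<Sum>i<n. cscale (c i) (l i)) = pair_fun n a (H *\<^sub>v a)" using a by simp
    have "dim_row (ric H) = n" using H(1) D by simp
    then have "Re ((ric H *\<^sub>v a) \<bullet>c a) < 0" using H(3) a unfolding neg_definite_def by simp
    then show "Re (symp_form n (mat_op n R (\<Sum>i<n. cscale (c i) (l i))) (\<Sum>i<n. cscale (c i) (l i))) < 0"
      unfolding s symp_form_graph[OF H(1,2) a(1) a(1)] .
  qed
qed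

text \<open>Reparametrisation by the inverse of \<open>X\<close> makes the subspace the graph of
  \<open>Y\<close> times that inverse; isotropy of the graph is Hermitian symmetry of this
  matrix.\<close>

lemma solution_of_graph_family:
  assumes X: "X \<in> carrier_mat n n" "det X \<noteq> 0" and Y: "Y \<in> carrier_mat n n"
    and iso: "\<And>a b. a \<in> carrier_vec n \<Longrightarrow> b \<in> carrier_vec n \<Longrightarrow>
      symp_form n (pair_fun n (X *\<^sub>v a) (Y *\<^sub>v a)) (pair_fun n (X *\<^sub>v b) (Y *\<^sub>v b)) = 0"
    and neg: "\<And>a. a \<in> carrier_vec n \<Longrightarrow> a \<noteq> 0\<^sub>v n \<Longrightarrow>
      Re (symp_form n (mat_op n R (pair_fun n (X *\<^sub>v a) (Y *\<^sub>v a))) (pair_fun n (X *\<^sub>v a) (Y *\<^sub>v a))) < 0"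
  shows "\<exists>H\<in>carrier_mat n n. hermitian_mat H \<and> neg_definite (ric H)"
proof -
  have "X \<in> Units (ring_mat TYPE(complex) n ())" by (rule det_non_zero_imp_unit[OF X])
  then obtain Xi where Xi: "Xi \<in> carrier_mat n n" "X * Xi = 1\<^sub>m n" "Xi * X = 1\<^sub>m n"
    unfolding Units_def by (auto simp: ring_mat_def)
  define H where "H = Y * Xi"
  have H: "H \<in> carrier_mat n n" using Y Xi(1) by (simp add: H_def)
  have c: "X *\<^sub>v (Xi *\<^sub>v x) = x" "Y *\<^sub>v (Xi *\<^sub>v x) = H *\<^sub>v x" "Xi *\<^sub>v x \<in> carrier_vec n"
    if x: "x \<in> carrier_vec n" for x
  proof -
    have "X *\<^sub>v (Xi *\<^sub>v x) = (X * Xi) *\<^sub>v x" by (rule assoc_mult_mat_vec[OF X(1) Xi(1) x, symmetric])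
    then show "X *\<^sub>v (Xi *\<^sub>v x) = x" unfolding Xi(2) using x by simp
    show "Y *\<^sub>v (Xi *\<^sub>v x) = H *\<^sub>v x"
      unfolding H_def by (rule assoc_mult_mat_vec[OF Y Xi(1) x, symmetric])
    show "Xi *\<^sub>v x \<in> carrier_vec n" by (rule mult_mat_vec_carrier[OF Xi(1) x])
  qed
  have Hsw: "x \<bullet>c (H *\<^sub>v y) = (H *\<^sub>v x) \<bullet>c y" if x: "x \<in> carrier_vec n" and y: "y \<in> carrier_vec n" for x y
    using iso[OF c(3)[OF x] c(3)[OF y]] H x y unfolding c(1,2)[OF x] c(1,2)[OF y]
    by (subst (asm) symp_form_pair_fun) auto
  have hH: "hermitian_mat H"
  proof (rule hermitian_matI[OF H])
    fix x y :: "complex vec" assume x: "x \<in> carrier_vec n" and y: "y \<in> carrier_vec n"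
    have "cnj ((H *\<^sub>v x) \<bullet>c y) = y \<bullet>c (H *\<^sub>v x)" by (rule cscalar_prod_cnj) (use H x y in auto)
    then show "cnj ((H *\<^sub>v x) \<bullet>c y) = (H *\<^sub>v y) \<bullet>c x" using Hsw[OF y x] by simp
  qed
  have ricc: "ric H \<in> carrier_mat n n"
    by (intro minus_carrier_mat mult_carrier_mat[of _ n n _ n] H D)
  have "hermitian_mat (ric H)"
  proof (rule hermitian_matI[OF ricc])
    fix x y :: "complex vec" assume x: "x \<in> carrier_vec n" and y: "y \<in> carrier_vec n"
    show "cnj ((ric H *\<^sub>v x) \<bullet>c y) = (ric H *\<^sub>v y) \<bullet>c x"
      using hamiltonian_form_swap[OF R_hamiltonian, of "pair_fun n x (H *\<^sub>v x)" "pair_fun n y (H *\<^sub>v y)"]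
      unfolding symp_form_graph[OF H hH x y] symp_form_graph[OF H hH y x] .
  qed
  moreover have "Re ((ric H *\<^sub>v x) \<bullet>c x) < 0" if x: "x \<in> carrier_vec n" "x \<noteq> 0\<^sub>v n" for x
  proof -
    have X0: "X *\<^sub>v 0\<^sub>v n = 0\<^sub>v n" using X(1) by (intro eq_vecI) auto
    have "Xi *\<^sub>v x \<noteq> 0\<^sub>v n"
    proof
      assume "Xi *\<^sub>v x = 0\<^sub>v n"
      then show False using c(1)[OF x(1)] X0 x(2) by simp
    qed
    then show ?thesis using neg[OF c(3)[OF x(1)]]
      unfolding c(1,2)[OF x(1)] symp_form_graph[OF H hH x(1) x(1)] by simp
  qed
  ultimately have "neg_definite (ric H)" using ricc unfolding neg_definite_def by auto
  then show ?thesis using H hH by blast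
qed

end

section \<open>Perturbing a Lagrangian subspace to a graph\<close>

context hermitian_form
begin

text \<open>Every product of two coefficients is at most the sum of their squared moduli; this
  controls the perturbation terms uniformly in the coefficients.\<close>

lemma sesquilinear_bound:
  fixes n :: nat
  assumes S: "lin S"
  shows "cmod (h (S (\<Sum>i<n. c i *s f i)) (\<Sum>i<n. c i *s g i))
    \<le> (\<Sum>i<n. \<Sum>j<n. cmod (h (S (f i)) (g j))) * (\<Sum>i<n. (cmod (c i))\<^sup>2)"
proof -
  let ?N = "\<Sum>i<n. (cmod (c i))\<^sup>2"
  have M: "(cmod (c i))\<^sup>2 \<le> ?N" if "i < n" for i
    by (rule member_le_sum) (use that in auto)
  have b: "cmod (c i) * cmod (c j) \<le> ?N" if "i < n" "j < n" for i j
  proof (cases "cmod (c i) \<le> cmod (c j)")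
    case True
    then have "cmod (c i) * cmod (c j) \<le> (cmod (c j))\<^sup>2"
      unfolding power2_eq_square by (intro mult_right_mono) auto
    then show ?thesis using M[OF that(2)] by linarith
  next
    case False
    then have "cmod (c i) * cmod (c j) \<le> (cmod (c i))\<^sup>2"
      unfolding power2_eq_square by (intro mult_left_mono) auto
    then show ?thesis using M[OF that(1)] by linarith
  qed
  have "h (S (\<Sum>i<n. c i *s f i)) (\<Sum>i<n. c i *s g i)
      = (\<Sum>i<n. \<Sum>j<n. c i * (cnj (c j) * h (S (f i)) (g j)))"
    by (simp add: lin_simps[OF S] h_sum_left h_sum_right h_scale_left h_scale_right sum_distrib_left)
      (subst sum.swap, simp add: mult_ac)
  also have "cmod \<dots> \<le> (\<Sum>i<n. \<Sum>j<n. cmod (c i * (cnj (c j) * h (S (f i)) (g j))))"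
    by (intro order_trans[OF norm_sum] sum_mono norm_sum)
  also have "\<dots> \<le> (\<Sum>i<n. \<Sum>j<n. cmod (h (S (f i)) (g j)) * ?N)"
  proof (intro sum_mono)
    fix i j assume "i \<in> {..<n}" "j \<in> {..<n}"
    then have "(cmod (c i) * cmod (c j)) * cmod (h (S (f i)) (g j)) \<le> ?N * cmod (h (S (f i)) (g j))"
      by (intro mult_right_mono b) auto
    then show "cmod (c i * (cnj (c j) * h (S (f i)) (g j))) \<le> cmod (h (S (f i)) (g j)) * ?N"
      by (simp add: norm_mult mult_ac)
  qed
  also have "\<dots> = (\<Sum>i<n. \<Sum>j<n. cmod (h (S (f i)) (g j))) * ?N"
    by (simp add: sum_distrib_right)
  finally show ?thesis .
qed

end

lemma add_smult_mult_mat_vec_index: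
  fixes X Y :: "complex mat"
  assumes X: "X \<in> carrier_mat n n" and Y: "Y \<in> carrier_mat n n" and a: "a \<in> carrier_vec n" and i: "i < n"
  shows "((X + z \<cdot>\<^sub>m Y) *\<^sub>v a) $ i = (X *\<^sub>v a) $ i + z * (Y *\<^sub>v a) $ i"
proof -
  have c: "X + z \<cdot>\<^sub>m Y \<in> carrier_mat n n" using X Y by simp
  have "((X + z \<cdot>\<^sub>m Y) *\<^sub>v a) $ i = (\<Sum>j<n. X $$ (i, j) * a $ j + z * (Y $$ (i, j) * a $ j))"
    unfolding mult_mat_vec_sum[OF c a i]
    by (intro sum.cong refl) (use X Y i in \<open>simp add: algebra_simps\<close>)
  then show ?thesis
    unfolding mult_mat_vec_sum[OF X a i] mult_mat_vec_sum[OF Y a i] by (simp add: sum.distrib sum_distrib_left)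
qed

text \<open>With the invertible \<open>Z = X + \<i> Y\<close> one has
  \<open>X + t Y = Z - (\<i> - t) Y\<close>. A kernel vector makes \<open>1 / (\<i> - t)\<close> an
  eigenvalue of the inverse of \<open>Z\<close> times \<open>Y\<close>; there are finitely many, and
  \<open>\<i> - t\<close> is never 0 for real \<open>t\<close>.\<close>

lemma finite_singular_parameters:
  fixes X Y :: "complex mat"
  assumes X: "X \<in> carrier_mat n n" and Y: "Y \<in> carrier_mat n n"
    and Z: "det (X + \<i> \<cdot>\<^sub>m Y) \<noteq> 0"
  shows "finite {t :: real. det (X + of_real t \<cdot>\<^sub>m Y) = 0}"
proof -
  have Zc: "X + \<i> \<cdot>\<^sub>m Y \<in> carrier_mat n n" using X Y by simp
  have "X + \<i> \<cdot>\<^sub>m Y \<in> Units (ring_mat TYPE(complex) n ())" by (rule det_non_zero_imp_unit[OF Zc Z])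
  then obtain Zi where Zi: "Zi \<in> carrier_mat n n" "Zi * (X + \<i> \<cdot>\<^sub>m Y) = 1\<^sub>m n"
    unfolding Units_def by (auto simp: ring_mat_def)
  let ?M = "Zi * Y"
  have M: "?M \<in> carrier_mat n n" using Zi Y by simp
  have "char_poly ?M \<noteq> 0" using degree_monic_char_poly[OF M] by auto
  then have fin: "finite {k. poly (char_poly ?M) k = 0}" by (rule poly_roots_finite)
  have "(\<lambda>t. 1 / (\<i> - of_real t)) ` {t :: real. det (X + of_real t \<cdot>\<^sub>m Y) = 0}
      \<subseteq> {k. poly (char_poly ?M) k = 0}"
  proof clarify
    fix t :: real assume "det (X + of_real t \<cdot>\<^sub>m Y) = 0"
    moreover have c: "X + of_real t \<cdot>\<^sub>m Y \<in> carrier_mat n n" using X Y by simp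
    ultimately obtain a where a: "a \<in> carrier_vec n" "a \<noteq> 0\<^sub>v n" "(X + of_real t \<cdot>\<^sub>m Y) *\<^sub>v a = 0\<^sub>v n"
      using det_0_iff_vec_prod_zero_field[OF c] by metis
    have it: "\<i> - of_real t \<noteq> 0" by (simp add: complex_eq_iff)
    have "(X + \<i> \<cdot>\<^sub>m Y) *\<^sub>v a = (\<i> - of_real t) \<cdot>\<^sub>v (Y *\<^sub>v a)"
    proof (intro eq_vecI)
      fix i assume "i < dim_vec ((\<i> - of_real t) \<cdot>\<^sub>v (Y *\<^sub>v a))"
      then have i: "i < n" using Y by simp
      have "((X + of_real t \<cdot>\<^sub>m Y) *\<^sub>v a) $ i = 0" using a(3) i by simp
      then show "((X + \<i> \<cdot>\<^sub>m Y) *\<^sub>v a) $ i = ((\<i> - of_real t) \<cdot>\<^sub>v (Y *\<^sub>v a)) $ i"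
        unfolding add_smult_mult_mat_vec_index[OF X Y a(1) i] using i Y a(1) by (simp add: algebra_simps add_eq_0_iff del: index_mult_mat_vec)
    qed (use X Y in auto)
    then have "Zi *\<^sub>v ((X + \<i> \<cdot>\<^sub>m Y) *\<^sub>v a) = (\<i> - of_real t) \<cdot>\<^sub>v (?M *\<^sub>v a)"
      using Zi(1) Y a(1) by (simp add: mult_mat_vec[of _ n n] assoc_mult_mat_vec[of _ n n _ n])
    moreover have "Zi *\<^sub>v ((X + \<i> \<cdot>\<^sub>m Y) *\<^sub>v a) = a"
      using assoc_mult_mat_vec[OF Zi(1) Zc a(1)] Zi(2) a(1) by simp
    ultimately have e: "a = (\<i> - of_real t) \<cdot>\<^sub>v (?M *\<^sub>v a)" by simp
    have "(1 / (\<i> - of_real t)) \<cdot>\<^sub>v ((\<i> - of_real t) \<cdot>\<^sub>v (?M *\<^sub>v a)) = ?M *\<^sub>v a"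
      using it by (simp add: smult_smult_assoc)
    then have "?M *\<^sub>v a = (1 / (\<i> - of_real t)) \<cdot>\<^sub>v a" using e by simp
    then have "eigenvector ?M a (1 / (\<i> - of_real t))"
      unfolding eigenvector_def using a M Zi(1) by simp
    then show "poly (char_poly ?M) (1 / (\<i> - of_real t)) = 0"
      using eigenvalue_root_char_poly[OF M] unfolding eigenvalue_def by metis
  qed
  then have "finite ((\<lambda>t. 1 / (\<i> - of_real t)) ` {t :: real. det (X + of_real t \<cdot>\<^sub>m Y) = 0})"
    using fin by (rule finite_subset)
  moreover have "inj (\<lambda>t :: real. 1 / (\<i> - of_real t))"
    by (intro injI) simp
  ultimately show ?thesis using finite_imageD inj_on_subset by blast
qed

context riccati
begin

text \<open>A Lagrangian subspace on which the form is negative definite need not be a graph over the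
  first \<open>n\<close> coordinates; adding \<open>t\<close> times the last \<open>n\<close> coordinates to the first ones makes it a graph
  for all but finitely many \<open>t\<close>, and preserves definiteness for small \<open>t\<close>.\<close>

lemma solution_of_lagrangian_family:
  assumes lV: "\<forall>i<n. l i \<in> fun_space (2 * n)" and liso: "\<forall>i<n. \<forall>j<n. symp_form n (l i) (l j) = 0"
    and m: "m > 0"
    and neg: "\<forall>c. Re (symp_form n (mat_op n R (\<Sum>i<n. cscale (c i) (l i))) (\<Sum>i<n. cscale (c i) (l i)))
      \<le> - m * (\<Sum>i<n. (cmod (c i))\<^sup>2)"
  shows "\<exists>H\<in>carrier_mat n n. hermitian_mat H \<and> neg_definite (ric H)"
proof -
  define X where "X = mat n n (\<lambda>(r, i). l i r)"
  define Y where "Y = mat n n (\<lambda>(r, i). l i (n + r))"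
  have X: "X \<in> carrier_mat n n" and Y: "Y \<in> carrier_mat n n" by (auto simp: X_def Y_def)
  let ?N = "\<lambda>c :: nat \<Rightarrow> complex. \<Sum>i<n. (cmod (c i))\<^sup>2"
  have Npos: "?N (\<lambda>i. a $ i) > 0" if a: "a \<in> carrier_vec n" "a \<noteq> 0\<^sub>v n" for a
  proof -
    obtain i where i: "i < n" "a $ i \<noteq> 0" using a by (auto simp: vec_eq_iff)
    show ?thesis by (rule sum_pos2[of _ i]) (use i in auto)
  qed
  \<comment> \<open>A kernel vector \<open>a\<close> gives a vector of the subspace whose halves
    satisfy \<open>X a = - \<i> Y a\<close>. Isotropy then forces \<open>Y a = 0\<close>, so the
    vector is 0, contrary to the strict bound.\<close>
  have "det (X + \<i> \<cdot>\<^sub>m Y) \<noteq> 0"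
  proof
    assume z: "det (X + \<i> \<cdot>\<^sub>m Y) = 0"
    have c: "X + \<i> \<cdot>\<^sub>m Y \<in> carrier_mat n n" using X Y by simp
    obtain a where a: "a \<in> carrier_vec n" "a \<noteq> 0\<^sub>v n" "(X + \<i> \<cdot>\<^sub>m Y) *\<^sub>v a = 0\<^sub>v n"
      using det_0_iff_vec_prod_zero_field[OF c] z by metis
    define u where "u = (\<Sum>i<n. cscale (a $ i) (l i))"
    have u: "u = pair_fun n (X *\<^sub>v a) (Y *\<^sub>v a)"
      unfolding u_def X_def Y_def by (rule pair_fun_sum) (use lV a in auto)
    have Xa: "(X *\<^sub>v a) $ i = - \<i> * (Y *\<^sub>v a) $ i" if "i < n" for i
    proof -
      have "((X + \<i> \<cdot>\<^sub>m Y) *\<^sub>v a) $ i = (X *\<^sub>v a) $ i + \<i> * (Y *\<^sub>v a) $ i"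
        by (rule add_smult_mult_mat_vec_index[OF X Y a(1) that])
      then show ?thesis using a(3) that by (simp add: add_eq_0_iff del: index_mult_mat_vec)
    qed
    have "symp_form n u u = 0"
      unfolding u_def using liso by (simp add: sf.h_sum_left sf.h_sum_right sf.h_scale_left sf.h_scale_right)
    moreover have "symp_form n u u = of_real (\<Sum>r<n. 2 * (cmod ((Y *\<^sub>v a) $ r))\<^sup>2)"
    proof -
      have key: "\<i> * (- \<i> * y * cnj y - y * cnj (- \<i> * y)) = of_real (2 * (cmod y)\<^sup>2)" for y
      proof -
        have "\<i> * (- \<i> * y * cnj y - y * cnj (- \<i> * y)) = 2 * (y * cnj y)"
          by (simp add: algebra_simps)
        then show ?thesis by (simp only: of_real_mult complex_norm_square of_real_numeral)
      qed
      have ur: "u r = - \<i> * (Y *\<^sub>v a) $ r" "u (n + r) = (Y *\<^sub>v a) $ r" if "r < n" for r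
        using that Xa by (simp_all add: u pair_fun_def del: index_mult_mat_vec)
      have "symp_form n u u = (\<Sum>r<n. \<i> * (u r * cnj (u (n + r)) - u (n + r) * cnj (u r)))"
        by (simp add: symp_form_def sum_distrib_left)
      also have "\<dots> = (\<Sum>r<n. of_real (2 * (cmod ((Y *\<^sub>v a) $ r))\<^sup>2))"
        by (intro sum.cong refl) (simp only: ur key lessThan_iff)
      finally show ?thesis by simp
    qed
    ultimately have "(\<Sum>r<n. 2 * (cmod ((Y *\<^sub>v a) $ r))\<^sup>2) = 0" by (metis of_real_eq_0_iff)
    then have Y0: "(Y *\<^sub>v a) $ r = 0" if "r < n" for r
      using that by (subst (asm) sum_nonneg_eq_0_iff) auto
    have "u = 0"
    proof
      show "u r = 0 r" for r
        using Xa[of r] Y0[of r] Y0[of "r - n"] by (simp add: u pair_fun_def del: index_mult_mat_vec)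
    qed
    then have "- m * ?N (\<lambda>i. a $ i) \<ge> 0" using neg[rule_format, of "\<lambda>i. a $ i"] by (simp add: u_def)
    then show False using mult_pos_pos[OF m Npos[OF a(1,2)]] by simp
  qed
  then have fin: "finite {t :: real. det (X + of_real t \<cdot>\<^sub>m Y) = 0}"
    by (rule finite_singular_parameters[OF X Y])
  \<comment> \<open>The lower half moved to the upper coordinates. Adding a real multiple is the
    shear from \<open>(x, z)\<close> to \<open>(x + t z, z)\<close>, which preserves
    \<open>symp_form\<close>.\<close>
  define p where "p i = (\<lambda>r. if r < n then l i (n + r) else 0)" for i
  let ?Q = "\<lambda>u v. symp_form n (mat_op n R u) v"
  define C where "C = (\<Sum>i<n. \<Sum>j<n. cmod (?Q (l i) (p j))) + (\<Sum>i<n. \<Sum>j<n. cmod (?Q (p i) (l j)))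
    + (\<Sum>i<n. \<Sum>j<n. cmod (?Q (p i) (p j)))"
  have C: "C \<ge> 0" unfolding C_def by (intro add_nonneg_nonneg sum_nonneg) auto
  \<comment> \<open>\<open>t \<le> 1\<close> lets the quadratic term be absorbed into
    \<open>t * C\<close>, and \<open>t * (C + 1) < m\<close> keeps the sum negative; the
    \<open>+ 1\<close> keeps the denominator positive.\<close>
  define \<epsilon> where "\<epsilon> = min 1 (m / (C + 1))"
  have \<epsilon>: "\<epsilon> > 0" using m C by (simp add: \<epsilon>_def)
  have "infinite {0<..<\<epsilon>}" using \<epsilon> by (rule infinite_Ioo)
  then have "infinite ({0<..<\<epsilon>} - {t :: real. det (X + of_real t \<cdot>\<^sub>m Y) = 0})"
    using fin by (rule Diff_infinite_finite[rotated])
  then have "{0<..<\<epsilon>} - {t :: real. det (X + of_real t \<cdot>\<^sub>m Y) = 0} \<noteq> {}"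
    by (rule infinite_imp_nonempty)
  then obtain t where "t \<in> {0<..<\<epsilon>} - {t :: real. det (X + of_real t \<cdot>\<^sub>m Y) = 0}" by (metis ex_in_conv)
  then have t: "0 < t" "t < \<epsilon>" "det (X + of_real t \<cdot>\<^sub>m Y) \<noteq> 0" by simp_all
  have t1: "t \<le> 1" "t * (C + 1) < m" using t(1,2) C by (auto simp: \<epsilon>_def field_simps)
  define l' where "l' i = l i + cscale (of_real t) (p i)" for i
  have l'V: "l' i \<in> fun_space (2 * n)" if "i < n" for i
    using lV that by (auto simp: l'_def p_def fun_space_def cscale_def)
  have X': "mat n n (\<lambda>(r, i). l' i r) = X + of_real t \<cdot>\<^sub>m Y"
    by (intro eq_matI) (auto simp: X_def Y_def l'_def p_def cscale_def)
  have Y': "mat n n (\<lambda>(r, i). l' i (n + r)) = Y"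
    by (intro eq_matI) (auto simp: Y_def l'_def p_def cscale_def)
  have s: "pair_fun n ((X + of_real t \<cdot>\<^sub>m Y) *\<^sub>v a) (Y *\<^sub>v a) = (\<Sum>i<n. cscale (a $ i) (l' i))"
    if "a \<in> carrier_vec n" for a
    using pair_fun_sum[of l', OF l'V that] unfolding X' Y' by simp
  have l'iso: "symp_form n (l' i) (l' j) = 0" if "i < n" "j < n" for i j
  proof -
    have "symp_form n (p i) (l j) + symp_form n (l i) (p j) = 0"
      by (simp add: symp_form_def p_def sum_negf)
    moreover have "symp_form n (p i) (p j) = 0" by (simp add: symp_form_def p_def)
    moreover have "symp_form n (l' i) (l' j) = symp_form n (l i) (l j)
      + of_real t * (symp_form n (p i) (l j) + symp_form n (l i) (p j))
      + of_real t * (of_real t * symp_form n (p i) (p j))"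
      by (simp add: l'_def sf.h_add_left sf.h_add_right sf.h_scale_left sf.h_scale_right algebra_simps)
    ultimately show ?thesis using liso that by simp
  qed
  show ?thesis
  proof (rule solution_of_graph_family[OF _ t(3) Y])
    show "X + of_real t \<cdot>\<^sub>m Y \<in> carrier_mat n n" using X Y by simp
    show "symp_form n (pair_fun n ((X + of_real t \<cdot>\<^sub>m Y) *\<^sub>v a) (Y *\<^sub>v a))
      (pair_fun n ((X + of_real t \<cdot>\<^sub>m Y) *\<^sub>v b) (Y *\<^sub>v b)) = 0"
      if "a \<in> carrier_vec n" "b \<in> carrier_vec n" for a b
      unfolding s[OF that(1)] s[OF that(2)] using l'iso
      by (simp add: sf.h_sum_left sf.h_sum_right sf.h_scale_left sf.h_scale_right)
    fix a :: "complex vec" assume a: "a \<in> carrier_vec n" "a \<noteq> 0\<^sub>v n"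
    define c where "c i = a $ i" for i
    define u where "u = (\<Sum>i<n. cscale (c i) (l i))"
    define w where "w = (\<Sum>i<n. cscale (c i) (p i))"
    have uw: "(\<Sum>i<n. cscale (a $ i) (l' i)) = u + cscale (of_real t) w"
    proof -
      have "cscale (a $ i) (l' i) = cscale (c i) (l i) + cscale (of_real t) (cscale (c i) (p i))" for i
        by (rule ext) (simp add: l'_def cscale_def c_def algebra_simps)
      then show ?thesis
        by (simp add: u_def w_def sum.distrib sf.scale_sum_right del: sf.scale_scale)
    qed
    define E where "E = of_real t * ?Q u w + of_real t * ?Q w u + of_real (t * t) * ?Q w w"
    have Q: "?Q (u + cscale (of_real t) w) (u + cscale (of_real t) w)
      = ?Q u u + E"
      unfolding E_def
      by (simp add: sf.lin_simps[OF mat_op_lin] sf.h_add_left sf.h_add_right sf.h_scale_left sf.h_scale_right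
          algebra_simps)
    have "Re E \<le> cmod E" by (rule complex_Re_le_cmod)
    also have "\<dots> \<le> cmod (of_real t * ?Q u w) + cmod (of_real t * ?Q w u) + cmod (of_real (t * t) * ?Q w w)"
      unfolding E_def by (rule order_trans[OF norm_triangle_ineq]) (intro add_right_mono norm_triangle_ineq)
    also have "\<dots> = t * cmod (?Q u w) + t * cmod (?Q w u) + t * t * cmod (?Q w w)"
      using t(1) by (simp add: norm_mult)
    also have "\<dots> \<le> t * cmod (?Q u w) + t * cmod (?Q w u) + t * cmod (?Q w w)"
      using t(1) t1(1) by (intro add_left_mono mult_right_mono) (auto intro: mult_left_le)
    also have "\<dots> \<le> t * (C * ?N c)"
    proof -
      have "cmod (?Q u w) + cmod (?Q w u) + cmod (?Q w w) \<le> C * ?N c"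
        unfolding C_def u_def w_def distrib_right
        by (intro add_mono sf.sesquilinear_bound[OF mat_op_lin])
      from mult_left_mono[OF this, of t] t(1) show ?thesis by (simp add: algebra_simps)
    qed
    finally have E: "Re E \<le> t * (C * ?N c)" .
    have "Re (?Q u u) \<le> - m * ?N c" using neg[rule_format, of c] by (simp add: u_def)
    then have "Re (?Q u u) + Re E \<le> (t * C - m) * ?N c" using E by (simp add: algebra_simps)
    moreover have "(t * C - m) * ?N c < 0"
    proof (rule mult_neg_pos)
      show "t * C - m < 0" using t1(2) t(1) by (simp add: algebra_simps)
      show "?N c > 0" using Npos[OF a] by (simp add: c_def)
    qed
    ultimately have "Re (?Q (u + cscale (of_real t) w) (u + cscale (of_real t) w)) < 0" unfolding Q by simp
    then show "Re (?Q (pair_fun n ((X + of_real t \<cdot>\<^sub>m Y) *\<^sub>v a) (Y *\<^sub>v a))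
        (pair_fun n ((X + of_real t \<cdot>\<^sub>m Y) *\<^sub>v a) (Y *\<^sub>v a))) < 0"
      unfolding s[OF a(1)] uw .
  qed
qed

end

section \<open>Root vectors and the span of the chains\<close>

context hermitian_form
begin

lemma jordan_chain_root_vector:
  assumes J: "jordan_family T V N w k \<kappa> e" and b: "b < N" and j: "j < k b"
    and S: "S = (\<lambda>x. T x - of_real (w b) *s x)" and l: "lin S"
  shows "(S ^^ Suc j) (e b j) = 0"
  using j
proof (induction j)
  case 0
  then show ?case using jordan_familyD(4)[OF J b 0] by (simp add: S)
next
  case (Suc j)
  have "(S ^^ Suc (Suc j)) (e b (Suc j)) = (S ^^ Suc j) (S (e b (Suc j)))"
    by (simp only: funpow_Suc_right o_apply)
  also have "S (e b (Suc j)) = e b j" using jordan_familyD(4)[OF J b Suc.prems] by (simp add: S)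
  finally show ?case using Suc by simp
qed

text \<open>Let \<open>y\<close> be the component of \<open>x\<close> in the complement.
  \<open>(S ^^ K) y\<close> lies both in the complement and in the chain span, so it is 0; without
  real eigenvectors in the complement, \<open>S\<close> is injective there and
  \<open>y = 0\<close>.\<close>

lemma root_vector_in_chain_span:
  assumes s: "sa_space T V" and J: "jordan_family T V N w k \<kappa> e"
    and nr: "no_real T (perp (chain_idx N k) (case_prod e) V)"
    and S: "S = (\<lambda>x. T x - of_real \<omega> *s x)" and x: "x \<in> V" "(S ^^ K) x = 0"
  shows "x \<in> span (case_prod e ` chain_idx N k)"
proof -
  let ?C = "chain_idx N k" and ?E = "case_prod e"
  let ?U = "perp ?C ?E V" and ?P = "span (?E ` ?C)"
  note V = sa_spaceD[OF s]
  note g = jordan_family_gram_system[OF J]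
  have sU: "sa_space T ?U"
    by (rule sa_space_perp[OF s g jordan_family_in[OF J] jordan_family_chain_in_span[OF J]])
  note l = sa_space_shift(1)[OF s fun_cong[OF S]]
  have TP: "T v \<in> ?P" if "v \<in> ?P" for v
    using that
  proof (induction rule: span_induct_alt)
    case base
    show ?case by (simp add: lin_simps[OF V(3)] span_zero)
  next
    case (step c v y)
    then obtain p where "p \<in> ?C" "v = ?E p" by blast
    then have "T v \<in> ?P" using jordan_family_chain_in_span[OF J] by simp
    then show ?case using step(2) by (simp add: lin_simps[OF V(3)] span_add span_scale)
  qed
  have SP: "(S ^^ K) v \<in> ?P" if "v \<in> ?P" for v K
    by (induction K) (use that TP in \<open>simp_all add: S span_diff span_scale\<close>)
  obtain c where c: "x - (\<Sum>i\<in>?C. c i *s ?E i) \<in> ?U"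
    using gram_system_decomp[OF g V(1) jordan_family_in[OF J] x(1)] .
  define v where "v = (\<Sum>i\<in>?C. c i *s ?E i)"
  define y where "y = x - v"
  have v: "v \<in> ?P" unfolding v_def by (intro span_sum span_scale span_base imageI)
  have y: "y \<in> ?U" using c by (simp add: y_def v_def)
  have "(S ^^ K) y = (S ^^ K) x - (S ^^ K) v" by (simp add: y_def lin_simps[OF lin_funpow[OF l]])
  then have "(S ^^ K) y \<in> ?P" using x(2) SP[OF v] by (simp add: span_neg)
  moreover have "(S ^^ K) y \<in> ?U" by (rule sa_space_shift(2)[OF sU fun_cong[OF S] y])
  then have "h ((S ^^ K) y) (?E p) = 0" if "p \<in> ?C" for p using that unfolding perp_def by blast
  ultimately have Sy: "(S ^^ K) y = 0" by (rule gram_system_span_perp[OF g])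
  have "y = 0" using y Sy
  proof (induction K arbitrary: y)
    case (Suc K)
    have "S y \<in> ?U" using sa_space_shift(2)[OF sU fun_cong[OF S] Suc.prems(1), of 1] by simp
    moreover have "(S ^^ K) (S y) = 0" using Suc.prems(2) by (simp only: funpow_Suc_right o_apply)
    ultimately have "S y = 0" by (rule Suc.IH)
    then have "T y = of_real \<omega> *s y" by (simp add: S)
    then show ?case using nr Suc.prems(1) unfolding no_real_def by metis
  qed simp
  then show ?thesis using v by (simp add: y_def)
qed

end

section \<open>Indexed Jordan bases\<close>

definition to_fun :: "complex vec \<Rightarrow> nat \<Rightarrow> complex"
  where "to_fun v = (\<lambda>i. if i < dim_vec v then v $ i else 0)"

lemma to_fun_in: "v \<in> carrier_vec d \<Longrightarrow> to_fun v \<in> fun_space d"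
  by (auto simp: to_fun_def fun_space_def)

lemma to_fun_inject: "v \<in> carrier_vec d \<Longrightarrow> u \<in> carrier_vec d \<Longrightarrow> to_fun v = to_fun u \<longleftrightarrow> v = u"
  by (auto simp: to_fun_def fun_eq_iff vec_eq_iff)

lemma to_fun_vec: "f \<in> fun_space d \<Longrightarrow> to_fun (vec d f) = f"
  by (auto simp: to_fun_def fun_space_def)

abbreviation vspan :: "nat \<Rightarrow> complex vec set \<Rightarrow> complex vec set"
  where "vspan d \<equiv> LinearCombinations.module.span class_ring (module_vec TYPE(complex) d)"

abbreviation vlincomb :: "nat \<Rightarrow> (complex vec \<Rightarrow> complex) \<Rightarrow> complex vec set \<Rightarrow> complex vec"
  where "vlincomb d \<equiv> LinearCombinations.module.lincomb (module_vec TYPE(complex) d)"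

abbreviation vlin_dep :: "nat \<Rightarrow> complex vec set \<Rightarrow> bool"
  where "vlin_dep d \<equiv> LinearCombinations.module.lin_dep class_ring (module_vec TYPE(complex) d)"

lemma to_fun_lincomb:
  assumes fin: "finite A" and AC: "A \<subseteq> carrier_vec d"
  shows "to_fun (vlincomb d a A) = (\<Sum>v\<in>A. cscale (a v) (to_fun v))"
proof
  interpret vs: vec_space "TYPE(complex)" d .
  fix i
  have d: "dim_vec v = d" if "v \<in> A" for v using AC that by auto
  have D: "dim_vec (vlincomb d a A) = d" using vs.lincomb_dim[OF fin AC, of a] .
  have "(\<Sum>v\<in>A. cscale (a v) (to_fun v)) i = (\<Sum>v\<in>A. if i < d then a v * v $ i else 0)"
    unfolding sum_fun_apply by (intro sum.cong refl) (simp add: cscale_def to_fun_def d)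
  then show "to_fun (vlincomb d a A) i = (\<Sum>v\<in>A. cscale (a v) (to_fun v)) i"
    using vs.lincomb_index[OF _ AC, of i a] by (simp add: to_fun_def D)
qed

text \<open>Spans of \<open>complex vec\<close> belong to a module with an explicit carrier; this
  and the next lemma connect span and independence there with those of functions.\<close>

lemma span_iff_to_fun:
  assumes S: "S \<subseteq> carrier_vec d"
  shows "v \<in> vspan d S \<longleftrightarrow> v \<in> carrier_vec d \<and> to_fun v \<in> sf.span (to_fun ` S)"
proof
  interpret vs: vec_space "TYPE(complex)" d .
  assume v: "v \<in> vspan d S"
  then obtain a A where A: "finite A" "A \<subseteq> S" "vlincomb d a A = v"
    unfolding vs.span_def by blast
  have "to_fun v \<in> sf.span (to_fun ` S)"
    unfolding A(3)[symmetric] to_fun_lincomb[OF A(1) subset_trans[OF A(2) S]]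
    using A(2) by (intro sf.span_sum sf.span_scale sf.span_base) auto
  moreover have "v \<in> carrier_vec d" using vs.span_closed[OF S v] .
  ultimately show "v \<in> carrier_vec d \<and> to_fun v \<in> sf.span (to_fun ` S)" by simp
next
  interpret vs: vec_space "TYPE(complex)" d .
  assume v: "v \<in> carrier_vec d \<and> to_fun v \<in> sf.span (to_fun ` S)"
  then obtain t r where t: "finite t" "t \<subseteq> to_fun ` S" "to_fun v = (\<Sum>a\<in>t. cscale (r a) a)"
    unfolding sf.span_explicit by auto
  obtain A where A: "A \<subseteq> S" "finite A" "t = to_fun ` A" using finite_subset_image[OF t(1,2)] by blast
  have "inj_on to_fun A" using A(1) S to_fun_inject by (intro inj_onI) blast
  then have "to_fun v = to_fun (vlincomb d (\<lambda>u. r (to_fun u)) A)"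
    unfolding t(3) A(3) to_fun_lincomb[OF A(2) subset_trans[OF A(1) S]] by (simp add: sum.reindex)
  moreover have "vlincomb d (\<lambda>u. r (to_fun u)) A \<in> carrier_vec d"
    using A(1) S by (intro vs.lincomb_closed) auto
  ultimately have "v = vlincomb d (\<lambda>u. r (to_fun u)) A" using v to_fun_inject by blast
  then show "v \<in> vspan d S" unfolding vs.span_def using A(1,2) by (auto simp: class_ring_simps)
qed

lemma lin_indpt_to_fun:
  assumes S: "S \<subseteq> carrier_vec d" and ind: "sf.independent (to_fun ` S)"
  shows "\<not> vlin_dep d S"
proof
  interpret vs: vec_space "TYPE(complex)" d .
  assume "vlin_dep d S"
  then obtain A a v where A: "finite A" "A \<subseteq> S" "vlincomb d a A = 0\<^sub>v d" "v \<in> A" "a v \<noteq> 0"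
    unfolding vs.lin_dep_def by (auto simp: module_vec_simps class_ring_simps)
  have inj: "inj_on to_fun A" using A(2) S to_fun_inject by (intro inj_onI) blast
  have "(\<Sum>u\<in>A. cscale (a u) (to_fun u)) = to_fun (0\<^sub>v d)"
    using to_fun_lincomb[OF A(1) subset_trans[OF A(2) S], of a] A(3) by simp
  also have "\<dots> = 0" by (auto simp: to_fun_def)
  finally have "(\<Sum>f\<in>to_fun ` A. cscale (a (the_inv_into A to_fun f)) f) = 0"
    using inj by (simp add: sum.reindex the_inv_into_f_f)
  then have "a (the_inv_into A to_fun (to_fun v)) = 0"
    by (rule sf.independentD[OF ind finite_imageI[OF A(1)] image_mono[OF A(2)] _ imageI[OF A(4)]])
  then show False using A(4,5) inj by (simp add: the_inv_into_f_f)
qed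

lemma mat_op_to_fun:
  assumes R: "R \<in> carrier_mat (2 * n) (2 * n)" and v: "v \<in> carrier_vec (2 * n)"
  shows "mat_op n R (to_fun v) = cscale (- \<i>) (to_fun (R *\<^sub>v v))"
proof
  fix i
  show "mat_op n R (to_fun v) i = cscale (- \<i>) (to_fun (R *\<^sub>v v)) i"
    using assms by (simp add: mat_op_def to_fun_def cscale_def mult_mat_vec_sum[OF R v] del: index_mult_mat_vec)
qed

text \<open>The characteristic matrix at \<open>i \<omega>\<close> acts as \<open>\<i>\<close> times
  the shifted operator, so their powers have the same kernels.\<close>

lemma root_subspace_iff_to_fun:
  assumes R: "R \<in> carrier_mat (2 * n) (2 * n)" and v: "v \<in> carrier_vec (2 * n)"
  shows "v \<in> root_subspace R (Complex 0 \<omega>) \<longleftrightarrow>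
    (\<exists>K. ((\<lambda>x. mat_op n R x - cscale (of_real \<omega>) x) ^^ K) (to_fun v) = 0)"
proof -
  define S where "S = (\<lambda>x. mat_op n R x - cscale (of_real \<omega>) x)"
  define c where "c = Complex 0 \<omega>"
  have c: "c = \<i> * of_real \<omega>" by (simp add: c_def complex_eq_iff)
  let ?M = "char_matrix R c"
  have M: "?M \<in> carrier_mat (2 * n) (2 * n)" using R by (simp add: char_matrix_def)
  have lS: "Modules.module_hom cscale cscale S"
    by (rule sf.linI) (simp_all add: S_def sf.lin_simps[OF mat_op_lin] sf.scale_right_distrib
        sf.scale_right_diff_distrib mult.commute)
  have step: "to_fun (?M *\<^sub>v u) = cscale \<i> (S (to_fun u))" if u: "u \<in> carrier_vec (2 * n)" for u
  proof
    fix i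
    have Su: "S (to_fun u) = cscale (- \<i>) (to_fun (R *\<^sub>v u)) - cscale (of_real \<omega>) (to_fun u)"
      by (simp add: S_def mat_op_to_fun[OF R u])
    show "to_fun (?M *\<^sub>v u) i = cscale \<i> (S (to_fun u)) i"
    proof (cases "i < 2 * n")
      case True
      have "(?M *\<^sub>v u) $ i = (\<Sum>j<2 * n. R $$ (i, j) * u $ j - (if j = i then c * u $ i else 0))"
        unfolding mult_mat_vec_sum[OF M u True]
        by (intro sum.cong refl) (use R True in \<open>auto simp: char_matrix_def algebra_simps\<close>)
      then have "(?M *\<^sub>v u) $ i = (R *\<^sub>v u) $ i - c * u $ i"
        using True by (simp add: sum_subtractf mult_mat_vec_sum[OF R u] del: index_mult_mat_vec)
      then have "to_fun (?M *\<^sub>v u) i = (R *\<^sub>v u) $ i - c * u $ i"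
        using True M by (simp add: to_fun_def del: index_mult_mat_vec)
      also have "\<dots> = cscale \<i> (S (to_fun u)) i"
        unfolding Su c using True R u
        by (simp add: to_fun_def cscale_def algebra_simps del: index_mult_mat_vec)
      finally show ?thesis .
    next
      case False
      then have "to_fun (?M *\<^sub>v u) i = 0" "S (to_fun u) i = 0"
        unfolding Su using carrier_matD[OF M] R u by (simp_all add: to_fun_def cscale_def)
      then show ?thesis by (simp add: cscale_def)
    qed
  qed
  have "\<forall>u\<in>carrier_vec (2 * n). to_fun ((?M ^\<^sub>m K) *\<^sub>v u) = cscale (\<i> ^ K) ((S ^^ K) (to_fun u))" for K
  proof (induction K)
    case 0
    show ?case using M by (auto simp: cscale_def)
  next
    case (Suc K)
    show ?case
    proof
      fix u :: "complex vec" assume u: "u \<in> carrier_vec (2 * n)"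
      have Mu: "?M *\<^sub>v u \<in> carrier_vec (2 * n)" using M u by simp
      have "(?M ^\<^sub>m Suc K) *\<^sub>v u = (?M ^\<^sub>m K) *\<^sub>v (?M *\<^sub>v u)"
        using assoc_mult_mat_vec[OF pow_carrier_mat[OF M] M u] by simp
      then have "to_fun ((?M ^\<^sub>m Suc K) *\<^sub>v u) = cscale (\<i> ^ K) ((S ^^ K) (cscale \<i> (S (to_fun u))))"
        using Suc.IH Mu step[OF u] by simp
      also have "\<dots> = cscale (\<i> ^ Suc K) ((S ^^ K) (S (to_fun u)))"
        by (simp add: sf.lin_simps[OF sf.lin_funpow[OF lS]] mult.commute)
      finally show "to_fun ((?M ^\<^sub>m Suc K) *\<^sub>v u) = cscale (\<i> ^ Suc K) ((S ^^ Suc K) (to_fun u))"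
        by (simp only: funpow_Suc_right o_apply)
    qed
  qed
  then have e: "to_fun ((?M ^\<^sub>m K) *\<^sub>v v) = cscale (\<i> ^ K) ((S ^^ K) (to_fun v))" for K using v by blast
  have "(?M ^\<^sub>m K) *\<^sub>v v = 0\<^sub>v (2 * n) \<longleftrightarrow> (S ^^ K) (to_fun v) = 0" for K
  proof -
    have c: "(?M ^\<^sub>m K) *\<^sub>v v \<in> carrier_vec (2 * n)" by (rule mult_mat_vec_carrier[OF pow_carrier_mat[OF M] v])
    have "(?M ^\<^sub>m K) *\<^sub>v v = 0\<^sub>v (2 * n) \<longleftrightarrow> to_fun ((?M ^\<^sub>m K) *\<^sub>v v) = to_fun (0\<^sub>v (2 * n))"
      using to_fun_inject[OF c zero_carrier_vec] by simp
    also have "to_fun (0\<^sub>v (2 * n)) = 0" by (auto simp: to_fun_def)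
    finally show ?thesis by (simp only: e sf.scale_eq_0_iff) simp
  qed
  then show ?thesis unfolding root_subspace_def S_def[symmetric] c_def[symmetric] using R v by auto
qed

lemma symp_J_mult_index:
  assumes S: "S \<in> carrier_mat (2 * n) k" and a: "a < n" and s: "s < k"
  shows "(symp_J n * S) $$ (a, s) = - S $$ (n + a, s)" "(symp_J n * S) $$ (n + a, s) = S $$ (a, s)"
proof -
  have J: "symp_J n \<in> carrier_mat (2 * n) (2 * n)"
    unfolding symp_J_def mult_2 by (intro four_block_carrier_mat) auto
  have e: "(symp_J n * S) $$ (i, s) = (\<Sum>j<2 * n. symp_J n $$ (i, j) * S $$ (j, s))" if "i < 2 * n" for i
    using that J S s by (simp add: scalar_prod_def atLeast0LessThan)
  have Je: "symp_J n $$ (a, j) = 0" "symp_J n $$ (a, n + j) = (if j = a then -1 else 0)"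
    "symp_J n $$ (n + a, j) = (if j = a then 1 else 0)" "symp_J n $$ (n + a, n + j) = 0" if "j < n" for j
    using that a by (auto simp: symp_J_def)
  have "(\<Sum>j<n. symp_J n $$ (a, j) * S $$ (j, s)) = 0" by (intro sum.neutral) (simp add: Je)
  moreover have "(\<Sum>j<n. symp_J n $$ (a, n + j) * S $$ (n + j, s)) = (\<Sum>j<n. if j = a then - S $$ (n + a, s) else 0)"
    by (intro sum.cong refl) (simp add: Je)
  ultimately show "(symp_J n * S) $$ (a, s) = - S $$ (n + a, s)"
    using a by (subst e) (simp_all add: sum_lessThan_double)
  have "(\<Sum>j<n. symp_J n $$ (n + a, n + j) * S $$ (n + j, s)) = 0" by (intro sum.neutral) (simp add: Je)
  moreover have "(\<Sum>j<n. symp_J n $$ (n + a, j) * S $$ (j, s)) = (\<Sum>j<n. if j = a then S $$ (a, s) else 0)"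
    by (intro sum.cong refl) (simp add: Je)
  ultimately show "(symp_J n * S) $$ (n + a, s) = S $$ (a, s)"
    using a by (subst e) (simp_all add: sum_lessThan_double)
qed

lemma adjoint_symp_J_index:
  assumes S: "S \<in> carrier_mat (2 * n) k" and S': "S' \<in> carrier_mat (2 * n) k'" and r: "r < k" and s: "s < k'"
  shows "(mat_adjoint S * symp_J n * S') $$ (r, s) = - \<i> * symp_form n (to_fun (col S' s)) (to_fun (col S r))"
proof -
  have J: "symp_J n \<in> carrier_mat (2 * n) (2 * n)"
    unfolding symp_J_def mult_2 by (intro four_block_carrier_mat) auto
  note Sa = mat_adjoint_carrier[OF S]
  have JS: "symp_J n * S' \<in> carrier_mat (2 * n) k'" by (rule mult_carrier_mat[OF J S'])
  have "mat_adjoint S * symp_J n * S' = mat_adjoint S * (symp_J n * S')" by (rule assoc_mult_mat[OF Sa J S'])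
  also have "\<dots> $$ (r, s) = (\<Sum>a<2 * n. mat_adjoint S $$ (r, a) * (symp_J n * S') $$ (a, s))"
    using r s carrier_matD[OF Sa] carrier_matD[OF JS] by (simp add: scalar_prod_def atLeast0LessThan)
  also have "\<dots> = (\<Sum>a<n. - cnj (S $$ (a, r)) * S' $$ (n + a, s) + cnj (S $$ (n + a, r)) * S' $$ (a, s))"
    unfolding sum_lessThan_double sum.distrib using r s
    by (intro arg_cong2[of _ _ _ _ "(+)"] sum.cong refl)
      (simp_all add: mat_adjoint_index[OF S] symp_J_mult_index[OF S'])
  also have "\<dots> = - \<i> * symp_form n (to_fun (col S' s)) (to_fun (col S r))"
    using r s carrier_matD[OF S] carrier_matD[OF S']
    by (simp add: symp_form_def to_fun_def sum_distrib_left sum_negf[symmetric]) (intro sum.cong refl, simp)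
  finally show ?thesis .
qed

text \<open>In both parities \<open>block_eps\<close> and the power of \<open>\<i>\<close> from the
  rescaling combine to a real sign: this is how the index \<open>\<beta>\<close> becomes
  \<open>\<kappa>\<close>.\<close>

lemma block_eps_power: "- (\<i> ^ k * block_eps k \<beta>) = (-1) ^ (k + 1) * of_int \<beta>"
proof (cases "even k")
  case True
  then obtain m where "k = 2 * m" by (rule evenE)
  then show ?thesis by (simp add: block_eps_def power_mult flip: power_mult_distrib)
next
  case False
  then obtain m where m: "k = 2 * m + 1" by (rule oddE)
  have a: "- (\<i> * x * (x * \<i> * b)) = x * x * b" for x b :: complex
  proof -
    have "\<i> * x * (x * \<i> * b) = (\<i> * \<i>) * (x * x * b)" by (simp only: mult_ac)
    then show ?thesis by simp
  qed
  have "(-1) ^ m * (-1) ^ m = (1 :: complex)" by (simp flip: power_mult_distrib)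
  then show ?thesis using a[of "(-1) ^ m" "of_int \<beta>"] by (simp add: m block_eps_def power_mult)
qed

lemma mat_eq_iff_entries:
  "A \<in> carrier_mat k l \<Longrightarrow> B \<in> carrier_mat k l \<Longrightarrow> A = B \<longleftrightarrow> (\<forall>i<k. \<forall>j<l. A $$ (i, j) = B $$ (i, j))"
  by (auto intro!: eq_matI)

lemma mat_eq_iff_cols:
  assumes "A \<in> carrier_mat k l" "B \<in> carrier_mat k l"
  shows "A = B \<longleftrightarrow> (\<forall>j<l. col A j = col B j)"
proof
  assume "\<forall>j<l. col A j = col B j"
  then show "A = B" using assms by (intro mat_col_eqI) auto
qed simp

text \<open>The normalised chain vectors \<open>i\<^sup>j c\<^sub>j\<close> turn the relations of the Jordan chain \<open>c\<^sub>0, c\<^sub>1, \<dots>\<close>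
  of \<open>R\<close> into those of a Jordan chain of \<open>- i R\<close>.\<close>

lemma jordan_equation_iff:
  assumes R: "R \<in> carrier_mat (2 * n) (2 * n)" and S: "S \<in> carrier_mat (2 * n) k"
    and e: "\<And>j. j < k \<Longrightarrow> e j = cscale (\<i> ^ j) (to_fun (col S j))"
  shows "R * S = S * jordan_block k (Complex 0 \<omega>) \<longleftrightarrow>
    (\<forall>j<k. mat_op n R (e j) = cscale (of_real \<omega>) (e j) + (if j = 0 then 0 else e (j - 1)))"
proof -
  let ?B = "jordan_block k (Complex 0 \<omega>)"
  have c: "col S j \<in> carrier_vec (2 * n)" for j using S by (intro carrier_vecI) simp
  have SB: "S * ?B \<in> carrier_mat (2 * n) k" and RS: "R * S \<in> carrier_mat (2 * n) k"
    using R S by auto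
  have ent: "(S * ?B) $$ (r, j) = Complex 0 \<omega> * S $$ (r, j) + (if j = 0 then 0 else S $$ (r, j - 1))"
    if r: "r < 2 * n" and j: "j < k" for r j
  proof -
    have "(S * ?B) $$ (r, j) = (\<Sum>i<k. S $$ (r, i) * ?B $$ (i, j))"
      using r j S by (simp add: scalar_prod_def atLeast0LessThan)
    also have "\<dots> = (\<Sum>i<k. (if i = j then Complex 0 \<omega> * S $$ (r, j) else 0)
        + (if i = j - 1 then (if j = 0 then 0 else S $$ (r, j - 1)) else 0))"
      using j by (intro sum.cong refl) auto
    finally show ?thesis using j by (simp add: sum.distrib)
  qed
  have "R * S = S * ?B \<longleftrightarrow> (\<forall>j<k. col (R * S) j = col (S * ?B) j)" by (rule mat_eq_iff_cols[OF RS SB])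
  also have "\<dots> \<longleftrightarrow> (\<forall>j<k. mat_op n R (e j) = cscale (of_real \<omega>) (e j) + (if j = 0 then 0 else e (j - 1)))"
  proof (intro all_cong)
    fix j assume j: "j < k"
    have cB: "to_fun (col (S * ?B) j)
      = cscale (Complex 0 \<omega>) (to_fun (col S j)) + (if j = 0 then 0 else to_fun (col S (j - 1)))"
    proof
      fix r
      show "to_fun (col (S * ?B) j) r
        = (cscale (Complex 0 \<omega>) (to_fun (col S j)) + (if j = 0 then 0 else to_fun (col S (j - 1)))) r"
        using ent[of r j] j carrier_matD[OF S] by (auto simp: to_fun_def cscale_def)
    qed
    have "cscale (of_real \<omega>) (e j) + (if j = 0 then 0 else e (j - 1))
      = cscale (\<i> ^ j) (cscale (- \<i>) (to_fun (col (S * ?B) j)))"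
    proof (cases j)
      case 0
      show ?thesis
        unfolding cB e[OF j] unfolding 0 by (rule ext) (simp add: cscale_def Complex_eq algebra_simps)
    next
      case (Suc m)
      then have m: "m < k" "j - 1 = m" "j \<noteq> 0" using j by auto
      show ?thesis
        unfolding cB e[OF j] m(2) e[OF m(1)] using m(3) unfolding Suc
        by (intro ext) (simp add: cscale_def Complex_eq algebra_simps)
    qed
    moreover have "mat_op n R (e j) = cscale (\<i> ^ j) (cscale (- \<i>) (to_fun (col (R * S) j)))"
      unfolding col_mult2[OF R S j] e[OF j] sf.lin_simps(4)[OF mat_op_lin] mat_op_to_fun[OF R c] ..
    ultimately have "mat_op n R (e j) = cscale (of_real \<omega>) (e j) + (if j = 0 then 0 else e (j - 1))
      \<longleftrightarrow> cscale (\<i> ^ j) (cscale (- \<i>) (to_fun (col (R * S) j)))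
        = cscale (\<i> ^ j) (cscale (- \<i>) (to_fun (col (S * ?B) j)))" by simp
    also have "\<dots> \<longleftrightarrow> to_fun (col (R * S) j) = to_fun (col (S * ?B) j)"
      by (simp only: sf.scale_cancel_left) simp
    also have "\<dots> \<longleftrightarrow> col (R * S) j = col (S * ?B) j"
      by (rule to_fun_inject; intro carrier_vecI) (use carrier_matD[OF RS] carrier_matD[OF SB] in simp_all)
    finally show "col (R * S) j = col (S * ?B) j \<longleftrightarrow>
      mat_op n R (e j) = cscale (of_real \<omega>) (e j) + (if j = 0 then 0 else e (j - 1))" by simp
  qed
  finally show ?thesis .
qed

lemma symp_form_chain_entry:
  assumes S: "S \<in> carrier_mat (2 * n) k" and S': "S' \<in> carrier_mat (2 * n) k'" and i: "i < k" and j: "j < k'"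
    and e: "e = cscale (\<i> ^ i) (to_fun (col S i))" and e': "e' = cscale (\<i> ^ j) (to_fun (col S' j))"
  shows "symp_form n e e' = \<i> ^ i * (- \<i>) ^ j * \<i> * (mat_adjoint S' * symp_J n * S) $$ (j, i)"
  unfolding adjoint_symp_J_index[OF S' S j i] e e'
  by (simp add: sf.h_scale_left sf.h_scale_right mult_ac)

text \<open>The rescaling absorbs the alternating signs of \<open>alt_flip_mat\<close>: the
  conjugated factor \<open>(- \<i>) ^ j\<close> times \<open>(-1) ^ j\<close> is
  \<open>\<i> ^ j\<close>, so every nonzero entry carries the same power
  \<open>\<i> ^ k\<close>.\<close>

lemma gram_equation_iff:
  assumes S: "S \<in> carrier_mat (2 * n) k"
    and e: "\<And>j. j < k \<Longrightarrow> e j = cscale (\<i> ^ j) (to_fun (col S j))"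
    and \<kappa>: "\<kappa> = (-1) ^ (k + 1) * of_int \<beta>"
  shows "mat_adjoint S * symp_J n * S = block_eps k \<beta> \<cdot>\<^sub>m alt_flip_mat k \<longleftrightarrow>
    (\<forall>i<k. \<forall>j<k. symp_form n (e i) (e j) = (if i + j + 1 = k then \<kappa> else 0))"
proof -
  have J: "symp_J n \<in> carrier_mat (2 * n) (2 * n)"
    unfolding symp_J_def mult_2 by (intro four_block_carrier_mat) auto
  have "mat_adjoint S * symp_J n * S = block_eps k \<beta> \<cdot>\<^sub>m alt_flip_mat k \<longleftrightarrow>
    (\<forall>j<k. \<forall>i<k. (mat_adjoint S * symp_J n * S) $$ (j, i) = (block_eps k \<beta> \<cdot>\<^sub>m alt_flip_mat k) $$ (j, i))"
    by (rule mat_eq_iff_entries)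
      (auto simp: alt_flip_mat_def intro!: mult_carrier_mat[OF _ S] mult_carrier_mat[OF mat_adjoint_carrier[OF S] J])
  also have "\<dots> \<longleftrightarrow> (\<forall>j<k. \<forall>i<k. symp_form n (e i) (e j) = (if i + j + 1 = k then \<kappa> else 0))"
  proof (intro all_cong)
    fix i j assume i: "i < k" and j: "j < k"
    let ?m = "(mat_adjoint S * symp_J n * S) $$ (j, i)"
    have nz: "\<i> ^ i * (- \<i>) ^ j * \<i> \<noteq> 0" by simp
    have x: "symp_form n (e i) (e j) = \<i> ^ i * (- \<i>) ^ j * \<i> * ?m"
      by (rule symp_form_chain_entry[OF S S i j e[OF i] e[OF j]])
    have y: "\<i> ^ i * (- \<i>) ^ j * \<i> * (block_eps k \<beta> \<cdot>\<^sub>m alt_flip_mat k) $$ (j, i)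
      = (if i + j + 1 = k then \<kappa> else 0)"
    proof (cases "i + j + 1 = k")
      case True
      have m: "(- \<i>) ^ j * (-1) ^ j = \<i> ^ j" by (simp flip: power_mult_distrib)
      have "\<i> ^ i * (- \<i>) ^ j * \<i> * (block_eps k \<beta> * (-1) ^ (j + 1))
          = - (\<i> ^ i * ((- \<i>) ^ j * (-1) ^ j) * \<i> * block_eps k \<beta>)"
        by (simp add: mult_ac)
      also have "\<dots> = - (\<i> ^ (i + j + 1) * block_eps k \<beta>)" unfolding m by (simp add: power_add)
      also have "\<dots> = \<kappa>" unfolding True \<kappa> by (rule block_eps_power)
      finally show ?thesis using True i j by (simp add: alt_flip_mat_def add.commute)
    qed (use i j in \<open>simp add: alt_flip_mat_def add.commute\<close>)
    show "?m = (block_eps k \<beta> \<cdot>\<^sub>m alt_flip_mat k) $$ (j, i)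
      \<longleftrightarrow> symp_form n (e i) (e j) = (if i + j + 1 = k then \<kappa> else 0)"
      unfolding x y[symmetric] using nz by (simp only: mult_cancel_left) simp
  qed
  finally show ?thesis by blast
qed

lemma orthogonality_equation_iff:
  assumes S: "S \<in> carrier_mat (2 * n) k" and S': "S' \<in> carrier_mat (2 * n) k'"
    and e: "\<And>j. j < k \<Longrightarrow> e j = cscale (\<i> ^ j) (to_fun (col S j))"
    and e': "\<And>j. j < k' \<Longrightarrow> e' j = cscale (\<i> ^ j) (to_fun (col S' j))"
  shows "mat_adjoint S' * symp_J n * S = 0\<^sub>m (dim_col S') (dim_col S) \<longleftrightarrow>
    (\<forall>i<k. \<forall>j<k'. symp_form n (e i) (e' j) = 0)"
proof -
  have J: "symp_J n \<in> carrier_mat (2 * n) (2 * n)"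
    unfolding symp_J_def mult_2 by (intro four_block_carrier_mat) auto
  have d: "dim_col S' = k'" "dim_col S = k" using S S' by auto
  have "mat_adjoint S' * symp_J n * S = 0\<^sub>m (dim_col S') (dim_col S) \<longleftrightarrow>
    (\<forall>j<k'. \<forall>i<k. (mat_adjoint S' * symp_J n * S) $$ (j, i) = 0\<^sub>m k' k $$ (j, i))"
    unfolding d by (rule mat_eq_iff_entries)
      (auto intro!: mult_carrier_mat[OF _ S] mult_carrier_mat[OF mat_adjoint_carrier[OF S'] J])
  also have "\<dots> \<longleftrightarrow> (\<forall>j<k'. \<forall>i<k. symp_form n (e i) (e' j) = 0)"
    using symp_form_chain_entry[OF S S' _ _ e e'] by (intro all_cong) simp
  finally show ?thesis by blast
qed

lemma distinct_concat_map_upt: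
  assumes "inj_on (\<lambda>(b, j). f b j) (SIGMA b:{..<N}. {..<k b})"
  shows "distinct (concat (map (\<lambda>b. map (f b) [0..<k b]) [0..<N]))"
  using assms
proof (induction N)
  case (Suc N)
  have inj: "b = b' \<and> j = j'" if "f b j = f b' j'" "b < Suc N" "j < k b" "b' < Suc N" "j' < k b'" for b j b' j'
    using inj_onD[OF Suc.prems, of "(b, j)" "(b', j')"] that by simp
  have "inj_on (\<lambda>(b, j). f b j) (SIGMA b:{..<N}. {..<k b})"
    by (rule inj_on_subset[OF Suc.prems]) auto
  moreover have "inj_on (f N) (set [0..<k N])" using inj[of N _ N] by (intro inj_onI) simp
  moreover have "set (concat (map (\<lambda>b. map (f b) [0..<k b]) [0..<N])) \<inter> set (map (f N) [0..<k N]) = {}"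
  proof -
    have "f N j' \<noteq> f b j" if "b < N" "j < k b" "j' < k N" for b j j'
      using inj[of N j' b j] that by auto
    then show ?thesis by auto
  qed
  ultimately show ?case using Suc.IH by (simp add: distinct_map)
qed simp

lemma set_concat_map_cols:
  assumes "\<And>b. b < length Ss \<Longrightarrow> dim_col (Ss ! b) = k b"
  shows "set (concat (map cols Ss)) = (\<lambda>(b, j). col (Ss ! b) j) ` (SIGMA b:{..<length Ss}. {..<k b})"
proof -
  have "set (concat (map cols Ss)) = (\<Union>b<length Ss. set (cols (Ss ! b)))"
    by (auto simp: set_conv_nth[of Ss])
  also have "\<dots> = (\<Union>b<length Ss. col (Ss ! b) ` {..<k b})"
    using assms by (intro SUP_cong refl) (auto simp: cols_def)
  also have "\<dots> = (\<lambda>(b, j). col (Ss ! b) j) ` (SIGMA b:{..<length Ss}. {..<k b})" by force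
  finally show ?thesis .
qed

lemma span_rescaled_family:
  assumes "\<And>p. p \<in> C \<Longrightarrow> e p = cscale (c p) (f p)" "\<And>p. p \<in> C \<Longrightarrow> c p \<noteq> 0"
  shows "sf.span (e ` C) = sf.span (f ` C)"
proof
  have "e ` C \<subseteq> sf.span (f ` C)"
    using assms(1) by (auto intro!: sf.span_scale intro: sf.span_base)
  then show "sf.span (e ` C) \<subseteq> sf.span (f ` C)" by (rule sf.span_minimal) simp
  have "f p = cscale (1 / c p) (e p)" if "p \<in> C" for p using assms[OF that] by simp
  then have "f ` C \<subseteq> sf.span (e ` C)" by (auto intro!: sf.span_scale intro: sf.span_base)
  then show "sf.span (f ` C) \<subseteq> sf.span (e ` C)" by (rule sf.span_minimal) simp
qed

section \<open>Passage between indexed Jordan bases and families of chains\<close>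

context
  fixes n :: nat and R :: "complex mat"
  assumes R: "hamiltonian_entries n R"
begin

lemma R_carrier: "R \<in> carrier_mat (2 * n) (2 * n)"
  using R by (simp add: hamiltonian_entries_def)

text \<open>Applies to whichever basis the choice operator refers to. A real eigenvector in the
  complement corresponds to a root vector, so by the spanning condition it lies in the span of the
  chains; being orthogonal to them, it is 0.\<close>

lemma jordan_family_of_indexed_jordan_basis:
  assumes I: "indexed_jordan_basis n R bs Ss"
  defines "N \<equiv> length bs" and "w \<equiv> \<lambda>b. fst (bs ! b)" and "k \<equiv> \<lambda>b. fst (snd (bs ! b))"
    and "\<beta> \<equiv> \<lambda>b. snd (snd (bs ! b))" and "e \<equiv> \<lambda>b j. cscale (\<i> ^ j) (to_fun (col (Ss ! b) j))"
  shows "sf.jordan_family n (mat_op n R) (fun_space (2 * n)) N w k (\<lambda>b. (-1) ^ (k b + 1) * of_int (\<beta> b)) e"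
    and "sf.no_real (mat_op n R) (sf.perp n (SIGMA b:{..<N}. {..<k b}) (case_prod e) (fun_space (2 * n)))"
    and "\<And>b. b < N \<Longrightarrow> \<beta> b \<in> {-1, 1}"
proof -
  let ?C = "SIGMA b:{..<N}. {..<k b}"
  let ?\<kappa> = "\<lambda>b. (-1) ^ (k b + 1) * of_int (\<beta> b) :: complex"
  have len: "length Ss = N"
    and blk: "\<forall>j < length bs. case bs ! j of (\<omega>, k, \<beta>) \<Rightarrow>
        k > 0 \<and> \<beta> \<in> {-1, 1} \<and> Ss ! j \<in> carrier_mat (2 * n) k \<and>
        R * Ss ! j = Ss ! j * jordan_block k (Complex 0 \<omega>) \<and>
        mat_adjoint (Ss ! j) * symp_J n * Ss ! j = block_eps k \<beta> \<cdot>\<^sub>m alt_flip_mat k"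
    and ort: "\<forall>i < length bs. \<forall>j < length bs. i \<noteq> j \<longrightarrow>
        mat_adjoint (Ss ! i) * symp_J n * Ss ! j = 0\<^sub>m (dim_col (Ss ! i)) (dim_col (Ss ! j))"
    and sp: "vspan (2 * n) (set (concat (map cols Ss))) = imag_root_space R"
    using I unfolding indexed_jordan_basis_def N_def by (simp_all add: Let_def)
  have b: "k b > 0" "\<beta> b \<in> {-1, 1}" "Ss ! b \<in> carrier_mat (2 * n) (k b)"
    "R * Ss ! b = Ss ! b * jordan_block (k b) (Complex 0 (w b))"
    "mat_adjoint (Ss ! b) * symp_J n * Ss ! b = block_eps (k b) (\<beta> b) \<cdot>\<^sub>m alt_flip_mat (k b)" if "b < N" for b
    using blk[rule_format, of b] that by (simp_all add: N_def w_def k_def \<beta>_def split_beta)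
  show "\<And>b. b < N \<Longrightarrow> \<beta> b \<in> {-1, 1}" by (rule b(2))
  have eV: "e b j \<in> fun_space (2 * n)" if "b < N" for b j
  proof -
    have "col (Ss ! b) j \<in> carrier_vec (2 * n)" using b(3)[OF that] by (intro carrier_vecI) simp
    then show ?thesis unfolding e_def by (intro sf.subspace_scale[OF subspace_fun_space] to_fun_in)
  qed
  have chain: "mat_op n R (e b j) = cscale (of_real (w b)) (e b j) + (if j = 0 then 0 else e b (j - 1))"
    if "b < N" "j < k b" for b j
    using jordan_equation_iff[OF R_carrier b(3)[OF that(1)], of "e b" "w b"] b(4)[OF that(1)] that(2)
    by (simp add: e_def)
  have gram: "symp_form n (e b i) (e b' j) = (if b = b' \<and> i + j + 1 = k b then ?\<kappa> b else 0)"
    if B: "b < N" "b' < N" "i < k b" "j < k b'" for b b' i j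
  proof (cases "b = b'")
    case True
    then show ?thesis
      using gram_equation_iff[OF b(3)[OF B(1)], of "e b" "?\<kappa> b" "\<beta> b"] b(5)[OF B(1)] B
      by (simp add: e_def)
  next
    case False
    then show ?thesis
      using orthogonality_equation_iff[OF b(3)[OF B(1)] b(3)[OF B(2)], of "e b" "e b'"]
        ort[rule_format, of b' b] B by (simp add: e_def N_def)
  qed
  have "?\<kappa> b \<in> {1, -1}" if "b < N" for b
    using b(2)[OF that] by (cases "even (k b)") auto
  then show J: "sf.jordan_family n (mat_op n R) (fun_space (2 * n)) N w k ?\<kappa> e"
    unfolding sf.jordan_family_def using b(1) eV chain gram by simp
  have X: "set (concat (map cols Ss)) = (\<lambda>(b, j). col (Ss ! b) j) ` ?C"
    unfolding len[symmetric] by (rule set_concat_map_cols) (use b(3) len in auto)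
  have Xc: "set (concat (map cols Ss)) \<subseteq> carrier_vec (2 * n)"
  proof -
    have "col (Ss ! b) j \<in> carrier_vec (2 * n)" if "b < N" for b j
      using b(3)[OF that] by (intro carrier_vecI) simp
    then show ?thesis unfolding X by auto
  qed
  have se: "sf.span (case_prod e ` ?C) = sf.span (to_fun ` set (concat (map cols Ss)))"
    unfolding X image_image
    by (rule span_rescaled_family[where c = "\<lambda>(b, j). \<i> ^ j"]) (auto simp: e_def)
  show "sf.no_real (mat_op n R) (sf.perp n ?C (case_prod e) (fun_space (2 * n)))"
    unfolding sf.no_real_def
  proof (intro ballI allI impI)
    fix x and \<mu> :: real
    assume x: "x \<in> sf.perp n ?C (case_prod e) (fun_space (2 * n))"
      and Tx: "mat_op n R x = cscale (of_real \<mu>) x"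
    have xV: "x \<in> fun_space (2 * n)" and x0: "\<And>p. p \<in> ?C \<Longrightarrow> symp_form n x (case_prod e p) = 0"
      using x unfolding sf.perp_def by blast+
    define v where "v = vec (2 * n) x"
    have v: "v \<in> carrier_vec (2 * n)" "to_fun v = x" using xV by (simp_all add: v_def to_fun_vec)
    have "((\<lambda>x. mat_op n R x - cscale (of_real \<mu>) x) ^^ 1) (to_fun v) = 0" using Tx v(2) by simp
    then have "v \<in> root_subspace R (Complex 0 \<mu>)"
      unfolding root_subspace_iff_to_fun[OF R_carrier v(1)] by (rule exI)
    moreover have "(\<Union>\<omega>::real. root_subspace R (Complex 0 \<omega>)) \<subseteq> imag_root_space R"
    proof -
      interpret vs: vec_space "TYPE(complex)" "2 * n" .
      have "(\<Union>\<omega>::real. root_subspace R (Complex 0 \<omega>)) \<subseteq> carrier_vec (2 * n)"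
        using R_carrier by (auto simp: root_subspace_def)
      then show ?thesis
        unfolding imag_root_space_def using vs.in_own_span R_carrier by simp
    qed
    ultimately have "v \<in> vspan (2 * n) (set (concat (map cols Ss)))" unfolding sp by blast
    then have "x \<in> sf.span (case_prod e ` ?C)"
      unfolding span_iff_to_fun[OF Xc] se v(2) by simp
    then show "x = 0"
      by (rule sf.gram_system_span_perp[OF sf.jordan_family_gram_system[OF J]]) (rule x0)
  qed
qed

text \<open>Multiplying by powers of \<open>- \<i>\<close> undoes the rescaling. For the span, chain
  vectors are root vectors, and conversely \<open>root_vector_in_chain_span\<close> applies.\<close>

lemma indexed_jordan_basis_of_jordan_family:
  assumes J: "sf.jordan_family n (mat_op n R) (fun_space (2 * n)) N w k \<kappa> e"
    and nr: "sf.no_real (mat_op n R) (sf.perp n (SIGMA b:{..<N}. {..<k b}) (case_prod e) (fun_space (2 * n)))"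
  shows "\<exists>bs Ss. indexed_jordan_basis n R bs Ss"
proof -
  let ?C = "SIGMA b:{..<N}. {..<k b}"
  note JD = sf.jordan_familyD[OF J]
  define \<beta> :: "nat \<Rightarrow> int" where "\<beta> b = (if \<kappa> b = (-1) ^ (k b + 1) then 1 else -1)" for b
  have \<kappa>: "\<kappa> b = (-1) ^ (k b + 1) * of_int (\<beta> b)" if "b < N" for b
    using JD(2)[OF that] by (cases "even (k b)") (auto simp: \<beta>_def)
  define S where "S b = mat (2 * n) (k b) (\<lambda>(r, j). (- \<i>) ^ j * e b j r)" for b
  have S: "S b \<in> carrier_mat (2 * n) (k b)" for b by (simp add: S_def)
  have colS: "to_fun (col (S b) j) = cscale ((- \<i>) ^ j) (e b j)" if "b < N" "j < k b" for b j
    using JD(3)[OF that] that(2) by (intro ext) (auto simp: to_fun_def S_def cscale_def fun_space_def)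
  have e: "e b j = cscale (\<i> ^ j) (to_fun (col (S b) j))" if "b < N" "j < k b" for b j
  proof -
    have "\<i> ^ j * (- \<i>) ^ j = 1" by (simp flip: power_mult_distrib)
    then show ?thesis unfolding colS[OF that] by simp
  qed
  define bs where "bs = map (\<lambda>b. (w b, k b, \<beta> b)) [0..<N]"
  define Ss where "Ss = map S [0..<N]"
  have len: "length bs = N" "length Ss = N" by (simp_all add: bs_def Ss_def)
  have nth: "bs ! b = (w b, k b, \<beta> b)" "Ss ! b = S b" if "b < N" for b
    using that by (simp_all add: bs_def Ss_def)
  have cs: "concat (map cols Ss) = concat (map (\<lambda>b. map (col (S b)) [0..<k b]) [0..<N])"
    unfolding Ss_def map_map by (intro arg_cong[of _ _ concat] map_cong refl) (simp add: cols_def S_def)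
  have X: "set (concat (map cols Ss)) = (\<lambda>(b, j). col (S b) j) ` ?C"
  proof -
    have "set (concat (map cols Ss)) = (\<lambda>(b, j). col (Ss ! b) j) ` (SIGMA b:{..<length Ss}. {..<k b})"
      by (rule set_concat_map_cols) (use nth(2) len(2) in \<open>simp add: S_def\<close>)
    also have "\<dots> = (\<lambda>(b, j). col (S b) j) ` ?C"
      unfolding len by (intro image_cong refl) (auto simp: nth(2))
    finally show ?thesis .
  qed
  have colc: "col (S b) j \<in> carrier_vec (2 * n)" for b j using S[of b] by (intro carrier_vecI) simp
  have Xc: "set (concat (map cols Ss)) \<subseteq> carrier_vec (2 * n)" unfolding X using colc by auto
  let ?f = "\<lambda>p. to_fun ((\<lambda>(b, j). col (S b) j) p)"
  have se: "sf.span (case_prod e ` ?C) = sf.span (to_fun ` set (concat (map cols Ss)))"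
    unfolding X image_image
    by (rule span_rescaled_family[where c = "\<lambda>(b, j). \<i> ^ j"]) (auto simp: e)
  have "\<forall>c. (\<Sum>p\<in>?C. cscale (c p) (?f p)) = 0 \<longrightarrow> (\<forall>p\<in>?C. c p = 0)"
  proof (intro allI impI ballI)
    fix c p assume z: "(\<Sum>p\<in>?C. cscale (c p) (?f p)) = 0" and p: "p \<in> ?C"
    have "(\<Sum>p\<in>?C. cscale (c p) (?f p)) = (\<Sum>p\<in>?C. cscale (c p * (- \<i>) ^ snd p) (case_prod e p))"
      by (intro sum.cong refl) (auto simp: colS)
    then have "c p * (- \<i>) ^ snd p = 0"
      using sf.gram_system_indep[OF sf.jordan_family_gram_system[OF J] _ p, of "\<lambda>p. c p * (- \<i>) ^ snd p"] z
      by simp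
    then show "c p = 0" by simp
  qed
  note fi = sf.family_independent[OF _ this]
  have finC: "finite ?C" by simp
  have inj: "inj_on (\<lambda>(b, j). col (S b) j) ?C"
    using fi(1)[OF finC] by (intro inj_on_imageI2[of to_fun]) (simp add: o_def)
  have "sf.independent (to_fun ` set (concat (map cols Ss)))"
    unfolding X image_image by (rule fi(2)[OF finC])
  then have ind: "\<not> vlin_dep (2 * n) (set (concat (map cols Ss)))" by (rule lin_indpt_to_fun[OF Xc])
  let ?U = "\<Union>\<omega>::real. root_subspace R (Complex 0 \<omega>)"
  have Uc: "?U \<subseteq> carrier_vec (2 * n)" using R_carrier by (auto simp: root_subspace_def)
  have dR: "dim_row R = 2 * n" using R_carrier by simp
  have "vspan (2 * n) (set (concat (map cols Ss))) = vspan (2 * n) ?U"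
  proof
    interpret vs: vec_space "TYPE(complex)" "2 * n" .
    have "set (concat (map cols Ss)) \<subseteq> ?U"
    proof -
      have "col (S b) j \<in> root_subspace R (Complex 0 (w b))" if b: "b < N" "j < k b" for b j
      proof -
        let ?S = "\<lambda>x. mat_op n R x - cscale (of_real (w b)) x"
        note l = sf.sa_space_shift(1)[OF hamiltonian_sa_space[OF R], of ?S "w b", OF refl]
        have "(?S ^^ Suc j) (e b j) = 0" by (rule sf.jordan_chain_root_vector[OF J b refl l])
        then have "(?S ^^ Suc j) (to_fun (col (S b) j)) = 0"
          unfolding colS[OF b] sf.lin_simps(4)[OF sf.lin_funpow[OF l]] by (simp only: sf.scale_zero_right)
        then show ?thesis unfolding root_subspace_iff_to_fun[OF R_carrier colc] by (rule exI)
      qed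
      then show ?thesis unfolding X by auto
    qed
    then show "vspan (2 * n) (set (concat (map cols Ss))) \<subseteq> vspan (2 * n) ?U" by (rule vs.span_is_monotone)
    have "to_fun ` ?U \<subseteq> sf.span (to_fun ` set (concat (map cols Ss)))"
    proof clarify
      fix u and \<omega> :: real assume u: "u \<in> root_subspace R (Complex 0 \<omega>)"
      have uc: "u \<in> carrier_vec (2 * n)" using u Uc by blast
      obtain K where K: "((\<lambda>x. mat_op n R x - cscale (of_real \<omega>) x) ^^ K) (to_fun u) = 0"
        using u unfolding root_subspace_iff_to_fun[OF R_carrier uc] by (rule exE)
      show "to_fun u \<in> sf.span (to_fun ` set (concat (map cols Ss)))"
        unfolding se[symmetric]
        by (rule sf.root_vector_in_chain_span[OF hamiltonian_sa_space[OF R] J nr refl to_fun_in[OF uc] K])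
    qed
    then have "sf.span (to_fun ` ?U) \<subseteq> sf.span (to_fun ` set (concat (map cols Ss)))"
      by (rule sf.span_minimal) simp
    then show "vspan (2 * n) ?U \<subseteq> vspan (2 * n) (set (concat (map cols Ss)))"
      using span_iff_to_fun[OF Uc] span_iff_to_fun[OF Xc] by blast
  qed
  then have sp: "vspan (2 * n) (set (concat (map cols Ss))) = imag_root_space R"
    by (simp add: imag_root_space_def dR)
  have "indexed_jordan_basis n R bs Ss"
    unfolding indexed_jordan_basis_def Let_def len
  proof (intro conjI allI impI)
    fix b assume b: "b < N"
    have "R * S b = S b * jordan_block (k b) (Complex 0 (w b))"
      using jordan_equation_iff[OF R_carrier S, of b "e b" "w b"] e[OF b] JD(4)[OF b] by simp
    moreover have "mat_adjoint (S b) * symp_J n * S b = block_eps (k b) (\<beta> b) \<cdot>\<^sub>m alt_flip_mat (k b)"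
      using gram_equation_iff[OF S, of b "e b" "\<kappa> b" "\<beta> b"] e[OF b] \<kappa>[OF b] JD(5)[OF b b] by simp
    moreover have "\<beta> b \<in> {-1, 1}" by (simp add: \<beta>_def)
    ultimately show "case bs ! b of (\<omega>, k, \<beta>) \<Rightarrow>
        k > 0 \<and> \<beta> \<in> {-1, 1} \<and> Ss ! b \<in> carrier_mat (2 * n) k \<and>
        R * Ss ! b = Ss ! b * jordan_block k (Complex 0 \<omega>) \<and>
        mat_adjoint (Ss ! b) * symp_J n * Ss ! b = block_eps k \<beta> \<cdot>\<^sub>m alt_flip_mat k"
      using JD(1)[OF b] S nth[OF b] by simp
  next
    fix b b' assume b: "b < N" "b' < N" "b \<noteq> b'"
    have "\<forall>i<k b'. \<forall>j<k b. symp_form n (e b' i) (e b j) = 0"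
      using JD(5)[OF b(2,1)] b(3) by simp
    then show "mat_adjoint (Ss ! b) * symp_J n * Ss ! b' = 0\<^sub>m (dim_col (Ss ! b)) (dim_col (Ss ! b'))"
      unfolding nth(2)[OF b(1)] nth(2)[OF b(2)]
      using orthogonality_equation_iff[OF S S, of b' "e b'" b "e b"] e[OF b(1)] e[OF b(2)] by simp
  next
    show "distinct (concat (map cols Ss))"
      unfolding cs by (rule distinct_concat_map_upt[OF inj])
  next
    show "N = N" by (rule refl)
    show "\<not> vlin_dep (2 * n) (set (concat (map cols Ss)))" by (rule ind)
    show "vspan (2 * n) (set (concat (map cols Ss))) = imag_root_space R" by (rule sp)
  qed
  then show ?thesis by metis
qed

text \<open>Existence of a basis guarantees that the chosen multiset comes from one, and that basis
  supplies the family; then \<open>s_count\<close> and \<open>block_count\<close> are compared block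
  by block.\<close>

lemma indexed_blocks_jordan_family:
  obtains N w k \<kappa> e where
    "sf.jordan_family n (mat_op n R) (fun_space (2 * n)) N w k \<kappa> e"
    "sf.no_real (mat_op n R) (sf.perp n (SIGMA b:{..<N}. {..<k b}) (case_prod e) (fun_space (2 * n)))"
    "\<forall>t. s_count n R t = block_count N w k \<kappa> t"
proof -
  obtain N0 w0 k0 \<kappa>0 e0 where
    "sf.jordan_family n (mat_op n R) (fun_space (2 * n)) N0 w0 k0 \<kappa>0 e0"
    "sf.no_real (mat_op n R) (sf.perp n (SIGMA b:{..<N0}. {..<k0 b}) (case_prod e0) (fun_space (2 * n)))"
    using sf.jordan_family_exists[OF hamiltonian_sa_space[OF R]] by metis
  then obtain bs0 Ss0 where "indexed_jordan_basis n R bs0 Ss0"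
    using indexed_jordan_basis_of_jordan_family by metis
  then have "\<exists>M bs Ss. indexed_jordan_basis n R bs Ss \<and> M = mset bs" by metis
  then have "\<exists>bs Ss. indexed_jordan_basis n R bs Ss \<and> indexed_blocks n R = mset bs"
    unfolding indexed_blocks_def by (rule someI_ex)
  then obtain bs Ss where I: "indexed_jordan_basis n R bs Ss" and M: "indexed_blocks n R = mset bs" by metis
  define N where "N = length bs"
  define w where "w b = fst (bs ! b)" for b
  define k where "k b = fst (snd (bs ! b))" for b
  define \<beta> where "\<beta> b = snd (snd (bs ! b))" for b
  define \<kappa> :: "nat \<Rightarrow> complex" where "\<kappa> b = (-1) ^ (k b + 1) * of_int (\<beta> b)" for b
  define e where "e b j = cscale (\<i> ^ j) (to_fun (col (Ss ! b) j))" for b j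
  note defs = N_def w_def[abs_def] k_def[abs_def] \<beta>_def[abs_def] \<kappa>_def[abs_def] e_def[abs_def]
  have J: "sf.jordan_family n (mat_op n R) (fun_space (2 * n)) N w k \<kappa> e"
    unfolding defs by (rule jordan_family_of_indexed_jordan_basis(1)[OF I])
  have nr: "sf.no_real (mat_op n R) (sf.perp n (SIGMA b:{..<N}. {..<k b}) (case_prod e) (fun_space (2 * n)))"
    unfolding defs by (rule jordan_family_of_indexed_jordan_basis(2)[OF I])
  have \<beta>: "\<beta> b \<in> {-1, 1}" if "b < N" for b
    using that unfolding defs by (rule jordan_family_of_indexed_jordan_basis(3)[OF I])
  have size: "int (size (filter_mset P (mset bs))) = (\<Sum>b<N. of_bool (P (bs ! b)))" for P
  proof -
    have "size (filter_mset P (mset bs)) = length (filter P bs)" by (metis mset_filter size_mset)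
    also have "\<dots> = card {b \<in> {..<N}. P (bs ! b)}" by (simp add: length_filter_conv_card N_def)
    finally show ?thesis by (simp add: of_bool_def sum.If_cases Int_def)
  qed
  have "s_count n R t = block_count N w k \<kappa> t" for t
  proof -
    have "s_count n R t = (\<Sum>b<N. of_bool (odd (k b) \<and> w b < t \<and> \<beta> b = 1)
      - of_bool (odd (k b) \<and> w b \<le> t \<and> \<beta> b = -1) - of_bool (even (k b) \<and> w b = t \<and> \<beta> b = -1))"
      unfolding s_count_def m_plus_def m_minus_def m_zero_def M size
      by (simp add: sum_subtractf split_beta w_def k_def \<beta>_def)
    \<comment> \<open>For odd size \<open>\<kappa> b\<close> is the index. For even size and index
      \<open>- 1\<close> both indicators on the right are active, and their difference is
      \<open>- 1\<close> exactly at \<open>w b = t\<close>.\<close>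
    also have "\<dots> = (\<Sum>b<N. of_bool (\<kappa> b = 1 \<and> w b < t) - of_bool (\<kappa> b = (-1) ^ k b \<and> w b \<le> t))"
    proof (intro sum.cong refl)
      fix b assume "b \<in> {..<N}"
      then have "\<beta> b = 1 \<or> \<beta> b = -1" using \<beta>[of b] by auto
      then show "of_bool (odd (k b) \<and> w b < t \<and> \<beta> b = 1) - of_bool (odd (k b) \<and> w b \<le> t \<and> \<beta> b = -1)
          - of_bool (even (k b) \<and> w b = t \<and> \<beta> b = -1)
        = (of_bool (\<kappa> b = 1 \<and> w b < t) - of_bool (\<kappa> b = (-1) ^ k b \<and> w b \<le> t) :: int)"
        by (cases "even (k b)") (auto simp: \<kappa>_def)
    qed
    also have "\<dots> = block_count N w k \<kappa> t"
      by (simp add: block_count_def sum_subtractf of_bool_def sum.If_cases Int_def)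
    finally show ?thesis .
  qed
  then have "\<forall>t. s_count n R t = block_count N w k \<kappa> t" by simp
  with J nr show ?thesis by (rule that)
qed

end

lemma inv_mat_hermitian:
  assumes \<Gamma>: "\<Gamma> \<in> carrier_mat m m" "hermitian_mat \<Gamma>" "det \<Gamma> \<noteq> 0"
  shows "inv_mat \<Gamma> \<in> carrier_mat m m" "hermitian_mat (inv_mat \<Gamma>)"
proof -
  have U: "\<Gamma> \<in> Units (ring_mat TYPE(complex) m ())" by (rule det_non_zero_imp_unit[OF \<Gamma>(1,3)])
  then obtain I where I: "mat_inverse \<Gamma> = Some I"
    using mat_inverse(1)[OF \<Gamma>(1), where b = "()"] by (cases "mat_inverse \<Gamma>") auto
  then have inv: "\<Gamma> * I = 1\<^sub>m m" "I \<in> carrier_mat m m"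
    using mat_inverse(2)[OF \<Gamma>(1)] by auto
  have c: "I *\<^sub>v x \<in> carrier_vec m" "\<Gamma> *\<^sub>v (I *\<^sub>v x) = x" if x: "x \<in> carrier_vec m" for x
  proof -
    show "I *\<^sub>v x \<in> carrier_vec m" by (rule mult_mat_vec_carrier[OF inv(2) x])
    have "\<Gamma> *\<^sub>v (I *\<^sub>v x) = (\<Gamma> * I) *\<^sub>v x" by (rule assoc_mult_mat_vec[OF \<Gamma>(1) inv(2) x, symmetric])
    then show "\<Gamma> *\<^sub>v (I *\<^sub>v x) = x" unfolding inv(1) using x by simp
  qed
  have "hermitian_mat I"
  proof (rule hermitian_matI[OF inv(2)])
    fix x y :: "complex vec" assume x: "x \<in> carrier_vec m" and y: "y \<in> carrier_vec m"
    have "(I *\<^sub>v x) \<bullet>c y = (I *\<^sub>v x) \<bullet>c (\<Gamma> *\<^sub>v (I *\<^sub>v y))" unfolding c(2)[OF y] ..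
    also have "\<dots> = (\<Gamma> *\<^sub>v (I *\<^sub>v x)) \<bullet>c (I *\<^sub>v y)"
      by (rule hermitian_mat_swap[OF \<Gamma>(1,2) c(1)[OF x] c(1)[OF y], symmetric])
    also have "\<dots> = x \<bullet>c (I *\<^sub>v y)" unfolding c(2)[OF x] ..
    finally show "cnj ((I *\<^sub>v x) \<bullet>c y) = (I *\<^sub>v y) \<bullet>c x"
      using cscalar_prod_cnj[OF x c(1)[OF y]] by simp
  qed
  then show "inv_mat \<Gamma> \<in> carrier_mat m m" "hermitian_mat (inv_mat \<Gamma>)"
    using inv(2) I by (simp_all add: inv_mat_def)
qed

lemma congruence_hermitian:
  assumes B: "B \<in> carrier_mat n m" and K: "K \<in> carrier_mat m m" "hermitian_mat K"
  shows "hermitian_mat (B * K * mat_adjoint B)"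
proof -
  note Ba = mat_adjoint_carrier[OF B]
  note BK = mult_carrier_mat[OF B K(1)]
  show ?thesis
  proof (rule hermitian_matI[OF mult_carrier_mat[OF BK Ba]])
    fix x y :: "complex vec" assume x: "x \<in> carrier_vec n" and y: "y \<in> carrier_vec n"
    note Bx = mult_mat_vec_carrier[OF Ba x] and By = mult_mat_vec_carrier[OF Ba y]
    have e: "(B * K * mat_adjoint B) *\<^sub>v u = B *\<^sub>v (K *\<^sub>v (mat_adjoint B *\<^sub>v u))" if u: "u \<in> carrier_vec n" for u
      using assoc_mult_mat_vec[OF BK Ba u] assoc_mult_mat_vec[OF B K(1) mult_mat_vec_carrier[OF Ba u]] by simp
    have f: "((B * K * mat_adjoint B) *\<^sub>v u) \<bullet>c v = (K *\<^sub>v (mat_adjoint B *\<^sub>v u)) \<bullet>c (mat_adjoint B *\<^sub>v v)"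
      if u: "u \<in> carrier_vec n" and v: "v \<in> carrier_vec n" for u v
      unfolding e[OF u]
      by (rule mat_adjoint_cscalar_prod[OF B mult_mat_vec_carrier[OF K(1) mult_mat_vec_carrier[OF Ba u]] v])
    show "cnj (((B * K * mat_adjoint B) *\<^sub>v x) \<bullet>c y) = ((B * K * mat_adjoint B) *\<^sub>v y) \<bullet>c x"
      unfolding f[OF x y] f[OF y x] hermitian_mat_swap[OF K Bx By]
      by (rule cscalar_prod_cnj[OF Bx mult_mat_vec_carrier[OF K(1) By]])
  qed
qed

lemma (in riccati) solution_iff:
  "(\<exists>H\<in>carrier_mat n n. hermitian_mat H \<and> neg_definite (ric H)) \<longleftrightarrow> (\<forall>t. s_count n R t \<ge> 0)"
proof -
  note s = hamiltonian_sa_space[OF R_hamiltonian]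
  note B = fun_space_basis[of n]
  obtain N w k \<kappa> e where J: "sf.jordan_family n (mat_op n R) (fun_space (2 * n)) N w k \<kappa> e"
    and nr: "sf.no_real (mat_op n R) (sf.perp n (SIGMA b:{..<N}. {..<k b}) (case_prod e) (fun_space (2 * n)))"
    and cnt: "\<forall>t. s_count n R t = block_count N w k \<kappa> t"
    using indexed_blocks_jordan_family[OF R_hamiltonian] .
  show ?thesis
  proof
    assume "\<exists>H\<in>carrier_mat n n. hermitian_mat H \<and> neg_definite (ric H)"
    then obtain H where H: "H \<in> carrier_mat n n" "hermitian_mat H" "neg_definite (ric H)" by blast
    show "\<forall>t. s_count n R t \<ge> 0"
    proof (rule solution_family[OF H])
      fix l
      assume l: "\<And>i. i < n \<Longrightarrow> l i \<in> fun_space (2 * n)"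
        "\<And>i j. i < n \<Longrightarrow> j < n \<Longrightarrow> symp_form n (l i) (l j) = 0"
        "\<And>c i. i < n \<Longrightarrow> c i \<noteq> 0 \<Longrightarrow>
          Re (symp_form n (mat_op n R (\<Sum>i<n. cscale (c i) (l i))) (\<Sum>i<n. cscale (c i) (l i))) < 0"
      show "\<forall>t. s_count n R t \<ge> 0"
        unfolding cnt[rule_format] by (intro allI sf.block_count_nonneg[OF s B(4,1,2,3) J nr l])
    qed
  next
    assume "\<forall>t. s_count n R t \<ge> 0"
    then have pos: "block_count N w k \<kappa> t \<ge> 0" for t using cnt by simp
    show "\<exists>H\<in>carrier_mat n n. hermitian_mat H \<and> neg_definite (ric H)"
    proof (rule negative_definite_family[of n])
      fix g
      assume g: "\<And>i. i < n \<Longrightarrow> g i \<in> fun_space (2 * n)"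
        "\<And>c i. i < n \<Longrightarrow> c i \<noteq> 0 \<Longrightarrow>
          Re (symp_form n (\<Sum>i<n. cscale (c i) (g i)) (\<Sum>i<n. cscale (c i) (g i))) < 0"
      obtain l m where "\<forall>i<n. l i \<in> fun_space (2 * n)" "\<forall>i<n. \<forall>j<n. symp_form n (l i) (l j) = 0" "m > 0"
        "\<forall>c. Re (symp_form n (mat_op n R (\<Sum>i<n. cscale (c i) (l i))) (\<Sum>i<n. cscale (c i) (l i)))
          \<le> - m * (\<Sum>i<n. (cmod (c i))\<^sup>2)"
        using sf.negative_lagrangian_family[OF s B(4,1,2,3) J nr g pos] .
      then show ?thesis by (rule solution_of_lagrangian_family)
    qed
  qed
qed

theorem theorem5p5:
  fixes n m :: nat and A G B \<Gamma> :: "complex mat"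
  assumes "A \<in> carrier_mat n n" and "G \<in> carrier_mat n n"
    and "B \<in> carrier_mat n m" and "\<Gamma> \<in> carrier_mat m m"
    and "hermitian_mat G" and "hermitian_mat \<Gamma>" and "det \<Gamma> \<noteq> 0"
  shows "(\<exists>H \<in> carrier_mat n n. hermitian_mat H \<and> neg_definite (riccati_expr A B G \<Gamma> H))
    \<longleftrightarrow> (\<forall>\<omega>::real. s_count n (riccati_hamiltonian A B G \<Gamma>) \<omega> \<ge> 0)"
proof -
  let ?K = "inv_mat \<Gamma>"
  let ?D = "B * ?K * mat_adjoint B"
  note B = assms(3)
  note K = inv_mat_hermitian[OF assms(4,6,7)]
  note Ba = mat_adjoint_carrier[OF B]
  have D: "?D \<in> carrier_mat n n" by (rule mult_carrier_mat[OF mult_carrier_mat[OF B K(1)] Ba])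
  interpret riccati n A G ?D
    by (rule riccati.intro[OF assms(1,2) D assms(5) congruence_hermitian[OF B K]])
  have "riccati_expr A B G \<Gamma> H = ric H" if H: "H \<in> carrier_mat n n" for H
  proof -
    have "H * B * ?K * mat_adjoint B = H * (B * ?K) * mat_adjoint B"
      using assoc_mult_mat[OF H B K(1)] by simp
    also have "\<dots> = H * ?D" by (rule assoc_mult_mat[OF H mult_carrier_mat[OF B K(1)] Ba])
    finally show ?thesis by (simp only: riccati_expr_def)
  qed
  then have "(\<exists>H\<in>carrier_mat n n. hermitian_mat H \<and> neg_definite (riccati_expr A B G \<Gamma> H))
    \<longleftrightarrow> (\<exists>H\<in>carrier_mat n n. hermitian_mat H \<and> neg_definite (ric H))"
    by simp
  then show ?thesis unfolding solution_iff riccati_hamiltonian_def .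
qed

end
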